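(* Let $L$ be an extremal Type II lattice of rank $72$ (i.e., an even unimodular lattice of rank $72$ with minimum nonzero norm $8$), and let $x_0\in\Lambda_8(L)$. For $j\in\mathbb{Z}$ let $M_j=M_j(L;x_0)=|\{y\in\Lambda_{10}(L):\langle x_0,y\rangle=j\}|$. Then the multiplicities $M_0,\dots,M_5$ are independent of the choice of $x_0$ and are given by \[ \begin{aligned} M_0 &= 5723204788224,\\ M_1 &= 3708252979200,\\ M_2 &= 975222374400,\\ M_3 &= 93206937600,\\ M_4 &= 2595532800,\\ M_5 &= 13959168. \end{aligned} \] In particular, all six multiplicities are positive integers, and $M_0+2(M_1+M_2+M_3+M_4+M_5)=|\Lambda_{10}(L)|$.
   Context: A lattice of rank $n$ is a free $\mathbb{Z}$-module $L$ of rank $n$ equipped with a positive-definite inner product $\langle\cdot,\cdot\rangle\colon L\times L\to\mathbb{R}$. The norm of $x\in L$ is $\langle x,x\rangle$ (not its square root). A lattice is even if $\langle x,x\rangle\in 2\mathbb{Z}$ for all $x\in L$, and unimodular (self-dual) if $L=L^*$, where $L^*$ is the dual lattice. A Type II lattice is an even unimodular lattice. Its minimum nonzero norm is denoted $\min(L)$. For a Type II lattice of rank $n$ one has $\min(L)\le 2\lfloor n/24\rfloor+2$ (Mallows--Odlyzko--Sloane), and a Type II lattice attaining equality is called extremal; for $n=72$ this means $\min(L)=8$. For $j\ge 0$, $\Lambda_j(L)=\{x\in L:\langle x,x\rangle=j\}$. *)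

theory Defs
  imports "HOL-Analysis.Analysis"
begin

text \<open>
  A lattice is realised inside a real inner product space of arbitrary dimension as the integer
  span of a linearly independent set. The real span of \<open>L\<close> then plays the role of the
  tensor product of \<open>L\<close> with the reals, the inner product being positive definite there.
  The rank is a natural number that is independent of the ambient type.
\<close>

definition lattice_of_rank :: "nat \<Rightarrow> 'a::real_inner set \<Rightarrow> bool" where
  "lattice_of_rank n L \<longleftrightarrow>
    (\<exists>B. finite B \<and> independent B \<and> card B = n \<and>
         L = {\<Sum>b\<in>B. of_int (c b) *\<^sub>R b | c :: 'a \<Rightarrow> int. True})"

definition dual_lattice :: "'a::real_inner set \<Rightarrow> 'a set" where
  "dual_lattice L = {y \<in> span L. \<forall>x\<in>L. x \<bullet> y \<in> \<int>}"

definition unimodular_lattice :: "'a::real_inner set \<Rightarrow> bool" where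
  "unimodular_lattice L \<longleftrightarrow> L = dual_lattice L"

definition even_lattice :: "'a::real_inner set \<Rightarrow> bool" where
  "even_lattice L \<longleftrightarrow> (\<forall>x\<in>L. \<exists>k::int. x \<bullet> x = 2 * of_int k)"

definition type_II_lattice :: "nat \<Rightarrow> 'a::real_inner set \<Rightarrow> bool" where
  "type_II_lattice n L \<longleftrightarrow> lattice_of_rank n L \<and> even_lattice L \<and> unimodular_lattice L"

text \<open>
  Norms are squared lengths. The infimum below is attained for every lattice of positive rank,
  since lattices are discrete.
\<close>

definition min_norm :: "'a::real_inner set \<Rightarrow> real" where
  "min_norm L = Inf {x \<bullet> x | x. x \<in> L \<and> x \<noteq> 0}"

definition extremal_type_II_lattice :: "nat \<Rightarrow> 'a::real_inner set \<Rightarrow> bool" where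
  "extremal_type_II_lattice n L \<longleftrightarrow>
    type_II_lattice n L \<and> min_norm L = 2 * of_int \<lfloor>real n / 24\<rfloor> + 2"

definition shell :: "real \<Rightarrow> 'a::real_inner set \<Rightarrow> 'a set" where
  "shell j L = {x \<in> L. x \<bullet> x = j}"

definition shell10_mult :: "'a::real_inner set \<Rightarrow> 'a \<Rightarrow> int \<Rightarrow> nat" where
  "shell10_mult L x\<^sub>0 j = card {y \<in> shell 10 L. x\<^sub>0 \<bullet> y = of_int j}"

end

theory Submission
  imports Defs "HOL-Probability.Probability" "HOL-Complex_Analysis.Complex_Analysis"
begin

text \<open>
  Let \<open>u, w\<close> in the span of \<open>L\<close> be orthogonal and of equal length, so that \<open>c = u + \<i> w\<close> is isotropic.
  Poisson summation, with a shift along \<open>w\<close> and a character along \<open>u\<close>, shows that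
  \<open>A(q) = \<Sum>x\<in>L. \<langle>c, x\<rangle>^d q^(x \<bullet> x / 2)\<close> transforms under inversion with weight \<open>36 + d\<close>; no harmonic
  projection is needed because the Gaussian factor \<open>exp (\<langle>c, c\<rangle> \<dots>)\<close> is trivial. As \<open>L\<close> has minimum 8,
  \<open>A\<close> vanishes to order 4 at \<open>q = 0\<close>. Dividing by a power of the discriminant \<open>q P(q)^24\<close>, which has no
  zeros for \<open>0 < norm q < 1\<close>, gives an invariant function vanishing at \<open>q = 0\<close> when \<open>0 < d < 12\<close>; since
  every point of the upper half-plane can be moved to \<open>Im \<tau> \<ge> 1/2\<close>, the maximum modulus principle makes
  it constant, so \<open>A = 0\<close>.

  Hence \<open>\<langle>c, x\<rangle>^d\<close> sums to 0 over each shell. For \<open>u\<close> parallel to \<open>x\<^sub>0\<close> this is a polynomial identity in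
  \<open>w \<bottom> x\<^sub>0\<close>, and applying the Laplacian in \<open>w\<close> removes \<open>w\<close>: zonal harmonics of degrees 2, 4, 6, 8, 10
  sum to 0 over each shell. On the shell of norm 8 inner products with \<open>x\<^sub>0\<close> other than 8 and -8 have absolute
  value at most 4, and these five equations determine their distribution. On the shell of norm 10 they have
  absolute value at most 5, and the reflection \<open>y \<mapsto> x\<^sub>0 - y\<close> identifies \<open>M\<^sub>5\<close> with the number of vectors
  of norm 8 having inner product 3 with \<open>x\<^sub>0\<close>; the five equations then determine \<open>M\<^sub>0, \<dots>, M\<^sub>4\<close>.
\<close>

text \<open>The bound on the degree comes from weights: the discriminant to the fourth power
  vanishes to order 4 and has weight 48, so a cusp form of weight \<open>36 + d\<close> vanishing to
  order 4 must be 0 as long as \<open>d < 12\<close>. Hence the harmonics stop at degree 10 and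
  there are exactly five equations per shell. Counting unknowns explains the order of the two
  shells. In norm 8 the inner products 0 to 4 give five unknowns, and the known vectors
  \<open>x\<^sub>0\<close> and \<open>- x\<^sub>0\<close> make the system inhomogeneous. In norm 10
  there are six unknowns and only homogeneous equations, so the scale has to be imported from norm
  8. Transformation laws are proved only on the imaginary axis, where Poisson summation deals with
  real Gaussians; the identity theorem carries the quotient's invariance to the half-plane. The law
  of the discriminant has the same origin: its 24th root is a one-dimensional Gaussian sum, by the
  pentagonal number theorem.\<close>

section \<open>Poisson summation for Gaussians on the line\<close>

text \<open>Lebesgue's argument: the kernel \<open>T\<close> below exceeds 1 near \<open>x\<close> and is bounded by 1 in absolute value
  elsewhere on the period, so integrating \<open>h\<close> against its powers would give unbounded values if
  \<open>h x\<close> were nonzero.\<close>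

lemma fourier_uniqueness:
  fixes h :: "real \<Rightarrow> complex"
  assumes cont: "continuous_on UNIV h" and per: "\<And>x. h (x + 1) = h x"
    and coeff: "\<And>k::int. integral {0..1} (\<lambda>u. h u * cis (2 * pi * of_int k * u)) = 0"
  shows "h x = 0"
proof -
  have inner: "h x = 0" if x: "0 < x" "x < 1" for x
  proof (rule ccontr)
    assume nz: "h x \<noteq> 0"
    \<comment> \<open>Rotating by \<open>cnj (h x)\<close> makes the value at \<open>x\<close> real
      and positive, so growth can be read off a real integral.\<close>
    define g where "g u = Re (h u * cnj (h x))" for u
    have gc: "continuous_on A g" for A
      unfolding g_def using continuous_on_subset[OF cont] by (auto intro!: continuous_intros)
    have gx: "g x > 0"
      using nz by (simp add: g_def complex_mult_cnj power2_eq_square[symmetric] sum_power2_gt_zero_iff complex_eq_iff)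
    define c where "c = g x / 2"
    have "c > 0" using gx by (simp add: c_def)
    obtain d0 where d0: "d0 > 0" "\<And>u. \<bar>u - x\<bar> < d0 \<Longrightarrow> \<bar>g u - g x\<bar> < c"
      using gc[of UNIV] \<open>c > 0\<close> unfolding continuous_on_iff dist_real_def by (metis UNIV_I)
    \<comment> \<open>\<open>d0 / 2\<close> keeps \<open>g\<close> above half of \<open>g x\<close>;
      the bounds by \<open>x\<close> and \<open>1 - x\<close> keep the window inside the period and
      all other points at distance at least \<open>\<delta>\<close> from \<open>x\<close> modulo 1;
      \<open>1 / 4\<close> keeps the angle \<open>2 * pi * \<delta>\<close> in the range where
      cosine decreases.\<close>
    define \<delta> where "\<delta> = Min {d0 / 2, x, 1 - x, 1 / 4}"
    have \<delta>: "\<delta> > 0" "\<delta> < d0" "\<delta> \<le> x" "\<delta> \<le> 1 - x" "\<delta> \<le> 1 / 4"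
      using x d0 by (auto simp: \<delta>_def min_def)
    have gc': "g u \<ge> c" if "\<bar>u - x\<bar> \<le> \<delta>" for u
      using d0(2)[of u] that \<delta> unfolding c_def by (simp only: abs_less_iff) (simp add: field_simps abs_le_iff)
    define T where "T u = 1 - cos (2 * pi * \<delta>) + cos (2 * pi * (u - x))" for u
    define \<eta> where "\<eta> = cos (pi * \<delta>) - cos (2 * pi * \<delta>)"
    have \<eta>: "\<eta> > 0" unfolding \<eta>_def using \<delta> by (simp add: cos_monotone_0_pi)
    have cosabs: "cos (2 * pi * (u - x)) = cos (2 * pi * \<bar>u - x\<bar>)" for u
      by (cases "u \<ge> x") (auto simp: abs_if, metis cos_minus minus_diff_eq mult_minus_right)
    have T1: "T u \<ge> 1 + \<eta>" if "\<bar>u - x\<bar> \<le> \<delta> / 2" for u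
    proof -
      have "cos (2 * pi * \<bar>u - x\<bar>) \<ge> cos (pi * \<delta>)"
        using that \<delta> by (intro cos_monotone_0_pi_le) (auto simp: mult_left_mono)
      then show ?thesis unfolding T_def \<eta>_def cosabs by simp
    qed
    have T2: "T u \<ge> 1" if "\<bar>u - x\<bar> \<le> \<delta>" for u
    proof -
      have "cos (2 * pi * \<bar>u - x\<bar>) \<ge> cos (2 * pi * \<delta>)"
        using that \<delta> by (intro cos_monotone_0_pi_le) (auto simp: mult_left_mono)
      then show ?thesis unfolding T_def cosabs by simp
    qed
    have T3: "\<bar>T u\<bar> \<le> 1" if "\<bar>u - x\<bar> \<ge> \<delta>" "u \<in> {0..1}" for u
    proof -
      have *: "\<bar>u - x\<bar> \<le> 1 - \<delta>" using that x \<delta> by auto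
      have "cos (2 * pi * \<bar>u - x\<bar>) \<le> cos (2 * pi * \<delta>)"
      proof (cases "\<bar>u - x\<bar> \<le> 1 / 2")
        case True
        then show ?thesis using that \<delta> by (intro cos_monotone_0_pi_le) (auto simp: mult_left_mono)
      next
        case False
        have "cos (2 * pi * \<bar>u - x\<bar>) = cos (2 * pi * (1 - \<bar>u - x\<bar>))"
          by (simp add: right_diff_distrib cos_diff)
        also have "\<dots> \<le> cos (2 * pi * \<delta>)"
          using False * \<delta> by (intro cos_monotone_0_pi_le) (auto simp: mult_left_mono)
        finally show ?thesis .
      qed
      moreover have "cos (2 * pi * (u - x)) \<ge> -1" "cos (2 * pi * \<delta>) \<le> 1" by auto
      ultimately show ?thesis unfolding T_def cosabs by linarith
    qed
    have Tc: "continuous_on A T" for A unfolding T_def by (intro continuous_intros)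
    \<comment> \<open>\<open>T\<close> is a trigonometric polynomial with frequencies -1, 0, 1, so
      multiplication by it only mixes neighbouring Fourier coefficients; by induction all
      coefficients of \<open>h\<close> times any power of \<open>T\<close> vanish.\<close>
    have Tcis: "of_real (T u) * cis (2 * pi * of_int k * u) =
        of_real (1 - cos (2 * pi * \<delta>)) * cis (2 * pi * of_int k * u)
        + cis (- 2 * pi * x) / 2 * cis (2 * pi * of_int (k + 1) * u)
        + cis (2 * pi * x) / 2 * cis (2 * pi * of_int (k - 1) * u)" for u k
    proof -
      have "complex_of_real (cos y) = (cis y + cis (- y)) / 2" for y
        by (simp add: complex_eq_iff)
      then have "complex_of_real (T u) = of_real (1 - cos (2 * pi * \<delta>))
          + (cis (2 * pi * (u - x)) + cis (- (2 * pi * (u - x)))) / 2" unfolding T_def by simp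
      moreover have "cis (2 * pi * (u - x)) * cis (2 * pi * of_int k * u) = cis (- 2 * pi * x) * cis (2 * pi * of_int (k + 1) * u)"
        "cis (- (2 * pi * (u - x))) * cis (2 * pi * of_int k * u) = cis (2 * pi * x) * cis (2 * pi * of_int (k - 1) * u)"
        by (simp_all add: cis_mult algebra_simps)
      ultimately show ?thesis by (simp add: ring_distribs add_divide_distrib)
    qed
    have hTc: "(\<lambda>u. h u * of_real (T u) ^ n * cis (2 * pi * of_int k * u)) integrable_on {0..1}" for n and k :: int
      by (intro integrable_continuous_real continuous_intros continuous_on_subset[OF cont]) (auto simp: T_def intro!: continuous_intros)
    have zero: "integral {0..1} (\<lambda>u. h u * of_real (T u) ^ n * cis (2 * pi * of_int k * u)) = 0" for n and k :: int
    proof (induction n arbitrary: k)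
      case 0
      then show ?case using coeff by simp
    next
      case (Suc n)
      let ?F = "\<lambda>k u. h u * of_real (T u) ^ n * cis (2 * pi * of_int k * u)"
      have "(\<lambda>u. h u * of_real (T u) ^ Suc n * cis (2 * pi * of_int k * u)) = (\<lambda>u.
         of_real (1 - cos (2 * pi * \<delta>)) * ?F k u + cis (- 2 * pi * x) / 2 * ?F (k + 1) u + cis (2 * pi * x) / 2 * ?F (k - 1) u)"
      proof
        fix u
        have "h u * of_real (T u) ^ Suc n * cis (2 * pi * of_int k * u) = h u * of_real (T u) ^ n * (of_real (T u) * cis (2 * pi * of_int k * u))"
          by simp
        then show "h u * of_real (T u) ^ Suc n * cis (2 * pi * of_int k * u) = of_real (1 - cos (2 * pi * \<delta>)) * ?F k u + cis (- 2 * pi * x) / 2 * ?F (k + 1) u + cis (2 * pi * x) / 2 * ?F (k - 1) u"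
          unfolding Tcis by (simp add: algebra_simps)
      qed
      moreover have "(?F j has_integral 0) {0..1}" for j
        using hTc[of n j] Suc[of j] by (metis has_integral_integral)
      then have "((\<lambda>u. of_real (1 - cos (2 * pi * \<delta>)) * ?F k u + cis (- 2 * pi * x) / 2 * ?F (k + 1) u
          + cis (2 * pi * x) / 2 * ?F (k - 1) u) has_integral
          (of_real (1 - cos (2 * pi * \<delta>)) * 0 + cis (- 2 * pi * x) / 2 * 0 + cis (2 * pi * x) / 2 * 0)) {0..1}"
        by (intro has_integral_add has_integral_mult_right)
      ultimately have "((\<lambda>u. h u * of_real (T u) ^ Suc n * cis (2 * pi * of_int k * u)) has_integral 0) {0..1}" by simp
      then show ?case by (rule integral_unique)
    qed
    have gz: "integral {0..1} (\<lambda>u. g u * T u ^ n) = 0" for n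
    proof -
      have "integral {0..1} (\<lambda>u. cnj (h x) * (h u * of_real (T u) ^ n)) = 0"
        using zero[of n 0] hTc[of n 0] by (subst integral_mult_right) auto
      moreover have "(\<lambda>u. cnj (h x) * (h u * of_real (T u) ^ n)) integrable_on {0..1}"
        using hTc[of n 0] by (intro integrable_on_mult_right) auto
      ultimately have "((\<lambda>u. cnj (h x) * (h u * of_real (T u) ^ n)) has_integral 0) {0..1}"
        by (metis has_integral_integral)
      then have "((\<lambda>u. Re (cnj (h x) * (h u * of_real (T u) ^ n))) has_integral Re 0) {0..1}"
        by (rule has_integral_Re)
      moreover have "Re (cnj (h x) * (h u * of_real (T u) ^ n)) = g u * T u ^ n" for u
        by (simp add: g_def mult_ac flip: of_real_power) (simp add: algebra_simps)
      ultimately show ?thesis by (simp add: integral_unique)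
    qed
    obtain M where M: "M \<ge> 0" "\<And>u. u \<in> {0..1} \<Longrightarrow> \<bar>g u\<bar> \<le> M"
    proof -
      have "bounded (g ` {0..1})" by (intro compact_imp_bounded compact_continuous_image gc) auto
      then obtain B where "\<forall>y\<in>g ` {0..1}. norm y \<le> B" unfolding bounded_iff by blast
      then show ?thesis by (intro that[of "max B 0"]) (auto simp: le_max_iff_disj)
    qed
    have lower: "g u * T u ^ n \<ge> - M + (if u \<in> {x - \<delta> / 2..x + \<delta> / 2} then c * (1 + \<eta>) ^ n else 0)"
      if u: "u \<in> {0..1}" for u n
    proof -
      consider "\<bar>u - x\<bar> \<le> \<delta> / 2" | "\<bar>u - x\<bar> > \<delta> / 2" "\<bar>u - x\<bar> \<le> \<delta>" | "\<bar>u - x\<bar> \<ge> \<delta>" using \<delta> by linarith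
      then show ?thesis
      proof cases
        case 1
        have "(1 + \<eta>) ^ n \<le> T u ^ n" using T1[OF 1] \<eta> by (intro power_mono) auto
        then have "c * (1 + \<eta>) ^ n \<le> g u * T u ^ n"
          using gc'[of u] 1 \<delta> \<open>c > 0\<close> \<eta> by (intro mult_mono) auto
        moreover have "u \<in> {x - \<delta> / 2..x + \<delta> / 2}" using 1 by (simp only: atLeastAtMost_iff) linarith
        ultimately show ?thesis using M(1) by simp
      next
        case 2
        have "0 \<le> g u * T u ^ n" using gc'[of u] T2[of u] 2 \<open>c > 0\<close> by (intro mult_nonneg_nonneg) auto
        then show ?thesis using M(1) 2 by (auto simp: abs_if split: if_splits)
      next
        case 3
        have "\<bar>g u * T u ^ n\<bar> \<le> M * 1"
          unfolding abs_mult power_abs using M u T3[of u] 3 by (intro mult_mono power_le_one) auto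
        then show ?thesis using 3 \<delta> by (auto simp: abs_if split: if_splits)
      qed
    qed
    \<comment> \<open>The half-width window, of length \<open>\<delta>\<close>, contributes
      exponential growth in \<open>n\<close>, the rest of the period at worst \<open>- M\<close>,
      while the integral is 0.\<close>
    have key: "0 \<ge> - M + c * (1 + \<eta>) ^ n * \<delta>" for n
    proof -
      let ?K = "c * (1 + \<eta>) ^ n"
      have "((\<lambda>u. ?K) has_integral (?K * \<delta>)) {x - \<delta> / 2..x + \<delta> / 2}"
        using has_integral_const_real[of ?K "x - \<delta> / 2" "x + \<delta> / 2"] \<delta> by (simp add: mult.commute)
      then have "((\<lambda>u. if u \<in> {x - \<delta> / 2..x + \<delta> / 2} then ?K else 0) has_integral (?K * \<delta>)) {0..1}"
        using \<delta> by (subst has_integral_restrict) auto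
      moreover have "((\<lambda>u. - M) has_integral (- M)) {0..1::real}"
        using has_integral_const_real[of "- M" 0 1] by simp
      ultimately have "((\<lambda>u. - M + (if u \<in> {x - \<delta> / 2..x + \<delta> / 2} then ?K else 0)) has_integral (- M + ?K * \<delta>)) {0..1}"
        by (intro has_integral_add)
      moreover have "((\<lambda>u. g u * T u ^ n) has_integral 0) {0..1}"
        using gz[of n] by (metis has_integral_integral integrable_continuous_real continuous_on_mult gc Tc continuous_on_power)
      ultimately show ?thesis by (rule has_integral_le) (use lower in auto)
    qed
    obtain n where "(M + 1) / (c * \<delta>) < (1 + \<eta>) ^ n"
      using real_arch_pow[of "1 + \<eta>"] \<eta> by auto
    then have "M + 1 < c * (1 + \<eta>) ^ n * \<delta>"
      using \<open>c > 0\<close> \<delta> by (simp add: divide_simps mult_ac)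
    with key[of n] show False by linarith
  qed
  have unit: "h x = 0" if x: "x \<in> {0..1}" for x
  proof -
    have "closure {0<..<1::real} = {0..1}" by simp
    moreover have "closed {x. h x = 0}"
      using continuous_closed_preimage_constant[OF cont, of 0] by simp
    moreover have "{0<..<1} \<subseteq> {x. h x = 0}" using inner by auto
    ultimately have "{0..1} \<subseteq> {x. h x = 0}" by (metis closure_minimal)
    then show ?thesis using x by auto
  qed
  have shift: "h (x + of_int k) = h x" for x and k :: int
  proof (induction k rule: int_induct[where k = 0])
    case (step1 i)
    then show ?case using per[of "x + of_int i"] by (simp add: add_ac)
  next
    case (step2 i)
    then show ?case using per[of "x + of_int (i - 1)"] by (simp add: algebra_simps)
  qed simp
  have "h x = h (frac x)" using shift[of "frac x" "\<lfloor>x\<rfloor>"] by (simp add: frac_def)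
  also have "\<dots> = 0" by (rule unit) (auto simp: frac_lt_1 less_imp_le)
  finally show ?thesis .
qed

text \<open>Rescaling by \<open>c = sqrt (2 * pi * s)\<close> turns the integrand into a multiple of
  the standard normal density times a character, so the value is the characteristic function of the
  standard normal distribution at \<open>2 * pi * v / c\<close>.\<close>

lemma gaussian_fourier_transform:
  fixes s v :: real
  assumes "s > 0"
  shows "integrable lborel (\<lambda>x. of_real (exp (- pi * s * x\<^sup>2)) * cis (2 * pi * x * v))" (is ?A)
    and "(\<integral>x. of_real (exp (- pi * s * x\<^sup>2)) * cis (2 * pi * x * v) \<partial>lborel)
         = of_real (exp (- pi * v\<^sup>2 / s) / sqrt s)" (is ?B)
proof -
  define c where "c = sqrt (2 * pi * s)"
  have c: "c > 0" "c\<^sup>2 = 2 * pi * s" unfolding c_def using assms by auto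
  have c3: "c = sqrt (2 * pi) * sqrt s" by (simp add: c_def real_sqrt_mult)
  define t where "t = 2 * pi * v / c"
  define f where "f x = of_real (std_normal_density x) * iexp (t * x)" for x
  have [measurable]: "(\<lambda>x. iexp (t * x)) \<in> borel_measurable borel"
    by (intro borel_measurable_continuous_onI continuous_intros)
  have fm: "f \<in> borel_measurable lborel" unfolding f_def[abs_def] by measurable
  have fi: "integrable lborel f"
  proof (rule Bochner_Integration.integrable_bound)
    show "integrable lborel std_normal_density" by simp
    show "AE x in lborel. norm (f x) \<le> norm (std_normal_density x)"
      by (auto simp: f_def norm_mult)
  qed (rule fm)
  have "of_real (exp (- t\<^sup>2 / 2)) = char std_normal_distribution t"
    by (simp add: char_std_normal_distribution)
  also have "\<dots> = (\<integral>x. f x \<partial>lborel)"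
    unfolding char_def f_def by (subst integral_density) (auto simp: scaleR_conv_of_real)
  also have "\<dots> = \<bar>c\<bar> *\<^sub>R (\<integral>x. f (0 + c * x) \<partial>lborel)"
    using c by (intro lborel_integral_real_affine) auto
  finally have I: "of_real (exp (- t\<^sup>2 / 2)) = c *\<^sub>R (\<integral>x. f (c * x) \<partial>lborel)" using c by simp
  have fc: "f (c * x) = of_real (1 / sqrt (2 * pi)) * (of_real (exp (- pi * s * x\<^sup>2)) * cis (2 * pi * x * v))" for x
  proof -
    have "std_normal_density (c * x) = 1 / sqrt (2 * pi) * exp (- pi * s * x\<^sup>2)"
      unfolding std_normal_density_def power_mult_distrib c(2) by simp
    moreover have "t * (c * x) = 2 * pi * x * v" using c(1) by (simp add: t_def)
    ultimately have "f (c * x) = of_real (1 / sqrt (2 * pi) * exp (- pi * s * x\<^sup>2)) * cis (2 * pi * x * v)"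
      unfolding f_def by (simp only: cis_conv_exp)
    then show ?thesis by simp
  qed
  have "integrable lborel (\<lambda>x. f (0 + c * x))" using c by (intro lborel_integrable_real_affine fi) auto
  then have "integrable lborel (\<lambda>x. of_real (sqrt (2 * pi)) * f (c * x))" by simp
  then show ?A unfolding fc by (simp flip: of_real_mult)
  have "(exp (- t\<^sup>2 / 2)) = exp (- pi * v\<^sup>2 / s)"
    using c assms by (simp add: t_def power_divide power_mult_distrib power2_eq_square)
  then have E: "of_real (exp (- pi * v\<^sup>2 / s)) = c *\<^sub>R (\<integral>x. f (c * x) \<partial>lborel)"
    unfolding I[symmetric] by simp
  have "c *\<^sub>R (\<integral>x. f (c * x) \<partial>lborel) = of_real (sqrt s) * (\<integral>x. of_real (exp (- pi * s * x\<^sup>2)) * cis (2 * pi * x * v) \<partial>lborel)"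
  proof -
    have "(\<integral>x. f (c * x) \<partial>lborel) = of_real (1 / sqrt (2 * pi)) * (\<integral>x. of_real (exp (- pi * s * x\<^sup>2)) * cis (2 * pi * x * v) \<partial>lborel)"
      unfolding fc by (rule integral_mult_right_zero)
    then show ?thesis unfolding c3 by (simp add: scaleR_conv_of_real)
  qed
  then show ?B using assms unfolding E[symmetric] of_real_divide by simp
qed

section \<open>Gaussian sums over the integers and periodization\<close>

lemma summable_on_intI:
  fixes f :: "int \<Rightarrow> real"
  assumes "\<And>m. f m \<ge> 0" "summable (\<lambda>n. f (int n))" "summable (\<lambda>n. f (- int n))"
  shows "f summable_on UNIV"
proof -
  have "(f \<circ> int) summable_on UNIV" "(f \<circ> (\<lambda>n. - int n)) summable_on UNIV"
    unfolding o_def by (subst summable_on_UNIV_nonneg_real_iff; use assms in simp)+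
  moreover have "inj int" "inj (\<lambda>n. - int n)" by (auto intro: injI)
  ultimately have 1: "f summable_on range int" and 2: "f summable_on range (\<lambda>n. - int n)"
    by (simp_all only: summable_on_reindex)
  have "m \<in> range int \<union> range (\<lambda>n. - int n)" for m
    by (cases m rule: int_cases2) auto
  then have "range int \<union> range (\<lambda>n. - int n) = (UNIV :: int set)" by blast
  then show ?thesis using summable_on_union[OF 1 2] by (simp only:)
qed

lemma gaussian_int_majorant:
  fixes a :: real
  assumes "a > 0"
  shows "(\<lambda>m::int. exp (- a * (of_int m)\<^sup>2)) summable_on UNIV"
proof (rule summable_on_intI)
  have "summable (\<lambda>n. exp (- a * (real n)\<^sup>2))"
  proof (rule summable_comparison_test')
    show "summable (\<lambda>n. exp (- a) ^ n)" using assms by (intro summable_geometric) auto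
    show "norm (exp (- a * (real n)\<^sup>2)) \<le> exp (- a) ^ n" if "n \<ge> 0" for n
    proof -
      have "real n \<le> (real n)\<^sup>2" by (cases n) (auto simp: power2_eq_square)
      then show ?thesis using assms by (simp flip: exp_of_nat_mult)
    qed
  qed
  then show "summable (\<lambda>n. exp (- a * (of_int (int n))\<^sup>2))" "summable (\<lambda>n. exp (- a * (of_int (- int n))\<^sup>2))" by simp_all
qed simp

text \<open>From \<open>m^2 \<le> 2 (y + m)^2 + 2 y^2\<close>. Giving up half of the exponent buys a
  majorant independent of \<open>y\<close> on bounded sets, as the Weierstrass test
  requires.\<close>

lemma gaussian_int_bound:
  fixes a R y :: real
  assumes "a > 0" "\<bar>y\<bar> \<le> R"
  shows "exp (- a * (y + of_int m)\<^sup>2) \<le> exp (a * R\<^sup>2) * exp (- (a / 2) * (of_int m)\<^sup>2)"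
proof -
  have "(of_int m)\<^sup>2 \<le> 2 * (y + of_int m)\<^sup>2 + 2 * y\<^sup>2"
    using zero_le_power2[of "2 * y + of_int m"] by (simp add: power2_eq_square algebra_simps)
  moreover have "y\<^sup>2 \<le> R\<^sup>2" using assms(2) abs_le_square_iff[of y R] by auto
  ultimately have "a * (of_int m)\<^sup>2 \<le> a * (2 * (y + of_int m)\<^sup>2 + 2 * R\<^sup>2)"
    using assms(1) by (intro mult_left_mono) auto
  then show ?thesis by (simp add: exp_add[symmetric] algebra_simps)
qed

lemma gaussian_int_summable:
  fixes a :: real
  assumes "a > 0"
  shows "(\<lambda>m::int. exp (- a * (y + of_int m)\<^sup>2)) summable_on UNIV"
proof (rule summable_on_comparison_test)
  show "(\<lambda>m::int. exp (a * \<bar>y\<bar>\<^sup>2) * exp (- (a / 2) * (of_int m)\<^sup>2)) summable_on UNIV"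
    using assms by (intro summable_on_cmult_right gaussian_int_majorant) auto
qed (use gaussian_int_bound[OF assms order.refl] in auto)

text \<open>The left side depends on \<open>y\<close> only modulo 1, so \<open>frac y\<close> may
  replace it. Uniformity in \<open>y\<close> is what later makes the sums over the fibres of a
  projected lattice summable.\<close>

lemma gaussian_int_sum_le:
  fixes a :: real
  assumes "a > 0"
  shows "(\<Sum>\<^sub>\<infinity>m::int. exp (- a * (y + of_int m)\<^sup>2)) \<le> exp a * (\<Sum>\<^sub>\<infinity>m::int. exp (- (a / 2) * (of_int m)\<^sup>2))"
proof -
  have "(\<Sum>\<^sub>\<infinity>m::int. exp (- a * (y + of_int m)\<^sup>2)) = (\<Sum>\<^sub>\<infinity>m::int. exp (- a * (frac y + of_int m)\<^sup>2))"
    by (rule infsum_reindex_bij_witness[of _ "\<lambda>m. m - \<lfloor>y\<rfloor>" "\<lambda>m. m + \<lfloor>y\<rfloor>"]) (auto simp: frac_def algebra_simps)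
  also have "\<dots> \<le> (\<Sum>\<^sub>\<infinity>m::int. exp a * exp (- (a / 2) * (of_int m)\<^sup>2))"
  proof (rule infsum_mono)
    show "(\<lambda>m::int. exp a * exp (- (a / 2) * (of_int m)\<^sup>2)) summable_on UNIV"
      using assms by (intro summable_on_cmult_right gaussian_int_majorant) auto
    show "exp (- a * (frac y + of_int m)\<^sup>2) \<le> exp a * exp (- (a / 2) * (of_int m)\<^sup>2)" for m
      using gaussian_int_bound[OF assms, of "frac y" 1 m] frac_lt_1[of y] frac_ge_0[of y] by simp
  qed (rule gaussian_int_summable[OF assms])
  also have "\<dots> = exp a * (\<Sum>\<^sub>\<infinity>m::int. exp (- (a / 2) * (of_int m)\<^sup>2))"
    by (rule infsum_cmult_right') 
  finally show ?thesis .
qed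

lemma filterlim_finite_subsets_at_top_UNIV:
  assumes "\<And>n::nat. finite (A n)" "\<And>x. \<forall>\<^sub>F n in sequentially. x \<in> A n"
  shows "filterlim A (finite_subsets_at_top UNIV) sequentially"
  unfolding filterlim_finite_subsets_at_top
proof (intro allI impI)
  fix X :: "'a set" assume X: "finite X \<and> X \<subseteq> UNIV"
  then have "\<forall>\<^sub>F n in sequentially. \<forall>x\<in>X. x \<in> A n"
    using assms(2) by (simp add: eventually_ball_finite)
  then show "\<forall>\<^sub>F n in sequentially. finite (A n) \<and> X \<subseteq> A n \<and> A n \<subseteq> UNIV"
    by eventually_elim (use assms(1) in auto)
qed

text \<open>Half-open, because the cells [m, m + 1] for m from -n to n - 1 tile exactly
  [-n, n].\<close>

lemma filterlim_int_intervals: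
  "filterlim (\<lambda>n::nat. {- int n..<int n}) (finite_subsets_at_top UNIV) sequentially"
proof (rule filterlim_finite_subsets_at_top_UNIV)
  fix x :: int
  show "\<forall>\<^sub>F n in sequentially. x \<in> {- int n..<int n}"
    using eventually_ge_at_top[of "nat (\<bar>x\<bar> + 1)"] by eventually_elim auto
qed simp

text \<open>The unit cells tile the line: uniform convergence moves the sum out of the integral over
  one period, partial sums combine into integrals over \<open>{- real n..real n}\<close>, and
  dominated convergence gives the integral over the line.\<close>

lemma integral_periodization:
  fixes F :: "real \<Rightarrow> complex" and M :: "int \<Rightarrow> real"
  assumes cont: "continuous_on UNIV F" and int: "integrable lborel F"
    and M: "M summable_on UNIV" "\<And>m u. u \<in> {0..1} \<Longrightarrow> norm (F (u + of_int m)) \<le> M m"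
  shows "integral {0..1} (\<lambda>u. \<Sum>\<^sub>\<infinity>m::int. F (u + of_int m)) = (\<integral>x. F x \<partial>lborel)"
proof -
  have cont': "continuous_on A (\<lambda>u. F (u + of_int m))" for A m
    by (intro continuous_on_compose2[OF cont] continuous_intros) auto
  obtain I J where I: "\<And>X. ((\<lambda>u. \<Sum>m\<in>X. F (u + of_int m)) has_integral I X) {0..1}"
    and J: "((\<lambda>u. \<Sum>\<^sub>\<infinity>m::int. F (u + of_int m)) has_integral J) {0..1}"
    and lim: "(I \<longlongrightarrow> J) (finite_subsets_at_top UNIV)"
  proof (rule uniform_limit_integral)
    show "uniform_limit {0..1} (\<lambda>X u. \<Sum>m\<in>X. F (u + of_int m)) (\<lambda>u. \<Sum>\<^sub>\<infinity>m::int. F (u + of_int m)) (finite_subsets_at_top UNIV)"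
      by (rule Weierstrass_m_test_general) (use M in auto)
  qed (auto intro!: continuous_on_sum cont')
  have "I {- int n..<int n} = integral {- real n..real n} F" for n
  proof -
    have "I {- int n..<int n} = (\<Sum>m\<in>{- int n..<int n}. integral {0..1} (\<lambda>u. F (u + of_int m)))"
      using has_integral_sum[of "{- int n..<int n}" "\<lambda>m u. F (u + of_int m)" "\<lambda>m. integral {0..1} (\<lambda>u. F (u + of_int m))" "{0..1}"]
        I[of "{- int n..<int n}"] by (metis (no_types, lifting) cont' finite_atLeastLessThan_int has_integral_integral has_integral_unique integrable_continuous_real)
    also have "\<dots> = integral {- real n..real n} F"
    proof (induction n)
      case (Suc n)
      have sh: "integral {0..1} (\<lambda>u. F (u + of_int m)) = integral {of_int m..of_int m + 1} F" for m
        using integral_shift[of 0 "of_int m" 1 F] continuous_on_subset[OF cont] by (simp add: o_def add_ac)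
      have ii: "F integrable_on {a..b}" for a b
        by (intro integrable_continuous_real continuous_on_subset[OF cont]) auto
      have set: "{- int (Suc n)..<int (Suc n)} = insert (- int (Suc n)) (insert (int n) {- int n..<int n})" by auto
      have "(\<Sum>m\<in>{- int (Suc n)..<int (Suc n)}. integral {0..1} (\<lambda>u. F (u + of_int m)))
         = integral {- 1 - real n..- real n} F + (integral {real n..1 + real n} F + integral {- real n..real n} F)"
        unfolding set using Suc sh[of "- int (Suc n)"] sh[of "int n"] by (simp add: algebra_simps)
      also have "\<dots> = integral {- 1 - real n..1 + real n} F"
        using Henstock_Kurzweil_Integration.integral_combine[where a = "- real n" and c = "real n" and b = "1 + real n" and f = F]
          Henstock_Kurzweil_Integration.integral_combine[where a = "- 1 - real n" and c = "- real n" and b = "1 + real n" and f = F] ii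
        by (simp add: add_ac)
      also have "\<dots> = integral {- real (Suc n)..real (Suc n)} F"
      proof -
        have "- 1 - real n = - real (Suc n)" "1 + real n = real (Suc n)" by simp_all
        then show ?thesis by (simp only:)
      qed
      finally show ?case .
    qed simp
    finally show ?thesis .
  qed
  moreover have "(\<lambda>n. I {- int n..<int n}) \<longlonglongrightarrow> J"
    using filterlim_compose[OF lim filterlim_int_intervals] .
  ultimately have 1: "(\<lambda>n. integral {- real n..real n} F) \<longlonglongrightarrow> J" by simp
  have "(\<lambda>n. \<integral>x. indicator {- real n..real n} x *\<^sub>R F x \<partial>lborel) \<longlonglongrightarrow> (\<integral>x. F x \<partial>lborel)"
  proof (rule integral_dominated_convergence[where w = "\<lambda>x. norm (F x)"])
    show "AE x in lborel. (\<lambda>n. indicator {- real n..real n} x *\<^sub>R F x) \<longlonglongrightarrow> F x"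
    proof (rule AE_I2, rule tendsto_eventually)
      fix x
      show "\<forall>\<^sub>F n in sequentially. indicator {- real n..real n} x *\<^sub>R F x = F x"
        using eventually_ge_at_top[of "nat \<lceil>\<bar>x\<bar>\<rceil>"] by eventually_elim (auto simp: indicator_def nat_le_iff ceiling_le_iff abs_le_iff)
    qed
  qed (use int in \<open>auto simp: indicator_def\<close>)
  moreover have "(\<integral>x. indicator {- real n..real n} x *\<^sub>R F x \<partial>lborel) = integral {- real n..real n} F" for n
  proof -
    have "set_integrable lborel {- real n..real n} F"
      unfolding set_integrable_def using int by (intro integrable_mult_indicator) auto
    then show ?thesis by (metis set_borel_integral_eq_integral(2) set_lebesgue_integral_def)
  qed
  ultimately have "J = (\<integral>x. F x \<partial>lborel)" using 1 LIMSEQ_unique by auto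
  then show ?thesis using J by (simp add: integral_unique)
qed

lemma fourier_series_continuous:
  fixes c :: "int \<Rightarrow> complex"
  assumes "(\<lambda>k. norm (c k)) summable_on UNIV"
  shows "continuous_on UNIV (\<lambda>u::real. \<Sum>\<^sub>\<infinity>k::int. c k * cis (2 * pi * of_int k * u))"
proof (rule uniform_limit_theorem)
  show "uniform_limit UNIV (\<lambda>X u. \<Sum>k\<in>X. c k * cis (2 * pi * of_int k * u)) (\<lambda>u. \<Sum>\<^sub>\<infinity>k::int. c k * cis (2 * pi * of_int k * u)) (finite_subsets_at_top UNIV)"
    by (rule Weierstrass_m_test_general[OF _ assms]) (auto simp: norm_mult)
qed (auto intro!: always_eventually continuous_intros)

text \<open>Termwise integration and orthogonality of characters; the index is \<open>- j\<close>
  because the test character is not conjugated.\<close>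

lemma fourier_series_coefficient:
  fixes c :: "int \<Rightarrow> complex"
  assumes "(\<lambda>k. norm (c k)) summable_on UNIV"
  shows "integral {0..1} (\<lambda>u. (\<Sum>\<^sub>\<infinity>k::int. c k * cis (2 * pi * of_int k * u)) * cis (2 * pi * of_int j * u)) = c (- j)"
proof -
  let ?e = "\<lambda>k::int. \<lambda>u::real. cis (2 * pi * of_int k * u)"
  have one: "(?e k has_integral (if k = 0 then 1 else 0)) {0..1}" for k
  proof (cases "k = 0")
    case True
    then show ?thesis using has_integral_const_real[of "1::complex" 0 1] by simp
  next
    case False
    let ?a = "2 * pi * of_int k"
    have "(?e k has_integral (cis (?a * 1) / (\<i> * ?a) - cis (?a * 0) / (\<i> * ?a))) {0..1}"
    proof (rule fundamental_theorem_of_calculus)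
      fix x :: real
      have "((\<lambda>x. exp (\<i> * of_real ?a * of_real x) / (\<i> * ?a)) has_vector_derivative exp (\<i> * of_real ?a * of_real x)) (at x within {0..1})"
        using False by (auto intro!: derivative_eq_intros has_vector_derivative_real_field)
      then show "((\<lambda>x. cis (?a * x) / (\<i> * ?a)) has_vector_derivative ?e k x) (at x within {0..1})"
        by (simp add: cis_conv_exp mult_ac)
    qed auto
    moreover have "cis (?a * 1) = 1" using cis_multiple_2pi[of "of_int k"] by simp
    ultimately show ?thesis using False by simp
  qed
  obtain I J where I: "\<And>X. ((\<lambda>u. \<Sum>k\<in>X. c k * ?e k u * ?e j u) has_integral I X) {0..1}"
    and J: "((\<lambda>u. (\<Sum>\<^sub>\<infinity>k. c k * ?e k u * ?e j u)) has_integral J) {0..1}"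
    and lim: "(I \<longlongrightarrow> J) (finite_subsets_at_top UNIV)"
  proof (rule uniform_limit_integral)
    show "uniform_limit {0..1} (\<lambda>X u. \<Sum>k\<in>X. c k * ?e k u * ?e j u) (\<lambda>u. \<Sum>\<^sub>\<infinity>k. c k * ?e k u * ?e j u) (finite_subsets_at_top UNIV)"
      by (rule Weierstrass_m_test_general[OF _ assms]) (auto simp: norm_mult)
  qed (auto intro!: continuous_intros)
  have "I X = c (- j)" if X: "finite X" "- j \<in> X" for X
  proof -
    have "((\<lambda>u. \<Sum>k\<in>X. c k * ?e (k + j) u) has_integral (\<Sum>k\<in>X. c k * (if k + j = 0 then 1 else 0))) {0..1}"
      by (intro has_integral_sum X has_integral_mult_right one)
    moreover have "?e k u * ?e j u = ?e (k + j) u" for k u by (simp add: cis_mult algebra_simps)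
    ultimately have "I X = (\<Sum>k\<in>X. c k * (if k + j = 0 then 1 else 0))"
      using I[of X] by (simp add: mult.assoc has_integral_unique)
    also have "\<dots> = (\<Sum>k\<in>{-j}. c k)"
      by (rule sum.mono_neutral_cong_right) (use X in auto)
    finally show ?thesis by simp
  qed
  then have "\<forall>\<^sub>F X in finite_subsets_at_top UNIV. I X = c (- j)"
    unfolding eventually_finite_subsets_at_top by (intro exI[of _ "{-j}"]) auto
  then have "(I \<longlongrightarrow> c (- j)) (finite_subsets_at_top UNIV)" by (rule tendsto_eventually)
  then have "J = c (- j)" using lim tendsto_unique by (metis finite_subsets_at_top_neq_bot)
  moreover have "(\<Sum>\<^sub>\<infinity>k. c k * ?e k u * ?e j u) = (\<Sum>\<^sub>\<infinity>k. c k * ?e k u) * ?e j u" for u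
    by (rule infsum_cmult_left')
  ultimately show ?thesis using J by (simp add: integral_unique)
qed

text \<open>As functions of \<open>x\<close>, the left side is the periodization of a Gaussian times
  a character and the right side a Fourier series; both are continuous with the same Fourier
  coefficients. The shift and the character are both kept since the induction over lattices produces
  both on each fibre.\<close>

theorem poisson_summation_gaussian:
  fixes s x w :: real
  assumes s: "s > 0"
  shows "(\<Sum>\<^sub>\<infinity>m::int. of_real (exp (- pi * s * (x + of_int m)\<^sup>2)) * cis (2 * pi * (x + of_int m) * w))
    = of_real (1 / sqrt s) * (\<Sum>\<^sub>\<infinity>k::int. of_real (exp (- pi * (of_int k - w)\<^sup>2 / s)) * cis (2 * pi * of_int k * x))"
proof -
  define G where "G x = complex_of_real (exp (- pi * s * x\<^sup>2)) * cis (2 * pi * x * w)" for x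
  define P where "P u = (\<Sum>\<^sub>\<infinity>m::int. G (u + of_int m))" for u
  define c where "c k = complex_of_real (exp (- pi * (of_int k - w)\<^sup>2 / s) / sqrt s)" for k :: int
  define r where "r u = (\<Sum>\<^sub>\<infinity>k::int. c k * cis (2 * pi * of_int k * u))" for u
  have Gc: "continuous_on A G" for A unfolding G_def by (intro continuous_intros)
  have Gn: "norm (G u) = exp (- (pi * s) * u\<^sup>2)" for u by (simp add: G_def norm_mult)
  have cs: "(\<lambda>k. norm (c k)) summable_on UNIV"
  proof -
    have "norm (c k) = (1 / sqrt s) * exp (- (pi / s) * (- w + of_int k)\<^sup>2)" for k
      using s by (simp add: c_def norm_divide)
    then show ?thesis using s by (simp only:) (intro summable_on_cmult_right gaussian_int_summable, simp)
  qed
  have Gsum: "(\<lambda>m::int. exp (pi * s * R\<^sup>2) * exp (- (pi * s / 2) * (of_int m)\<^sup>2)) summable_on UNIV" for R :: real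
    using s by (intro summable_on_cmult_right gaussian_int_majorant) auto
  have Gb: "norm (G (u + of_int m)) \<le> exp (pi * s * R\<^sup>2) * exp (- (pi * s / 2) * (of_int m)\<^sup>2)" if "\<bar>u\<bar> \<le> R" for u R m
    unfolding Gn using gaussian_int_bound[of "pi * s" u R m] that s by simp
  have Pc: "continuous_on UNIV P"
  proof -
    have "continuous_on {-R<..<R} P" for R unfolding P_def
    proof (rule uniform_limit_theorem)
      show "uniform_limit {-R<..<R} (\<lambda>X u. \<Sum>m\<in>X. G (u + of_int m)) (\<lambda>u. \<Sum>\<^sub>\<infinity>m::int. G (u + of_int m)) (finite_subsets_at_top UNIV)"
        by (rule Weierstrass_m_test_general[OF _ Gsum[of R]]) (use Gb[of _ R] in auto)
    qed (auto intro!: always_eventually continuous_on_sum continuous_on_compose2[OF Gc] continuous_intros)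
    then have "isCont P u" for u
      by (rule continuous_on_interior[of "{-(\<bar>u\<bar> + 1)<..<\<bar>u\<bar> + 1}"]) auto
    then show ?thesis by (simp add: continuous_at_imp_continuous_on)
  qed
  have rc: "continuous_on UNIV r" unfolding r_def by (rule fourier_series_continuous[OF cs])
  have "P x - r x = 0"
  proof (rule fourier_uniqueness[of "\<lambda>x. P x - r x"])
    show "continuous_on UNIV (\<lambda>x. P x - r x)" by (intro continuous_intros Pc rc)
    fix u
    have "P (u + 1) = P u" unfolding P_def
      by (rule infsum_reindex_bij_witness[of _ "\<lambda>m. m - 1" "\<lambda>m. m + 1"]) (auto simp: add_ac)
    moreover have "r (u + 1) = r u" unfolding r_def
    proof (rule infsum_cong)
      fix k :: int
      show "c k * cis (2 * pi * of_int k * (u + 1)) = c k * cis (2 * pi * of_int k * u)"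
        using cis_multiple_2pi[of "of_int k"] by (simp add: distrib_left flip: cis_mult)
    qed
    ultimately show "P (u + 1) - r (u + 1) = P u - r u" by simp
  next
    fix k :: int
    let ?e = "\<lambda>u::real. cis (2 * pi * of_int k * u)"
    have Ge: "G x * ?e x = of_real (exp (- pi * s * x\<^sup>2)) * cis (2 * pi * x * (w + of_int k))" for x
      unfolding G_def mult.assoc by (simp add: cis_mult algebra_simps)
    have "integral {0..1} (\<lambda>u. P u * ?e u) = integral {0..1} (\<lambda>u. \<Sum>\<^sub>\<infinity>m::int. G (u + of_int m) * ?e (u + of_int m))"
    proof (rule integral_cong)
      fix u :: real
      have "?e (u + of_int m) = ?e u" for m :: int
        using cis_multiple_2pi[of "of_int (k * m)"] by (simp add: distrib_left mult.assoc flip: cis_mult)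
      then show "P u * ?e u = (\<Sum>\<^sub>\<infinity>m::int. G (u + of_int m) * ?e (u + of_int m))"
        unfolding P_def by (simp add: infsum_cmult_left')
    qed
    also have "\<dots> = (\<integral>x. G x * ?e x \<partial>lborel)"
    proof (rule integral_periodization)
      show "continuous_on UNIV (\<lambda>x. G x * ?e x)" by (intro continuous_intros Gc)
      show "integrable lborel (\<lambda>x. G x * ?e x)"
        unfolding Ge by (rule gaussian_fourier_transform(1)[OF s])
      show "(\<lambda>m::int. exp (pi * s * 1\<^sup>2) * exp (- (pi * s / 2) * (of_int m)\<^sup>2)) summable_on UNIV" by (rule Gsum)
      show "norm (G (u + of_int m) * ?e (u + of_int m)) \<le> exp (pi * s * 1\<^sup>2) * exp (- (pi * s / 2) * (of_int m)\<^sup>2)"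
        if "u \<in> {0..1}" for m :: int and u :: real
        using Gb[of u 1 m] that by (simp add: norm_mult)
    qed
    also have "\<dots> = c (- k)"
      unfolding Ge gaussian_fourier_transform(2)[OF s] by (simp add: c_def power2_eq_square algebra_simps)
    finally have "integral {0..1} (\<lambda>u. P u * ?e u) = c (- k)" .
    moreover have "integral {0..1} (\<lambda>u. r u * ?e u) = c (- k)"
      unfolding r_def by (rule fourier_series_coefficient[OF cs])
    moreover have "continuous_on {0..1} (\<lambda>u. P u * ?e u)" "continuous_on {0..1} (\<lambda>u. r u * ?e u)"
      by (intro continuous_intros continuous_on_subset[OF Pc] continuous_on_subset[OF rc]; simp)+
    ultimately show "integral {0..1} (\<lambda>u. (P u - r u) * ?e u) = 0"
      unfolding left_diff_distrib by (subst integral_diff) (auto intro: integrable_continuous_real)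
  qed
  moreover have "r x = of_real (1 / sqrt s) * (\<Sum>\<^sub>\<infinity>k::int. of_real (exp (- pi * (of_int k - w)\<^sup>2 / s)) * cis (2 * pi * of_int k * x))"
    unfolding r_def c_def by (subst infsum_cmult_right'[symmetric]) (simp add: mult_ac)
  ultimately show ?thesis unfolding P_def G_def by simp
qed

section \<open>Poisson summation over lattices\<close>

text \<open>Bases are families indexed by the numbers below \<open>n\<close>, which allows induction
  on the rank by splitting off the last vector.\<close>

definition lin_indep :: "nat \<Rightarrow> (nat \<Rightarrow> 'a::real_inner) \<Rightarrow> bool" where
  "lin_indep n b \<longleftrightarrow> (\<forall>x. (\<Sum>i<n. x i *\<^sub>R b i) = 0 \<longrightarrow> (\<forall>i<n. x i = 0))"

definition rspan :: "nat \<Rightarrow> (nat \<Rightarrow> 'a::real_inner) \<Rightarrow> 'a set" where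
  "rspan n b = {\<Sum>i<n. x i *\<^sub>R b i | x :: nat \<Rightarrow> real. True}"

definition zspan :: "nat \<Rightarrow> (nat \<Rightarrow> 'a::real_inner) \<Rightarrow> 'a set" where
  "zspan n b = {\<Sum>i<n. of_int (c i) *\<^sub>R b i | c :: nat \<Rightarrow> int. True}"

definition zdual :: "nat \<Rightarrow> (nat \<Rightarrow> 'a::real_inner) \<Rightarrow> 'a set" where
  "zdual n b = {y \<in> rspan n b. \<forall>i<n. y \<bullet> b i \<in> \<int>}"

lemma rspan_0 [simp]: "rspan 0 b = {0}" and zspan_0 [simp]: "zspan 0 b = {0}"
  and zdual_0 [simp]: "zdual 0 b = {0}"
  by (auto simp: rspan_def zspan_def zdual_def)

lemma rspanI: "(\<Sum>i<n. x i *\<^sub>R b i) \<in> rspan n b"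
  and zspanI: "(\<Sum>i<n. of_int (c i) *\<^sub>R b i) \<in> zspan n b"
  unfolding rspan_def zspan_def by blast+

lemma rspan_add: "u \<in> rspan n b \<Longrightarrow> v \<in> rspan n b \<Longrightarrow> u + v \<in> rspan n b"
  unfolding rspan_def by (auto simp: sum.distrib[symmetric] scaleR_add_left[symmetric])

lemma rspan_scaleR: "u \<in> rspan n b \<Longrightarrow> r *\<^sub>R u \<in> rspan n b"
  unfolding rspan_def by (auto simp: scaleR_sum_right)

lemma rspan_diff: "u \<in> rspan n b \<Longrightarrow> v \<in> rspan n b \<Longrightarrow> u - v \<in> rspan n b"
  using rspan_add[of u n b "(-1) *\<^sub>R v"] rspan_scaleR[of v n b "-1"] by simp

lemma rspan_Suc_iff: "v \<in> rspan (Suc n) b \<longleftrightarrow> (\<exists>u\<in>rspan n b. \<exists>r. v = u + r *\<^sub>R b n)"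
proof
  assume "v \<in> rspan (Suc n) b"
  then show "\<exists>u\<in>rspan n b. \<exists>r. v = u + r *\<^sub>R b n" by (auto simp: rspan_def)
next
  assume "\<exists>u\<in>rspan n b. \<exists>r. v = u + r *\<^sub>R b n"
  then obtain x r where v: "v = (\<Sum>i<n. x i *\<^sub>R b i) + r *\<^sub>R b n" by (auto simp: rspan_def)
  have "(\<Sum>i<n. x i *\<^sub>R b i) = (\<Sum>i<n. (x(n := r)) i *\<^sub>R b i)" by (intro sum.cong) auto
  then show "v \<in> rspan (Suc n) b" unfolding rspan_def v by (auto intro!: exI[of _ "x(n := r)"])
qed

lemma zspan_Suc_iff: "v \<in> zspan (Suc n) b \<longleftrightarrow> (\<exists>u\<in>zspan n b. \<exists>m::int. v = u + of_int m *\<^sub>R b n)"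
proof
  assume "v \<in> zspan (Suc n) b"
  then show "\<exists>u\<in>zspan n b. \<exists>m::int. v = u + of_int m *\<^sub>R b n" by (auto simp: zspan_def)
next
  assume "\<exists>u\<in>zspan n b. \<exists>m::int. v = u + of_int m *\<^sub>R b n"
  then obtain x m where v: "v = (\<Sum>i<n. of_int (x i) *\<^sub>R b i) + of_int m *\<^sub>R b n" by (auto simp: zspan_def)
  have "(\<Sum>i<n. of_int (x i) *\<^sub>R b i) = (\<Sum>i<n. of_int ((x(n := m)) i) *\<^sub>R b i)" by (intro sum.cong) auto
  then show "v \<in> zspan (Suc n) b" unfolding zspan_def v by (auto intro!: exI[of _ "x(n := m)"])
qed

lemma zspan_subset_rspan: "zspan n b \<subseteq> rspan n b"
  by (auto simp: zspan_def intro: rspanI)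

lemma zdual_subset_rspan: "zdual n b \<subseteq> rspan n b"
  unfolding zdual_def by blast

lemma rspan_orthogonal: "v \<in> rspan n b \<Longrightarrow> (\<And>i. i < n \<Longrightarrow> b i \<bullet> e = 0) \<Longrightarrow> v \<bullet> e = 0"
  by (auto simp: rspan_def inner_sum_left)

lemma lin_indep_Suc:
  assumes "lin_indep (Suc n) b"
  shows "lin_indep n b" "b n \<notin> rspan n b"
proof -
  show "lin_indep n b" unfolding lin_indep_def
  proof (intro allI impI)
    fix x i assume "(\<Sum>i<n. x i *\<^sub>R b i) = 0" "i < n"
    then have "(\<Sum>i<Suc n. (if i < n then x i else 0) *\<^sub>R b i) = 0" by simp
    then show "x i = 0" using assms[unfolded lin_indep_def, rule_format, OF _ less_SucI[OF \<open>i < n\<close>]] \<open>i < n\<close> by fastforce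
  qed
  show "b n \<notin> rspan n b"
  proof
    assume "b n \<in> rspan n b"
    then obtain x where x: "b n = (\<Sum>i<n. x i *\<^sub>R b i)" by (auto simp: rspan_def)
    have "(\<Sum>i<n. (if i < n then x i else -1) *\<^sub>R b i) = (\<Sum>i<n. x i *\<^sub>R b i)" by (intro sum.cong) auto
    then have "(\<Sum>i<Suc n. (if i < n then x i else -1) *\<^sub>R b i) = 0" using x by simp
    then show False using assms[unfolded lin_indep_def, rule_format, OF _ lessI] by fastforce
  qed
qed

text \<open>Gram-Schmidt: a solution for the first \<open>n\<close> values is corrected by a
  multiple of \<open>u\<close>, the part of \<open>b n\<close> orthogonal to the earlier vectors,
  which changes only the last value and is nonzero by independence.\<close>

lemma exists_inner_functional:
  assumes "lin_indep n b"
  shows "\<exists>\<eta>\<in>rspan n b. \<forall>i<n. \<eta> \<bullet> b i = f i"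
  using assms
proof (induction n arbitrary: f)
  case (Suc n)
  note ind = lin_indep_Suc[OF Suc.prems]
  obtain \<zeta> where \<zeta>: "\<zeta> \<in> rspan n b" "\<And>i. i < n \<Longrightarrow> \<zeta> \<bullet> b i = b n \<bullet> b i" using Suc.IH[OF ind(1), of "\<lambda>i. b n \<bullet> b i"] by blast
  obtain \<eta> where \<eta>: "\<eta> \<in> rspan n b" "\<And>i. i < n \<Longrightarrow> \<eta> \<bullet> b i = f i" using Suc.IH[OF ind(1), of f] by blast
  define u where "u = b n - \<zeta>"
  have "u \<noteq> 0" using \<zeta>(1) ind(2) by (auto simp: u_def)
  have u0: "u \<bullet> b i = 0" if "i < n" for i using \<zeta>(2)[OF that] by (simp add: u_def inner_diff_left)
  have "\<zeta> \<bullet> u = 0" by (rule rspan_orthogonal[OF \<zeta>(1)]) (simp add: u0 inner_commute)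
  then have un: "u \<bullet> b n = u \<bullet> u" by (simp add: u_def inner_diff_right inner_commute)
  define r where "r = (f n - \<eta> \<bullet> b n) / (u \<bullet> u)"
  have "\<eta> + r *\<^sub>R u = (\<eta> - r *\<^sub>R \<zeta>) + r *\<^sub>R b n" by (simp add: u_def scaleR_diff_right)
  then have "\<eta> + r *\<^sub>R u \<in> rspan (Suc n) b"
    using rspan_diff[OF \<eta>(1) rspan_scaleR[OF \<zeta>(1)]] unfolding rspan_Suc_iff by metis
  moreover have "\<forall>i<Suc n. (\<eta> + r *\<^sub>R u) \<bullet> b i = f i"
    using \<eta>(2) u0 un \<open>u \<noteq> 0\<close> by (auto simp: less_Suc_eq inner_add_left r_def)
  ultimately show ?case by blast
qed auto

section \<open>Splitting off the last basis vector\<close>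

definition proj_perp :: "'a::real_inner \<Rightarrow> 'a \<Rightarrow> 'a" where
  "proj_perp e x = x - ((x \<bullet> e) / (e \<bullet> e)) *\<^sub>R e"

lemma proj_perp_orthogonal: "e \<noteq> 0 \<Longrightarrow> proj_perp e x \<bullet> e = 0"
  by (simp add: proj_perp_def inner_diff_left)

lemma lin_indep_proj_perp:
  assumes "lin_indep (Suc n) b"
  shows "lin_indep n (\<lambda>i. proj_perp (b n) (b i))"
  unfolding lin_indep_def
proof (intro allI impI)
  fix x i assume x: "(\<Sum>i<n. x i *\<^sub>R proj_perp (b n) (b i)) = 0" and "i < n"
  let ?r = "\<Sum>i<n. x i * ((b i \<bullet> b n) / (b n \<bullet> b n))"
  have "(\<Sum>i<n. x i *\<^sub>R proj_perp (b n) (b i)) = (\<Sum>i<n. x i *\<^sub>R b i) - ?r *\<^sub>R b n"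
    unfolding proj_perp_def by (simp add: scaleR_diff_right sum_subtractf scaleR_sum_left)
  moreover have "(\<Sum>i<n. (if i < n then x i else - ?r) *\<^sub>R b i) = (\<Sum>i<n. x i *\<^sub>R b i)" by (intro sum.cong) auto
  ultimately have "(\<Sum>i<Suc n. (if i < n then x i else - ?r) *\<^sub>R b i) = 0" using x by simp
  then show "x i = 0" using assms[unfolded lin_indep_def, rule_format, OF _ less_SucI[OF \<open>i < n\<close>]] \<open>i < n\<close> by fastforce
qed

text \<open>One step of the induction on the rank. The lattice is fibred over its projection to the
  complement of the last basis vector \<open>e\<close>, which has basis \<open>b'\<close>: since
  \<open>b i = b' i + (\<eta> \<bullet> b' i) *\<^sub>R e\<close>, the fibre over \<open>x\<close>
  consists of the integer multiples of \<open>e\<close> shifted by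
  \<open>x + (\<eta> \<bullet> x) *\<^sub>R e\<close>. So \<open>\<eta>\<close> records how far
  \<open>e\<close> is from being orthogonal to the other basis vectors.\<close>

locale lattice_step =
  fixes n :: nat and b :: "nat \<Rightarrow> 'a::real_inner" and e :: 'a and b' :: "nat \<Rightarrow> 'a" and \<eta> :: 'a and N :: real
  assumes ind: "lin_indep (Suc n) b"
    and e_def: "e = b n" and N_def: "N = e \<bullet> e" and b'_def: "b' = (\<lambda>i. proj_perp e (b i))"
    and \<eta>: "\<eta> \<in> rspan n b'" "\<And>i. i < n \<Longrightarrow> \<eta> \<bullet> b' i = (b i \<bullet> e) / N"
begin

lemma e_nz: "e \<noteq> 0"
  using lin_indep_Suc(2)[OF ind] rspan_scaleR[of _ n b 0] by (fastforce simp: e_def rspan_def)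

lemma N_pos: "N > 0" using e_nz by (simp add: N_def)

lemma ind': "lin_indep n b'" using lin_indep_proj_perp[OF ind] by (simp add: b'_def e_def)

lemma b'_e: "b' i \<bullet> e = 0" "e \<bullet> b' i = 0"
  using proj_perp_orthogonal[OF e_nz] by (simp_all add: b'_def inner_commute)

lemma rspan'_e: "v \<in> rspan n b' \<Longrightarrow> v \<bullet> e = 0" "v \<in> rspan n b' \<Longrightarrow> e \<bullet> v = 0"
  using rspan_orthogonal[of v n b' e] b'_e by (simp_all add: inner_commute)

lemma b_eq: "i < n \<Longrightarrow> b i = b' i + (\<eta> \<bullet> b' i) *\<^sub>R e"
  using \<eta>(2)[of i] by (simp add: b'_def proj_perp_def N_def)

lemma sum_b_eq: "(\<Sum>i<n. x i *\<^sub>R b i) = (\<Sum>i<n. x i *\<^sub>R b' i) + (\<eta> \<bullet> (\<Sum>i<n. x i *\<^sub>R b' i)) *\<^sub>R e"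
proof -
  have "(\<Sum>i<n. x i *\<^sub>R b i) = (\<Sum>i<n. x i *\<^sub>R (b' i + (\<eta> \<bullet> b' i) *\<^sub>R e))"
    by (intro sum.cong refl) (metis b_eq lessThan_iff)
  then show ?thesis by (simp add: scaleR_add_right sum.distrib inner_sum_right scaleR_sum_left)
qed

lemma rspan_iff: "v \<in> rspan (Suc n) b \<longleftrightarrow> (\<exists>u\<in>rspan n b'. \<exists>r. v = u + r *\<^sub>R e)"
proof
  assume "v \<in> rspan (Suc n) b"
  then obtain x r where "v = (\<Sum>i<n. x i *\<^sub>R b i) + r *\<^sub>R e" by (auto simp: rspan_Suc_iff e_def rspan_def)
  then have "v = (\<Sum>i<n. x i *\<^sub>R b' i) + ((\<eta> \<bullet> (\<Sum>i<n. x i *\<^sub>R b' i)) + r) *\<^sub>R e"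
    unfolding sum_b_eq by (simp add: scaleR_add_left)
  then show "\<exists>u\<in>rspan n b'. \<exists>r. v = u + r *\<^sub>R e" unfolding rspan_def by blast
next
  assume "\<exists>u\<in>rspan n b'. \<exists>r. v = u + r *\<^sub>R e"
  then obtain x r where "v = (\<Sum>i<n. x i *\<^sub>R b' i) + r *\<^sub>R e" by (auto simp: rspan_def)
  then have "v = (\<Sum>i<n. x i *\<^sub>R b i) + (r - (\<eta> \<bullet> (\<Sum>i<n. x i *\<^sub>R b' i))) *\<^sub>R e"
    unfolding sum_b_eq by (simp add: scaleR_diff_left)
  then show "v \<in> rspan (Suc n) b" unfolding rspan_Suc_iff e_def[symmetric] by (intro bexI[OF _ rspanI] exI)
qed

lemma bij_zspan:
  "bij_betw (\<lambda>(x, m). x + (of_int m + \<eta> \<bullet> x) *\<^sub>R e) (zspan n b' \<times> UNIV) (zspan (Suc n) b)"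
proof (intro bij_betw_imageI)
  show "inj_on (\<lambda>(x, m). x + (of_int m + \<eta> \<bullet> x) *\<^sub>R e) (zspan n b' \<times> UNIV)"
  proof (intro inj_onI, clarify)
    fix x y and m k :: int
    assume xy: "x \<in> zspan n b'" "y \<in> zspan n b'"
      and eq: "x + (of_int m + \<eta> \<bullet> x) *\<^sub>R e = y + (of_int k + \<eta> \<bullet> y) *\<^sub>R e"
    have "x \<bullet> e = 0" "y \<bullet> e = 0" using xy zspan_subset_rspan rspan'_e by blast+
    then have *: "of_int m + \<eta> \<bullet> x = of_int k + \<eta> \<bullet> y"
      using arg_cong[OF eq, of "\<lambda>v. v \<bullet> e"] e_nz by (simp add: inner_add_left)
    then have "x = y" using eq by simp
    then show "x = y \<and> m = k" using * by simp
  qed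
  show "(\<lambda>(x, m). x + (of_int m + \<eta> \<bullet> x) *\<^sub>R e) ` (zspan n b' \<times> UNIV) = zspan (Suc n) b"
  proof (intro equalityI subsetI)
    fix v assume "v \<in> (\<lambda>(x, m). x + (of_int m + \<eta> \<bullet> x) *\<^sub>R e) ` (zspan n b' \<times> UNIV)"
    then obtain c m where "v = (\<Sum>i<n. of_int (c i) *\<^sub>R b' i) + (of_int m + \<eta> \<bullet> (\<Sum>i<n. of_int (c i) *\<^sub>R b' i)) *\<^sub>R e"
      by (auto simp: zspan_def)
    then have "v = (\<Sum>i<n. of_int (c i) *\<^sub>R b i) + of_int m *\<^sub>R e" unfolding sum_b_eq by (simp add: scaleR_add_left)
    then show "v \<in> zspan (Suc n) b" unfolding zspan_Suc_iff e_def[symmetric] by (intro bexI[OF _ zspanI] exI)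
  next
    fix v assume "v \<in> zspan (Suc n) b"
    then obtain c m where v: "v = (\<Sum>i<n. of_int (c i) *\<^sub>R b i) + of_int m *\<^sub>R e"
      by (auto simp: zspan_Suc_iff zspan_def e_def)
    let ?x = "\<Sum>i<n. of_int (c i) *\<^sub>R b' i"
    have "v = ?x + (of_int m + \<eta> \<bullet> ?x) *\<^sub>R e" unfolding v sum_b_eq by (simp add: scaleR_add_left)
    moreover have "?x \<in> zspan n b'" unfolding zspan_def by blast
    ultimately show "v \<in> (\<lambda>(x, m). x + (of_int m + \<eta> \<bullet> x) *\<^sub>R e) ` (zspan n b' \<times> UNIV)"
      by (intro image_eqI[of _ _ "(?x, m)"]) auto
  qed
qed

text \<open>The product with \<open>e\<close> must be an integer \<open>k\<close>, which forces the
  component \<open>k / N\<close> along \<open>e\<close>. Against \<open>b i\<close> this component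
  contributes \<open>k (\<eta> \<bullet> b' i)\<close>, which the term \<open>- k \<eta>\<close>
  cancels, so that what remains is dual to \<open>b'\<close>.\<close>

lemma bij_zdual:
  "bij_betw (\<lambda>(k, y). y - of_int k *\<^sub>R \<eta> + (of_int k / N) *\<^sub>R e) (UNIV \<times> zdual n b') (zdual (Suc n) b)"
proof (intro bij_betw_imageI)
  have \<eta>e: "\<eta> \<bullet> e = 0" using rspan'_e \<eta>(1) by blast
  have ye: "y \<bullet> e = 0" if "y \<in> zdual n b'" for y using that zdual_subset_rspan rspan'_e by blast
  show "inj_on (\<lambda>(k, y). y - of_int k *\<^sub>R \<eta> + (of_int k / N) *\<^sub>R e) (UNIV \<times> zdual n b')"
  proof (intro inj_onI, clarify)
    fix x y and m k :: int
    assume xy: "x \<in> zdual n b'" "y \<in> zdual n b'"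
      and eq: "x - of_int k *\<^sub>R \<eta> + (of_int k / N) *\<^sub>R e = y - of_int m *\<^sub>R \<eta> + (of_int m / N) *\<^sub>R e"
    have "k = m"
      using arg_cong[OF eq, of "\<lambda>v. v \<bullet> e"] N_pos by (simp add: inner_add_left inner_diff_left ye[OF xy(1)] ye[OF xy(2)] \<eta>e N_def[symmetric])
    then show "k = m \<and> x = y" using eq by simp
  qed
  show "(\<lambda>(k, y). y - of_int k *\<^sub>R \<eta> + (of_int k / N) *\<^sub>R e) ` (UNIV \<times> zdual n b') = zdual (Suc n) b"
  proof (intro equalityI subsetI)
    fix v assume "v \<in> (\<lambda>(k, y). y - of_int k *\<^sub>R \<eta> + (of_int k / N) *\<^sub>R e) ` (UNIV \<times> zdual n b')"
    then obtain k :: int and y where y: "y \<in> zdual n b'" and v: "v = (y - of_int k *\<^sub>R \<eta>) + (of_int k / N) *\<^sub>R e" by auto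
    have "v \<in> rspan (Suc n) b" unfolding rspan_iff v
      using y \<eta>(1) zdual_subset_rspan rspan_diff rspan_scaleR by blast
    moreover have "v \<bullet> b i \<in> \<int>" if "i < Suc n" for i
    proof (cases "i = n")
      case True
      then show ?thesis using N_pos ye[OF y] by (simp add: v inner_add_left inner_diff_left \<eta>e e_def[symmetric] N_def[symmetric])
    next
      case False
      then have i: "i < n" using that by simp
      have "v \<bullet> b i = y \<bullet> b' i"
        unfolding b_eq[OF i] v using N_pos ye[OF y] \<eta>e b'_e
        by (simp add: inner_add_left inner_add_right inner_diff_left N_def[symmetric])
      then show ?thesis using y i by (auto simp: zdual_def)
    qed
    ultimately show "v \<in> zdual (Suc n) b" by (simp add: zdual_def)
  next
    fix v assume v: "v \<in> zdual (Suc n) b"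
    then obtain u r where u: "u \<in> rspan n b'" and vu: "v = u + r *\<^sub>R e" by (auto simp: zdual_def rspan_iff)
    have ue: "u \<bullet> e = 0" using u rspan'_e by blast
    have "v \<bullet> e \<in> \<int>" using v by (auto simp: zdual_def e_def)
    then obtain k where k: "r * N = of_int k" by (auto simp: vu inner_add_left ue N_def elim: Ints_cases)
    have "u + of_int k *\<^sub>R \<eta> \<in> zdual n b'" unfolding zdual_def
    proof (intro CollectI conjI allI impI)
      show "u + of_int k *\<^sub>R \<eta> \<in> rspan n b'" by (intro rspan_add u rspan_scaleR \<eta>)
      fix i assume i: "i < n"
      have "v \<bullet> b i = (u + of_int k *\<^sub>R \<eta>) \<bullet> b' i"
        unfolding b_eq[OF i] vu using N_pos ue b'_e
        by (simp add: inner_add_left inner_add_right N_def[symmetric] k[symmetric] mult_ac)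
      moreover have "v \<bullet> b i \<in> \<int>" using v i by (auto simp: zdual_def)
      ultimately show "(u + of_int k *\<^sub>R \<eta>) \<bullet> b' i \<in> \<int>" by simp
    qed
    moreover have "r = of_int k / N" using k N_pos by (simp add: field_simps)
    ultimately show "v \<in> (\<lambda>(k, y). y - of_int k *\<^sub>R \<eta> + (of_int k / N) *\<^sub>R e) ` (UNIV \<times> zdual n b')"
      by (intro image_eqI[of _ _ "(k, u + of_int k *\<^sub>R \<eta>)"]) (auto simp: vu)
  qed
qed

end

lemma lattice_step_exists:
  assumes "lin_indep (Suc n) b"
  shows "\<exists>e b' \<eta> N. lattice_step n b e b' \<eta> N"
proof -
  let ?b' = "\<lambda>i. proj_perp (b n) (b i)"
  obtain \<eta> where "\<eta> \<in> rspan n ?b'" "\<And>i. i < n \<Longrightarrow> \<eta> \<bullet> ?b' i = (b i \<bullet> b n) / (b n \<bullet> b n)"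
    using exists_inner_functional[OF lin_indep_proj_perp[OF assms], of "\<lambda>i. (b i \<bullet> b n) / (b n \<bullet> b n)"] by blast
  then have "lattice_step n b (b n) ?b' \<eta> (b n \<bullet> b n)"
    using assms by unfold_locales auto
  then show ?thesis by blast
qed

lemma gaussian_zspan_summable:
  assumes "lin_indep n b" "t > 0" "p \<in> rspan n b"
  shows "(\<lambda>x. exp (- t * ((x + p) \<bullet> (x + p)))) summable_on zspan n b"
  using assms(1,3)
proof (induction n arbitrary: b p)
  case (Suc n)
  obtain e b' \<eta> N where "lattice_step n b e b' \<eta> N" using lattice_step_exists[OF Suc.prems(1)] by blast
  then interpret lattice_step n b e b' \<eta> N .
  obtain p' r where p': "p' \<in> rspan n b'" and p: "p = p' + r *\<^sub>R e" using Suc.prems(2) by (auto simp: rspan_iff)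
  have tN: "t * N > 0" using N_pos assms(2) by simp
  \<comment> \<open>A bound for all fibre sums at once, whatever the shift
    \<open>\<eta> \<bullet> x + r\<close>; summability over the projected lattice then
    suffices.\<close>
  let ?K = "exp (t * N) * (\<Sum>\<^sub>\<infinity>m::int. exp (- (t * N / 2) * (of_int m)\<^sup>2))"
  let ?g = "\<lambda>x. exp (- t * ((x + p') \<bullet> (x + p')))"
  let ?h = "\<lambda>x (m::int). exp (- (t * N) * ((\<eta> \<bullet> x + r) + of_int m)\<^sup>2)"
  have "(\<lambda>(x, m::int). ?g x * ?h x m) summable_on (zspan n b' \<times> UNIV)"
  proof (rule summable_on_SigmaI)
    show "((\<lambda>m. case (x, m) of (x, m) \<Rightarrow> ?g x * ?h x m) has_sum (?g x * infsum (?h x) UNIV)) UNIV" for x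
      using gaussian_int_summable[OF tN, of "\<eta> \<bullet> x + r"] by (auto intro!: has_sum_cmult_right has_sum_infsum)
    show "(\<lambda>x. ?g x * infsum (?h x) UNIV) summable_on zspan n b'"
    proof (rule summable_on_comparison_test)
      show "(\<lambda>x. ?g x * ?K) summable_on zspan n b'"
        by (intro summable_on_cmult_left Suc.IH ind' p')
      show "?g x * infsum (?h x) UNIV \<le> ?g x * ?K" for x
        using gaussian_int_sum_le[OF tN, of "\<eta> \<bullet> x + r"] by (intro mult_left_mono) auto
      show "0 \<le> ?g x * infsum (?h x) UNIV" for x by (intro mult_nonneg_nonneg infsum_nonneg) auto
    qed
  qed auto
  moreover have "exp (- t * ((x + (of_int m + \<eta> \<bullet> x) *\<^sub>R e + p) \<bullet> (x + (of_int m + \<eta> \<bullet> x) *\<^sub>R e + p))) = ?g x * ?h x m"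
    if "x \<in> zspan n b'" for x and m :: int
  proof -
    have "(x + p') \<bullet> e = 0" "e \<bullet> (x + p') = 0" using that p' zspan_subset_rspan rspan'_e rspan_add by blast+
    moreover have "x + (of_int m + \<eta> \<bullet> x) *\<^sub>R e + p = (x + p') + (\<eta> \<bullet> x + r + of_int m) *\<^sub>R e"
      by (simp add: p algebra_simps)
    ultimately have "(x + (of_int m + \<eta> \<bullet> x) *\<^sub>R e + p) \<bullet> (x + (of_int m + \<eta> \<bullet> x) *\<^sub>R e + p)
        = (x + p') \<bullet> (x + p') + N * (\<eta> \<bullet> x + r + of_int m)\<^sup>2"
      by (simp only: inner_add_left[of "x + p'"] inner_add_right[of _ "x + p'"]) (simp add: N_def power2_eq_square)
    then show ?thesis by (simp only: exp_add[symmetric]) (simp add: distrib_left)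
  qed
  ultimately have "(\<lambda>z. exp (- t * (((case z of (x, m) \<Rightarrow> x + (of_int m + \<eta> \<bullet> x) *\<^sub>R e) + p) \<bullet> ((case z of (x, m) \<Rightarrow> x + (of_int m + \<eta> \<bullet> x) *\<^sub>R e) + p))))
      summable_on (zspan n b' \<times> UNIV)"
    by (subst summable_on_cong[where g = "\<lambda>(x, m::int). ?g x * ?h x m"]) auto
  then show ?case
    using summable_on_reindex_bij_betw[OF bij_zspan, of "\<lambda>x. exp (- t * ((x + p) \<bullet> (x + p)))"] by simp
qed auto

text \<open>\<open>d\<close> is the dual basis. It transfers Gaussian summability from integer spans
  to duals.\<close>

lemma zdual_eq_zspan:
  assumes "lin_indep n b"
  shows "\<exists>d. lin_indep n d \<and> zdual n b = zspan n d \<and> rspan n d = rspan n b"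
proof -
  have "\<forall>j. \<exists>\<eta>. \<eta> \<in> rspan n b \<and> (\<forall>i<n. \<eta> \<bullet> b i = (if i = j then 1 else 0))"
  proof
    fix j
    show "\<exists>\<eta>. \<eta> \<in> rspan n b \<and> (\<forall>i<n. \<eta> \<bullet> b i = (if i = j then 1 else 0))"
      using exists_inner_functional[OF assms, of "\<lambda>i. if i = j then 1 else 0"] by blast
  qed
  then obtain d where d: "\<And>j. d j \<in> rspan n b" "\<And>i j. i < n \<Longrightarrow> d j \<bullet> b i = (if i = j then 1 else 0)" by metis
  have sumb: "(\<Sum>j<n. x j *\<^sub>R d j) \<bullet> b i = x i" if "i < n" for x i
  proof -
    have "(\<Sum>j<n. x j *\<^sub>R d j) \<bullet> b i = (\<Sum>j<n. if i = j then x j else 0)"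
      unfolding inner_sum_left using that by (intro sum.cong) (auto simp: d)
    then show ?thesis using that by simp
  qed
  have "lin_indep n d" unfolding lin_indep_def
  proof (intro allI impI)
    fix x i assume "(\<Sum>i<n. x i *\<^sub>R d i) = 0" "i < n"
    then show "x i = 0" using sumb[of i x] by simp
  qed
  have eq0: "v = 0" if "v \<in> rspan n b" "\<And>i. i < n \<Longrightarrow> v \<bullet> b i = 0" for v
    using rspan_orthogonal[of v n b v] that by (simp add: inner_commute)
  have sumin: "(\<Sum>j<m. x j *\<^sub>R d j) \<in> rspan n b" for m x
  proof (induction m)
    case 0
    show ?case by (auto simp: rspan_def intro!: exI[of _ "\<lambda>_. 0"])
  qed (auto intro!: rspan_add rspan_scaleR d)
  have rep: "v = (\<Sum>j<n. (v \<bullet> b j) *\<^sub>R d j)" if "v \<in> rspan n b" for v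
    using eq0[OF rspan_diff[OF that sumin[of "\<lambda>j. v \<bullet> b j" n]]] by (simp add: inner_diff_left sumb)
  have "rspan n d = rspan n b"
  proof (intro equalityI subsetI)
    show "v \<in> rspan n b" if "v \<in> rspan n d" for v
      using that sumin by (auto simp: rspan_def[of n d])
    show "v \<in> rspan n d" if "v \<in> rspan n b" for v
      by (subst rep[OF that]) (rule rspanI)
  qed
  moreover have "zdual n b = zspan n d"
  proof (intro equalityI subsetI)
    fix v assume v: "v \<in> zdual n b"
    then have "\<And>i. i < n \<Longrightarrow> of_int \<lfloor>v \<bullet> b i\<rfloor> = v \<bullet> b i" by (auto simp: zdual_def elim!: Ints_cases)
    then have "(\<Sum>j<n. of_int \<lfloor>v \<bullet> b j\<rfloor> *\<^sub>R d j) = (\<Sum>j<n. (v \<bullet> b j) *\<^sub>R d j)" by (intro sum.cong) auto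
    also have "\<dots> = v" using v rep[of v] by (simp add: zdual_def)
    finally show "v \<in> zspan n d" using zspanI[where n = n and c = "\<lambda>j. \<lfloor>v \<bullet> b j\<rfloor>" and b = d] by simp
  next
    fix v assume "v \<in> zspan n d"
    then obtain c where v: "v = (\<Sum>j<n. of_int (c j) *\<^sub>R d j)" by (auto simp: zspan_def)
    show "v \<in> zdual n b" unfolding zdual_def using sumin sumb by (simp add: v)
  qed
  ultimately show ?thesis using \<open>lin_indep n d\<close> by blast
qed

lemma gaussian_zdual_summable:
  assumes "lin_indep n b" "t > 0" "p \<in> rspan n b"
  shows "(\<lambda>x. exp (- t * ((x + p) \<bullet> (x + p)))) summable_on zdual n b"
  using zdual_eq_zspan[OF assms(1)] gaussian_zspan_summable assms by metis

text \<open>Induction on the rank: one-dimensional Poisson summation on each fibre over the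
  projected lattice, exchange of the two sums, then the induction hypothesis for each dual index
  \<open>k\<close>. The constant stays existential but is independent of \<open>t\<close>,
  \<open>p\<close> and \<open>v\<close>, so a single evaluation can fix it for a self-dual
  lattice.\<close>

theorem poisson_summation_lattice:
  fixes b :: "nat \<Rightarrow> 'a::real_inner"
  assumes "lin_indep n b"
  shows "\<exists>C>0. \<forall>t>0. \<forall>p\<in>rspan n b. \<forall>v\<in>rspan n b.
    (\<Sum>\<^sub>\<infinity>x\<in>zspan n b. of_real (exp (- pi * t * ((x + p) \<bullet> (x + p)))) * cis (2 * pi * (v \<bullet> (x + p))))
    = of_real (C * (1 / sqrt t) ^ n) *
      (\<Sum>\<^sub>\<infinity>y\<in>zdual n b. of_real (exp (- (pi / t) * ((y - v) \<bullet> (y - v)))) * cis (2 * pi * (y \<bullet> p)))"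
  using assms
proof (induction n arbitrary: b)
  case 0
  show ?case by (intro exI[of _ 1]) auto
next
  case (Suc n)
  obtain e b' \<eta> N where "lattice_step n b e b' \<eta> N" using lattice_step_exists[OF Suc.prems] by blast
  then interpret lattice_step n b e b' \<eta> N .
  from Suc.IH[OF ind'] obtain C where C_IH: "C > 0 \<and> (\<forall>t>0. \<forall>p\<in>rspan n b'. \<forall>v\<in>rspan n b'.
    (\<Sum>\<^sub>\<infinity>x\<in>zspan n b'. of_real (exp (- pi * t * ((x + p) \<bullet> (x + p)))) * cis (2 * pi * (v \<bullet> (x + p))))
    = of_real (C * (1 / sqrt t) ^ n) *
      (\<Sum>\<^sub>\<infinity>y\<in>zdual n b'. of_real (exp (- (pi / t) * ((y - v) \<bullet> (y - v)))) * cis (2 * pi * (y \<bullet> p))))"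
    by (rule exE)
  note C = conjunct1[OF C_IH] and IH = conjunct2[OF C_IH, rule_format]
  show ?case
  \<comment> \<open>\<open>N\<close> is the squared length of the vector split off, so the product
    of these factors is the reciprocal of the covolume.\<close>
  proof (intro exI[of _ "C / sqrt N"] conjI allI impI ballI)
    show "C / sqrt N > 0" using C N_pos by simp
    fix t :: real and p v
    assume t: "t > 0" and p: "p \<in> rspan (Suc n) b" and v: "v \<in> rspan (Suc n) b"
    obtain p' r where p': "p' \<in> rspan n b'" and peq: "p = p' + r *\<^sub>R e" using p by (auto simp: rspan_iff)
    obtain v' w0 where v': "v' \<in> rspan n b'" and veq: "v = v' + w0 *\<^sub>R e" using v by (auto simp: rspan_iff)
    define w where "w = N * w0"
    have tN: "t * N > 0" using t N_pos by simp
    define F where "F x = complex_of_real (exp (- pi * t * ((x + p) \<bullet> (x + p)))) * cis (2 * pi * (v \<bullet> (x + p)))" for x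
    define G where "G y = complex_of_real (exp (- (pi / t) * ((y - v) \<bullet> (y - v)))) * cis (2 * pi * (y \<bullet> p))" for y
    define E where "E x = complex_of_real (exp (- pi * t * ((x + p') \<bullet> (x + p')))) * cis (2 * pi * (v' \<bullet> (x + p')))" for x
    define A where "A k = complex_of_real (exp (- pi * (of_int k - w)\<^sup>2 / (t * N)))" for k :: int
    let ?\<phi> = "\<lambda>(x, m). x + (of_int m + \<eta> \<bullet> x) *\<^sub>R e"
    let ?\<psi> = "\<lambda>(k, y). y - of_int k *\<^sub>R \<eta> + (of_int k / N) *\<^sub>R e"
    let ?L = "zspan n b'" and ?D = "zdual n b'"
    have perp: "z \<bullet> e = 0" "e \<bullet> z = 0" if "z \<in> rspan n b'" for z using rspan'_e that by auto
    have ee: "e \<bullet> e = N" by (simp add: N_def)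
    have F\<phi>: "F (?\<phi> (x, m)) = E x * (of_real (exp (- pi * (t * N) * ((\<eta> \<bullet> x + r) + of_int m)\<^sup>2)) * cis (2 * pi * ((\<eta> \<bullet> x + r) + of_int m) * w))"
      if "x \<in> ?L" for x m
    proof -
      define z s where "z = x + p'" and "s = \<eta> \<bullet> x + r + of_int m"
      have z: "z \<in> rspan n b'" unfolding z_def using that p' zspan_subset_rspan rspan_add by blast
      have 1: "?\<phi> (x, m) + p = z + s *\<^sub>R e" by (simp add: peq z_def s_def algebra_simps)
      have 2: "(z + s *\<^sub>R e) \<bullet> (z + s *\<^sub>R e) = z \<bullet> z + N * s\<^sup>2"
        using perp[OF z] by (simp add: inner_add_left inner_add_right ee power2_eq_square)
      have 3: "v \<bullet> (z + s *\<^sub>R e) = v' \<bullet> z + s * w"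
        using perp[OF z] perp[OF v'] by (simp add: veq inner_add_left inner_add_right ee w_def)
      have "exp (- pi * t * (z \<bullet> z + N * s\<^sup>2)) = exp (- pi * t * (z \<bullet> z)) * exp (- pi * (t * N) * s\<^sup>2)"
        by (simp add: exp_add[symmetric] algebra_simps)
      moreover have "cis (2 * pi * (v' \<bullet> z + s * w)) = cis (2 * pi * (v' \<bullet> z)) * cis (2 * pi * s * w)"
        by (simp add: cis_mult algebra_simps)
      ultimately show ?thesis unfolding F_def E_def 1 2 3 z_def[symmetric] s_def[symmetric] by simp
    qed
    have Fsum: "F summable_on zspan (Suc n) b"
    proof (rule abs_summable_summable)
      show "(\<lambda>x. norm (F x)) summable_on zspan (Suc n) b"
        using gaussian_zspan_summable[OF Suc.prems _ p, of "pi * t"] t by (simp add: F_def norm_mult)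
    qed
    then have F\<phi>sum: "(\<lambda>z. F (?\<phi> z)) summable_on (?L \<times> UNIV)"
      using summable_on_reindex_bij_betw[OF bij_zspan, of F] by simp
    have Gsum: "G summable_on zdual (Suc n) b"
    proof (rule abs_summable_summable)
      have "- v \<in> rspan (Suc n) b" using rspan_scaleR[OF v, of "-1"] by simp
      then show "(\<lambda>x. norm (G x)) summable_on zdual (Suc n) b"
        using gaussian_zdual_summable[OF Suc.prems, of "pi / t" "- v"] t by (simp add: G_def norm_mult)
    qed
    then have G\<psi>sum: "(\<lambda>z. G (?\<psi> z)) summable_on (UNIV \<times> ?D)"
      using summable_on_reindex_bij_betw[OF bij_zdual, of G] by simp
    define H where "H x k = E x * (A k * cis (2 * pi * of_int k * (\<eta> \<bullet> x + r)))" for x and k :: int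
    have Hsum: "(\<lambda>(x, k). H x k) summable_on (?L \<times> UNIV)"
    proof (rule abs_summable_summable)
      let ?g = "\<lambda>x. exp (- (pi * t) * ((x + p') \<bullet> (x + p')))"
      let ?a = "\<lambda>k::int. exp (- (pi / (t * N)) * (- w + of_int k)\<^sup>2)"
      have "(\<lambda>(x, k). ?g x * ?a k) summable_on (?L \<times> UNIV)"
      proof (rule summable_on_SigmaI)
        show "((\<lambda>k. case (x, k) of (x, k) \<Rightarrow> ?g x * ?a k) has_sum (?g x * infsum ?a UNIV)) UNIV" for x
          using gaussian_int_summable[of "pi / (t * N)" "- w"] tN by (auto intro!: has_sum_cmult_right has_sum_infsum)
        show "(\<lambda>x. ?g x * infsum ?a UNIV) summable_on ?L"
          using gaussian_zspan_summable[OF ind' _ p', of "pi * t"] t by (intro summable_on_cmult_left) simp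
      qed auto
      moreover have "norm (H x k) = ?g x * ?a k" for x k
        by (simp add: H_def E_def A_def norm_mult)
      ultimately show "(\<lambda>z. norm (case z of (x, k) \<Rightarrow> H x k)) summable_on (?L \<times> UNIV)"
        by (simp add: case_prod_unfold)
    qed
    have inner_sum: "(\<Sum>\<^sub>\<infinity>x\<in>?L. H x k) = of_real (C * (1 / sqrt t) ^ n) * (\<Sum>\<^sub>\<infinity>y\<in>?D. G (?\<psi> (k, y)))" for k
    proof -
      \<comment> \<open>The phase coming from the fibre shift \<open>\<eta> \<bullet> x\<close> is
        itself a character of the projected lattice; absorbing it moves the dual variable by
        \<open>k \<eta>\<close>, which matches the parametrisation in
        \<open>bij_zdual\<close>.\<close>
      define vk where "vk = v' + of_int k *\<^sub>R \<eta>"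
      have vk: "vk \<in> rspan n b'" unfolding vk_def by (intro rspan_add rspan_scaleR v' \<eta>)
      define c where "c = A k * cis (2 * pi * of_int k * r) * cis (- (2 * pi * of_int k * (\<eta> \<bullet> p')))"
      have "H x k = c * (of_real (exp (- pi * t * ((x + p') \<bullet> (x + p')))) * cis (2 * pi * (vk \<bullet> (x + p'))))" for x
      proof -
        have "cis (2 * pi * (v' \<bullet> (x + p'))) * cis (2 * pi * of_int k * (\<eta> \<bullet> x + r))
          = cis (2 * pi * of_int k * r) * cis (- (2 * pi * of_int k * (\<eta> \<bullet> p'))) * cis (2 * pi * (vk \<bullet> (x + p')))"
          by (simp add: cis_mult vk_def inner_add_left inner_add_right algebra_simps)
        then show ?thesis unfolding H_def E_def c_def by (simp add: mult_ac)
      qed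
      then have "(\<Sum>\<^sub>\<infinity>x\<in>?L. H x k) = c * (\<Sum>\<^sub>\<infinity>x\<in>?L. of_real (exp (- pi * t * ((x + p') \<bullet> (x + p')))) * cis (2 * pi * (vk \<bullet> (x + p'))))"
        by (simp only: infsum_cmult_right')
      also have "\<dots> = of_real (C * (1 / sqrt t) ^ n) * (\<Sum>\<^sub>\<infinity>y\<in>?D. c * (of_real (exp (- (pi / t) * ((y - vk) \<bullet> (y - vk)))) * cis (2 * pi * (y \<bullet> p'))))"
        unfolding IH[OF t p' vk] infsum_cmult_right' by (simp only: mult_ac)
      also have "(\<Sum>\<^sub>\<infinity>y\<in>?D. c * (of_real (exp (- (pi / t) * ((y - vk) \<bullet> (y - vk)))) * cis (2 * pi * (y \<bullet> p')))) = (\<Sum>\<^sub>\<infinity>y\<in>?D. G (?\<psi> (k, y)))"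
      proof (rule infsum_cong)
        fix y assume "y \<in> ?D"
        then have y: "y \<in> rspan n b'" using zdual_subset_rspan by blast
        define z where "z = y - vk"
        have z: "z \<in> rspan n b'" unfolding z_def by (intro rspan_diff y vk)
        define s where "s = of_int k / N - w0"
        have 1: "?\<psi> (k, y) - v = z + s *\<^sub>R e" by (simp add: veq z_def s_def vk_def algebra_simps)
        have 2: "(z + s *\<^sub>R e) \<bullet> (z + s *\<^sub>R e) = z \<bullet> z + N * s\<^sup>2"
          using perp[OF z] by (simp add: inner_add_left inner_add_right ee power2_eq_square)
        have 3: "?\<psi> (k, y) \<bullet> p = y \<bullet> p' - of_int k * (\<eta> \<bullet> p') + of_int k * r"
          using perp[OF p'] perp[OF y] perp[OF \<eta>(1)] N_pos by (simp add: peq inner_add_left inner_add_right inner_diff_left ee)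
        have "N * s\<^sup>2 = (of_int k - w)\<^sup>2 / N"
          using N_pos by (simp add: s_def w_def power2_eq_square field_simps)
        then have "- (pi / t) * (z \<bullet> z + N * s\<^sup>2) = - pi * (of_int k - w)\<^sup>2 / (t * N) + - (pi / t) * (z \<bullet> z)"
          using t N_pos by (simp add: field_simps)
        then have 4: "exp (- (pi / t) * (z \<bullet> z + N * s\<^sup>2)) = exp (- pi * (of_int k - w)\<^sup>2 / (t * N)) * exp (- (pi / t) * (z \<bullet> z))"
          by (simp only: exp_add)
        have 5: "cis (2 * pi * (y \<bullet> p' - of_int k * (\<eta> \<bullet> p') + of_int k * r))
          = cis (2 * pi * of_int k * r) * cis (- (2 * pi * of_int k * (\<eta> \<bullet> p'))) * cis (2 * pi * (y \<bullet> p'))"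
          by (simp add: cis_mult algebra_simps)
        show "c * (of_real (exp (- (pi / t) * ((y - vk) \<bullet> (y - vk)))) * cis (2 * pi * (y \<bullet> p'))) = G (?\<psi> (k, y))"
          unfolding G_def 1 2 3 4 5 z_def[symmetric] c_def A_def by (simp only: of_real_mult mult_ac)
      qed
      finally show ?thesis .
    qed
    have "(\<Sum>\<^sub>\<infinity>x\<in>zspan (Suc n) b. F x) = (\<Sum>\<^sub>\<infinity>z\<in>?L \<times> UNIV. F (?\<phi> z))"
      using infsum_reindex_bij_betw[OF bij_zspan, of F] by simp
    also have "\<dots> = (\<Sum>\<^sub>\<infinity>x\<in>?L. \<Sum>\<^sub>\<infinity>m. F (?\<phi> (x, m)))"
      by (rule infsum_Sigma_banach[OF F\<phi>sum, symmetric])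
    also have "\<dots> = (\<Sum>\<^sub>\<infinity>x\<in>?L. of_real (1 / sqrt (t * N)) * (\<Sum>\<^sub>\<infinity>k. H x k))"
    proof (rule infsum_cong)
      fix x assume x: "x \<in> ?L"
      have "(\<Sum>\<^sub>\<infinity>m. F (?\<phi> (x, m))) = E x * (of_real (1 / sqrt (t * N)) * (\<Sum>\<^sub>\<infinity>k. A k * cis (2 * pi * of_int k * (\<eta> \<bullet> x + r))))"
        unfolding F\<phi>[OF x] infsum_cmult_right' poisson_summation_gaussian[OF tN] A_def ..
      then show "(\<Sum>\<^sub>\<infinity>m. F (?\<phi> (x, m))) = of_real (1 / sqrt (t * N)) * (\<Sum>\<^sub>\<infinity>k. H x k)"
        unfolding H_def infsum_cmult_right' by (simp only: mult_ac)
    qed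
    also have "\<dots> = of_real (1 / sqrt (t * N)) * (\<Sum>\<^sub>\<infinity>k. \<Sum>\<^sub>\<infinity>x\<in>?L. H x k)"
      unfolding infsum_cmult_right' infsum_swap_banach[OF Hsum] ..
    also have "\<dots> = of_real (1 / sqrt (t * N)) * (of_real (C * (1 / sqrt t) ^ n) * (\<Sum>\<^sub>\<infinity>k. \<Sum>\<^sub>\<infinity>y\<in>?D. G (?\<psi> (k, y))))"
      unfolding inner_sum infsum_cmult_right' ..
    also have "(\<Sum>\<^sub>\<infinity>k. \<Sum>\<^sub>\<infinity>y\<in>?D. G (?\<psi> (k, y))) = (\<Sum>\<^sub>\<infinity>z\<in>UNIV \<times> ?D. G (?\<psi> z))"
      by (rule infsum_Sigma_banach[OF G\<psi>sum])
    also have "\<dots> = (\<Sum>\<^sub>\<infinity>y\<in>zdual (Suc n) b. G y)"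
      using infsum_reindex_bij_betw[OF bij_zdual, of G] by simp
    also have "of_real (1 / sqrt (t * N)) * (of_real (C * (1 / sqrt t) ^ n) * (\<Sum>\<^sub>\<infinity>y\<in>zdual (Suc n) b. G y))
      = of_real (C / sqrt N * (1 / sqrt t) ^ Suc n) * (\<Sum>\<^sub>\<infinity>y\<in>zdual (Suc n) b. G y)"
      by (simp add: real_sqrt_mult mult_ac)
    finally show "(\<Sum>\<^sub>\<infinity>x\<in>zspan (Suc n) b. of_real (exp (- pi * t * ((x + p) \<bullet> (x + p)))) * cis (2 * pi * (v \<bullet> (x + p))))
      = of_real (C / sqrt N * (1 / sqrt t) ^ Suc n) *
        (\<Sum>\<^sub>\<infinity>y\<in>zdual (Suc n) b. of_real (exp (- (pi / t) * ((y - v) \<bullet> (y - v)))) * cis (2 * pi * (y \<bullet> p)))"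
      unfolding F_def G_def .
  qed
qed

section \<open>Modular invariant functions on the unit disc\<close>

text \<open>After a translation the real part is at most 1/2 in absolute value. If the imaginary
  part is still below 1/2, the squared modulus is at most 1/2, and inversion at least doubles the
  imaginary part; \<open>n\<close> in \<open>claim\<close> bounds the number of doublings.\<close>

lemma invariant_reach:
  fixes f :: "complex \<Rightarrow> complex"
  assumes T: "\<And>\<tau> k::int. f (\<tau> + of_int k) = f \<tau>" and S: "\<And>\<tau>. Im \<tau> > 0 \<Longrightarrow> f (- 1 / \<tau>) = f \<tau>"
    and "Im \<tau> > 0"
  shows "\<exists>\<tau>'. Im \<tau>' \<ge> 1 / 2 \<and> f \<tau>' = f \<tau>"
proof -
  have claim: "\<exists>\<tau>'. Im \<tau>' \<ge> 1 / 2 \<and> f \<tau>' = f \<tau>" if "Im \<tau> \<ge> 1 / 2 ^ Suc n" for n \<tau>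
    using that
  proof (induction n arbitrary: \<tau>)
    case 0
    then show ?case by auto
  next
    case (Suc n)
    define \<sigma> where "\<sigma> = \<tau> + of_int (- round (Re \<tau>))"
    have f\<sigma>: "f \<sigma> = f \<tau>" unfolding \<sigma>_def by (rule T)
    have Im: "Im \<sigma> = Im \<tau>" by (simp add: \<sigma>_def)
    have Re: "\<bar>Re \<sigma>\<bar> \<le> 1 / 2" using of_int_round_abs_le[of "Re \<tau>"] by (simp add: \<sigma>_def abs_minus_commute)
    have pos: "Im \<sigma> > 0" using Suc.prems Im by (smt (verit) divide_pos_pos zero_less_power)
    show ?case
    proof (cases "Im \<sigma> \<ge> 1 / 2")
      case True
      then show ?thesis using f\<sigma> by blast
    next
      case False
      have "(Re \<sigma>)\<^sup>2 \<le> (1 / 2)\<^sup>2" using Re abs_le_square_iff[of "Re \<sigma>" "1/2"] by simp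
      moreover have "(Im \<sigma>)\<^sup>2 \<le> (1 / 2)\<^sup>2" using False pos by (intro power_mono) auto
      ultimately have n: "(Re \<sigma>)\<^sup>2 + (Im \<sigma>)\<^sup>2 \<le> 1 / 2" by (simp add: power2_eq_square)
      have p: "(Re \<sigma>)\<^sup>2 + (Im \<sigma>)\<^sup>2 > 0" using pos by (simp add: sum_power2_gt_zero_iff)
      have "Im (- 1 / \<sigma>) = Im \<sigma> / ((Re \<sigma>)\<^sup>2 + (Im \<sigma>)\<^sup>2)" by (simp add: Im_divide)
      also have "\<dots> \<ge> Im \<sigma> * 2" using n p pos mult_left_mono[OF n, of "Im \<sigma> * 2"] by (simp add: field_simps)
      finally have "Im (- 1 / \<sigma>) \<ge> 2 * Im \<tau>" using Im by simp
      moreover have "2 * Im \<tau> \<ge> 1 / 2 ^ Suc n" using Suc.prems by simp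
      ultimately have "\<exists>\<tau>'. Im \<tau>' \<ge> 1 / 2 \<and> f \<tau>' = f (- 1 / \<sigma>)" by (intro Suc.IH) linarith
      then show ?thesis using S[OF pos] f\<sigma> by simp
    qed
  qed
  obtain n where "(1 / 2) ^ n < Im \<tau>" using real_arch_pow_inv[OF assms(3), of "1/2"] by auto
  moreover have "1 / 2 ^ Suc n \<le> (1 / 2 :: real) ^ n" by (simp add: power_divide field_simps)
  ultimately have "Im \<tau> \<ge> 1 / 2 ^ Suc n" by linarith
  then show ?thesis by (rule claim)
qed

text \<open>As a function of \<open>q\<close>, \<open>g\<close> is automatically invariant under
  translations of the half-plane. Inversion is assumed on the imaginary axis only, which is the form
  in which Poisson summation supplies it.\<close>

theorem modular_invariant_constant:
  fixes g :: "complex \<Rightarrow> complex"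
  assumes holo: "g holomorphic_on ball 0 1"
    and inv: "\<And>t. t > 0 \<Longrightarrow> g (of_real (exp (- (2 * pi / t)))) = g (of_real (exp (- (2 * pi * t))))"
    and q: "q \<in> ball 0 1"
  shows "g q = g 0"
proof -
  define e where "e \<tau> = exp (2 * of_real pi * \<i> * \<tau>)" for \<tau>
  define H where "H = {\<tau>::complex. Im \<tau> > 0}"
  have en: "norm (e \<tau>) = exp (- (2 * pi * Im \<tau>))" for \<tau> by (simp add: e_def)
  have eb: "e \<tau> \<in> ball 0 1" if "\<tau> \<in> H" for \<tau> using that by (simp add: en H_def)
  have Hinv: "- 1 / \<tau> \<in> H" if "\<tau> \<in> H" for \<tau>
    using that by (auto simp: H_def Im_divide sum_power2_gt_zero_iff intro!: divide_pos_pos)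
  have H0: "\<tau> \<noteq> 0" if "\<tau> \<in> H" for \<tau> using that by (auto simp: H_def)
  \<comment> \<open>The difference is holomorphic on the upper half-plane and vanishes on the
    imaginary axis, so the identity theorem applies.\<close>
  have S: "g (e (- 1 / \<tau>)) - g (e \<tau>) = 0" if "\<tau> \<in> H" for \<tau>
  proof (rule analytic_continuation[where f = "\<lambda>\<tau>. g (e (- 1 / \<tau>)) - g (e \<tau>)" and S = H and U = "(\<lambda>t. \<i> * of_real t) ` {0<..}" and \<xi> = \<i>])
    have "e holomorphic_on H" "(\<lambda>\<tau>. e (- 1 / \<tau>)) holomorphic_on H"
      unfolding e_def using H0 by (auto intro!: holomorphic_intros)
    moreover have "e ` H \<subseteq> ball 0 1" "(\<lambda>\<tau>. e (- 1 / \<tau>)) ` H \<subseteq> ball 0 1"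
      using eb Hinv by blast+
    ultimately have "(g \<circ> e) holomorphic_on H" "(g \<circ> (\<lambda>\<tau>. e (- 1 / \<tau>))) holomorphic_on H"
      by (simp_all add: holomorphic_on_compose_gen[OF _ holo])
    then show "(\<lambda>\<tau>. g (e (- 1 / \<tau>)) - g (e \<tau>)) holomorphic_on H"
      by (auto simp: o_def intro!: holomorphic_intros)
    show "open H" unfolding H_def by (rule open_halfspace_Im_gt)
    show "connected H" unfolding H_def by (intro convex_connected convex_halfspace_Im_gt)
    show "(\<lambda>t. \<i> * of_real t) ` {0<..} \<subseteq> H" by (auto simp: H_def)
    show "\<i> \<in> H" by (simp add: H_def)
    show "\<i> islimpt (\<lambda>t. \<i> * of_real t) ` {0<..}"
      unfolding islimpt_approachable
    proof (intro allI impI)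
      fix \<epsilon> :: real assume "\<epsilon> > 0"
      then show "\<exists>x'\<in>(\<lambda>t. \<i> * of_real t) ` {0<..}. x' \<noteq> \<i> \<and> dist x' \<i> < \<epsilon>"
        by (intro bexI[of _ "\<i> * of_real (1 + \<epsilon> / 2)"])
           (auto simp: dist_norm algebra_simps complex_eq_iff norm_mult norm_divide)
    qed
    fix z assume "z \<in> (\<lambda>t. \<i> * of_real t) ` {0<..}"
    then obtain t :: real where t: "t > 0" and z: "z = \<i> * of_real t" by auto
    have "e (- 1 / z) = of_real (exp (- (2 * pi / t)))" "e z = of_real (exp (- (2 * pi * t)))"
      using t by (simp_all add: e_def z exp_of_real[symmetric] field_simps)
    then show "g (e (- 1 / z)) - g (e z) = 0" using inv[OF t] by simp
  qed (use that in auto)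
  have T: "g (e (\<tau> + of_int k)) = g (e \<tau>)" for \<tau> k
  proof -
    have "exp (2 * of_real pi * \<i> * of_int k) = 1"
      using exp_integer_2pi[of "of_int k"] by (simp add: mult_ac)
    then show ?thesis by (simp add: e_def distrib_left exp_add)
  qed
  \<comment> \<open>The radius \<open>exp (- pi)\<close> corresponds to imaginary part 1/2: every
    value of \<open>g\<close> is taken on this compact smaller disc, so the modulus has a maximum
    inside the unit disc.\<close>
  have small: "\<exists>q'\<in>cball 0 (exp (- pi)). g q' = g q" if "q \<in> ball 0 1" for q
  proof (cases "q = 0")
    case True
    then show ?thesis by (auto intro!: bexI[of _ 0])
  next
    case False
    define \<tau> where "\<tau> = Ln q / (2 * of_real pi * \<i>)"
    have e\<tau>: "e \<tau> = q" using False by (simp add: e_def \<tau>_def)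
    have "exp (- (2 * pi * Im \<tau>)) < exp 0" using that en[of \<tau>] by (simp add: e\<tau>)
    then have "Im \<tau> > 0" by (simp only: exp_less_cancel_iff) (simp add: zero_less_mult_iff)
    from invariant_reach[of "\<lambda>\<tau>. g (e \<tau>)", OF T _ this] S obtain \<tau>' where \<tau>': "Im \<tau>' \<ge> 1 / 2" "g (e \<tau>') = g (e \<tau>)"
      unfolding H_def by fastforce
    have "e \<tau>' \<in> cball 0 (exp (- pi))" using \<tau>'(1) by (simp add: en)
    then show ?thesis using \<tau>'(2) e\<tau> by auto
  qed
  have "exp (- pi) < exp 0" by (simp only: exp_less_cancel_iff) simp
  then have sub: "cball 0 (exp (- pi)) \<subseteq> ball (0::complex) 1" by (simp add: cball_subset_ball_iff)
  obtain z where z: "z \<in> cball 0 (exp (- pi))" "\<And>w. w \<in> cball 0 (exp (- pi)) \<Longrightarrow> norm (g w) \<le> norm (g z)"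
  proof -
    have "continuous_on (cball 0 (exp (- pi))) (\<lambda>w. norm (g w))"
      by (intro continuous_intros holomorphic_on_imp_continuous_on holomorphic_on_subset[OF holo] sub)
    then show ?thesis using continuous_attains_sup[of "cball 0 (exp (- pi))" "\<lambda>w. norm (g w)"] that by (auto simp: less_imp_le)
  qed
  have "g constant_on ball 0 1"
  proof (rule maximum_modulus_principle[OF holo, of "ball 0 1" z])
    show "norm (g w) \<le> norm (g z)" if "w \<in> ball 0 1" for w using small[OF that] z(2) by metis
  qed (use z sub in auto)
  then show ?thesis using q unfolding constant_on_def by auto
qed

section \<open>Euler's product and its inversion formula\<close>

definition euler_prod :: "complex \<Rightarrow> complex" where
  "euler_prod q = (\<Prod>n. 1 - q ^ Suc n)"

lemma euler_prod_convergent: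
  assumes "q \<in> ball (0::complex) 1"
  shows "convergent_prod (\<lambda>n. 1 - q ^ Suc n)"
proof (rule abs_convergent_prod_imp_convergent_prod, rule summable_imp_abs_convergent_prod)
  show "summable (\<lambda>n. norm (1 - q ^ Suc n - 1))"
    using assms by (auto simp: norm_power norm_mult intro!: summable_mult summable_geometric)
qed

lemma euler_prod_tendsto:
  assumes "q \<in> ball (0::complex) 1"
  shows "(\<lambda>n. \<Prod>k<n. 1 - q ^ Suc k) \<longlonglongrightarrow> euler_prod q"
  using convergent_prod_LIMSEQ[OF euler_prod_convergent[OF assms]] unfolding euler_prod_def
  by (simp add: LIMSEQ_lessThan_iff_atMost)

lemma euler_prod_nonzero:
  assumes "q \<in> ball (0::complex) 1"
  shows "euler_prod q \<noteq> 0"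
  unfolding euler_prod_def
proof (rule prodinf_nonzero[OF euler_prod_convergent[OF assms]])
  fix n
  have "norm q ^ Suc n \<le> norm q ^ 1" using assms by (intro power_decreasing) auto
  then have "norm (q ^ Suc n) < 1" using assms by (simp add: norm_power norm_mult)
  then show "1 - q ^ Suc n \<noteq> 0" by (metis eq_iff_diff_eq_0 less_irrefl norm_one)
qed

lemma euler_prod_holomorphic: "euler_prod holomorphic_on ball 0 1"
proof (rule holomorphic_uniform_sequence)
  fix x :: complex assume x: "x \<in> ball 0 1"
  define d where "d = (1 - norm x) / 2"
  define r where "r = norm x + d"
  have d0: "d > 0" and r: "0 < r" "r < 1" using x norm_ge_zero[of x] by (auto simp: d_def r_def field_simps simp del: norm_ge_zero)
  have b: "norm z \<le> r" if "z \<in> cball x d" for z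
    using that norm_triangle_ineq[of x "z - x"] by (simp add: r_def dist_norm norm_minus_commute)
  have d: "d > 0" "cball x d \<subseteq> ball 0 1" using d0 b r by fastforce+
  have "uniformly_convergent_on (cball x d) (\<lambda>N z. \<Prod>n<N. 1 - z ^ Suc n)"
  proof (rule uniformly_convergent_on_prod')
    show "uniformly_convergent_on (cball x d) (\<lambda>N z. \<Sum>n<N. norm (1 - z ^ Suc n - 1))"
    proof (rule Weierstrass_m_test')
      show "summable (\<lambda>n. r ^ Suc n)" using r by (subst summable_Suc_iff) (auto intro: summable_geometric)
      show "norm (norm (1 - z ^ Suc n - 1)) \<le> r ^ Suc n" if "z \<in> cball x d" for n z
        using b[OF that] by (simp add: norm_power norm_mult del: power_Suc) (intro power_mono, auto)
    qed
  qed (auto intro!: continuous_intros)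
  then obtain l where l: "uniform_limit (cball x d) (\<lambda>N z. \<Prod>n<N. 1 - z ^ Suc n) l sequentially"
    unfolding uniformly_convergent_on_def by blast
  have "l z = euler_prod z" if "z \<in> cball x d" for z
    using tendsto_uniform_limitI[OF l that] euler_prod_tendsto[of z] d(2) that LIMSEQ_unique by blast
  then have "uniform_limit (cball x d) (\<lambda>N z. \<Prod>n<N. 1 - z ^ Suc n) euler_prod sequentially"
    using l by (subst uniform_limit_cong'[where g = "\<lambda>N z. \<Prod>n<N. 1 - z ^ Suc n" and i = l]) auto
  then show "\<exists>d>0. cball x d \<subseteq> ball 0 1 \<and> uniform_limit (cball x d) (\<lambda>N z. \<Prod>n<N. 1 - z ^ Suc n) euler_prod sequentially"
    using d by blast
qed (auto intro!: holomorphic_intros)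

text \<open>Shanks' finite form of Euler's pentagonal number theorem, with \<open>q = r^2\<close> so
  that no exponent needs division by 2. The summand \<open>s = 0\<close> is the partial Euler
  product; the others carry high powers of \<open>r\<close>.\<close>

lemma shanks_identity:
  fixes r :: "'a::comm_ring_1"
  shows "(\<Sum>s\<le>n. (-1) ^ s * (\<Prod>k\<in>{s<..n}. 1 - r ^ (2 * k)) * r ^ (2 * s * n + s * (s + 1)))
    = 1 + (\<Sum>k=1..n. (-1) ^ k * (r ^ (k * (3 * k + 1)) + r ^ (k * (3 * k - 1))))"
proof (induction n)
  case (Suc n)
  define Q where "Q s = (\<Prod>k\<in>{s<..n}. 1 - r ^ (2 * k))" for s
  \<comment> \<open>A telescoping certificate: by \<open>tel\<close>, passing from \<open>n\<close>
    to \<open>Suc n\<close> changes the summand at \<open>s\<close> by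
    \<open>G (Suc s) - G s\<close>.\<close>
  define G where "G s = (case s of 0 \<Rightarrow> 0 | Suc u \<Rightarrow> (-1) ^ s * Q u * r ^ (2 * s * Suc n + s * u))" for s
  have Qs: "(\<Prod>k\<in>{s<..Suc n}. 1 - r ^ (2 * k)) = (1 - r ^ (2 * Suc n)) * Q s" if "s \<le> n" for s
  proof -
    have "{s<..Suc n} = insert (Suc n) {s<..n}" using that by auto
    then show ?thesis by (simp add: Q_def)
  qed
  have Qu: "Q u = (1 - r ^ (2 * Suc u)) * Q (Suc u)" if "Suc u \<le> n" for u
  proof -
    have "{u<..n} = insert (Suc u) {Suc u<..n}" using that by auto
    then show ?thesis by (simp add: Q_def)
  qed
  have tel: "(-1) ^ s * ((1 - r ^ (2 * Suc n)) * Q s) * r ^ (2 * s * Suc n + s * (s + 1))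
      - (-1) ^ s * Q s * r ^ (2 * s * n + s * (s + 1)) = G (Suc s) - G s" if "s \<le> n" for s
  proof (cases s)
    case 0
    then have "G (Suc s) = - (Q 0 * r ^ (2 * Suc n))" "G s = 0" by (simp_all add: G_def)
    then show ?thesis using 0 by (simp add: left_diff_distrib del: power_Suc mult_Suc_right)
  next
    case (Suc u)
    have e1: "2 * s * Suc n + s * (s + 1) = (2 * s * n + s * (s + 1)) + 2 * s"
      and e2: "2 * Suc s * Suc n + Suc s * s = (2 * s * n + s * (s + 1)) + 2 * s + 2 * Suc n"
      and e3: "2 * s * Suc n + s * u = 2 * s * n + s * (s + 1)"
      using Suc by (simp_all add: algebra_simps)
    have "G (Suc s) = - ((-1) ^ s * Q s * r ^ ((2 * s * n + s * (s + 1)) + 2 * s + 2 * Suc n))"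
      unfolding e2[symmetric] by (simp add: G_def)
    moreover have "G s = (-1) ^ s * ((1 - r ^ (2 * s)) * Q s) * r ^ (2 * s * n + s * (s + 1))"
      unfolding e3[symmetric] using Qu[of u] that Suc by (simp add: G_def)
    ultimately show ?thesis unfolding e1 power_add by (simp add: algebra_simps)
  qed
  have telescope: "(\<Sum>s\<le>m. g (Suc s) - g s) = g (Suc m) - g 0" for g :: "nat \<Rightarrow> 'a" and m
    by (induction m) auto
  have top: "(\<Sum>s\<le>n. G (Suc s) - G s) = G (Suc n)"
    unfolding telescope by (simp add: G_def)
  have "(\<Sum>s\<le>Suc n. (-1) ^ s * (\<Prod>k\<in>{s<..Suc n}. 1 - r ^ (2 * k)) * r ^ (2 * s * Suc n + s * (s + 1)))
    = (\<Sum>s\<le>n. (-1) ^ s * ((1 - r ^ (2 * Suc n)) * Q s) * r ^ (2 * s * Suc n + s * (s + 1)))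
      + (-1) ^ Suc n * r ^ (2 * Suc n * Suc n + Suc n * (Suc n + 1))"
    unfolding sum.atMost_Suc by (intro arg_cong2[where f = "(+)"] sum.cong refl) (simp_all only: Qs atMost_iff, simp)
  also have "(\<Sum>s\<le>n. (-1) ^ s * ((1 - r ^ (2 * Suc n)) * Q s) * r ^ (2 * s * Suc n + s * (s + 1)))
    = (\<Sum>s\<le>n. (-1) ^ s * Q s * r ^ (2 * s * n + s * (s + 1))) + G (Suc n)"
    unfolding top[symmetric] sum.distrib[symmetric]
    by (intro sum.cong refl) (simp only: tel[symmetric] atMost_iff, simp)
  also have "(\<Sum>s\<le>n. (-1) ^ s * Q s * r ^ (2 * s * n + s * (s + 1)))
    = 1 + (\<Sum>k=1..n. (-1) ^ k * (r ^ (k * (3 * k + 1)) + r ^ (k * (3 * k - 1))))"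
    using Suc.IH by (simp add: Q_def)
  \<comment> \<open>With \<open>k = Suc n\<close>, the boundary value \<open>G (Suc n)\<close>
    supplies the exponent \<open>k (3 k - 1)\<close> and the new summand \<open>s = Suc n\<close>
    the exponent \<open>k (3 k + 1)\<close>.\<close>
  also have "\<dots> + G (Suc n) + (-1) ^ Suc n * r ^ (2 * Suc n * Suc n + Suc n * (Suc n + 1))
    = 1 + (\<Sum>k=1..Suc n. (-1) ^ k * (r ^ (k * (3 * k + 1)) + r ^ (k * (3 * k - 1))))"
  proof -
    have "2 * Suc n * Suc n + Suc n * (Suc n + 1) = Suc n * (3 * Suc n + 1)"
      "2 * Suc n * Suc n + Suc n * n = Suc n * (3 * Suc n - 1)" by (simp_all add: algebra_simps)
    moreover have "Q n = 1" by (simp add: Q_def)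
    ultimately show ?thesis by (simp add: G_def algebra_simps del: mult_Suc mult_Suc_right)
  qed
  finally show ?case .
qed simp

text \<open>In Shanks' identity each of the \<open>n\<close> summands with \<open>s \<ge> 1\<close>
  is at most \<open>q ^ n\<close> in absolute value, its exponent of \<open>r\<close> being at least
  \<open>2 * n\<close>; so the remainder \<open>R\<close> tends to 0 and the Euler product
  survives.\<close>

lemma pentagonal_tendsto:
  fixes r :: real
  assumes r: "0 < r" "r < 1"
  shows "(\<lambda>n. complex_of_real (1 + (\<Sum>k=1..n. (-1) ^ k * (r ^ (k * (3 * k + 1)) + r ^ (k * (3 * k - 1)))))) \<longlonglongrightarrow> euler_prod (of_real (r\<^sup>2))"
proof -
  define q where "q = r\<^sup>2"
  have q: "0 < q" "q < 1" using r by (auto simp: q_def power_less_one_iff)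
  define P where "P s n = (\<Prod>k\<in>{s<..n}. 1 - q ^ k)" for s n :: nat
  define R where "R n = (\<Sum>s=1..n. (-1) ^ s * P s n * r ^ (2 * s * n + s * (s + 1)))" for n
  have P01: "0 \<le> P s n" "P s n \<le> 1" for s n
    unfolding P_def using q by (auto intro!: prod_nonneg prod_le_1 simp: power_le_one)
  have eq: "1 + (\<Sum>k=1..n. (-1) ^ k * (r ^ (k * (3 * k + 1)) + r ^ (k * (3 * k - 1)))) = P 0 n + R n" for n
  proof -
    have "{..n} = insert 0 {1..n}" by auto
    then have "(\<Sum>s\<le>n. (-1) ^ s * P s n * r ^ (2 * s * n + s * (s + 1))) = P 0 n + R n"
      unfolding R_def by simp
    then show ?thesis using shanks_identity[where n = n and r = r] by (simp add: P_def q_def power_mult)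
  qed
  have "norm (R n) \<le> real n * q ^ n" for n
  proof -
    have "norm (R n) \<le> (\<Sum>s=1..n. norm ((-1) ^ s * P s n * r ^ (2 * s * n + s * (s + 1))))"
      unfolding R_def by (rule norm_sum)
    also have "\<dots> \<le> (\<Sum>s=1..n. q ^ n)"
    proof (rule sum_mono)
      fix s assume s: "s \<in> {1..n}"
      have "r ^ (2 * s * n + s * (s + 1)) \<le> r ^ (2 * n)"
        using r s by (intro power_decreasing) (auto intro: trans_le_add1)
      then have "P s n * r ^ (2 * s * n + s * (s + 1)) \<le> 1 * q ^ n"
        unfolding q_def power_mult[symmetric] using P01 r by (intro mult_mono) auto
      then show "norm ((-1) ^ s * P s n * r ^ (2 * s * n + s * (s + 1))) \<le> q ^ n"
        using P01 r by (simp add: norm_mult abs_mult power_abs)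
    qed
    finally show ?thesis by simp
  qed
  moreover have "(\<lambda>n. real n * q ^ n) \<longlonglongrightarrow> 0" using powser_times_n_limit_0[of q] q by simp
  ultimately have R0: "R \<longlonglongrightarrow> 0" by (rule Lim_null_comparison[OF always_eventually, rule_format])
  have "(\<lambda>n. complex_of_real (P 0 n)) \<longlonglongrightarrow> euler_prod (of_real q)"
  proof -
    have "P 0 n = (\<Prod>k<n. 1 - q ^ Suc k)" for n
      unfolding P_def by (rule prod.reindex_bij_witness[of _ Suc "\<lambda>k. k - 1"]) auto
    then show ?thesis using euler_prod_tendsto[of "of_real q"] q by simp
  qed
  then have "(\<lambda>n. complex_of_real (P 0 n) + of_real (R n)) \<longlonglongrightarrow> euler_prod (of_real q) + of_real 0"
    by (intro tendsto_add tendsto_of_real R0)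
  then show ?thesis unfolding eq q_def by simp
qed

text \<open>Dedekind's eta function at \<open>\<i> t\<close>, through its pentagonal series. The
  sign is written as a character and the exponent as a completed square, so that the series is a
  Poisson sum with shift -1/6.\<close>

definition eta_series :: "real \<Rightarrow> complex" where
  "eta_series t = (\<Sum>\<^sub>\<infinity>j::int. cis (pi * of_int j) * of_real (exp (- (3 * pi * t) * (of_int j - 1 / 6)\<^sup>2)))"

lemma cis_pi_int: "cis (pi * of_int (int k)) = (-1) ^ k" "cis (pi * of_int (- int k)) = (-1) ^ k"
proof -
  show "cis (pi * of_int (int k)) = (-1) ^ k"
    by (induction k) (simp_all add: distrib_left flip: cis_mult)
  then have "cnj (cis (pi * of_int (int k))) = (-1) ^ k" by simp
  then show "cis (pi * of_int (- int k)) = (-1) ^ k" by (simp add: cis_cnj)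
qed

lemma eta_series_summable:
  assumes "t > 0"
  shows "(\<lambda>j::int. cis (pi * of_int j) * of_real (exp (- (3 * pi * t) * (of_int j - 1 / 6)\<^sup>2))) summable_on UNIV"
proof (rule abs_summable_summable)
  show "(\<lambda>j::int. norm (cis (pi * of_int j) * of_real (exp (- (3 * pi * t) * (of_int j - 1 / 6)\<^sup>2)))) summable_on UNIV"
    using gaussian_int_summable[of "3 * pi * t" "- 1 / 6"] assms by (simp add: norm_mult)
qed

text \<open>Completing the square: \<open>3 (j - 1/6)^2 = j (3 j - 1) + 1/12\<close>. The constant
  gives the factor \<open>q\<close> to the power 1/24; positive and negative \<open>j\<close> give
  the two families of pentagonal exponents.\<close>

lemma eta_series_eq:
  assumes t: "t > 0"
  shows "eta_series t = of_real (exp (- (pi * t / 12))) * euler_prod (of_real (exp (- (2 * pi * t))))"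
proof -
  define r where "r = exp (- (pi * t))"
  have r: "0 < r" "r < 1" using t by (auto simp: r_def)
  define f where "f j = cis (pi * of_int j) * of_real (exp (- (3 * pi * t) * (of_int j - 1 / 6)\<^sup>2))" for j :: int
  define c where "c = complex_of_real (exp (- (pi * t / 12)))"
  have rp: "r ^ k = exp (- (pi * t * real k))" for k by (simp add: r_def mult_ac flip: exp_of_nat_mult)
  have f1: "f (- int k) = c * of_real ((-1) ^ k * r ^ (k * (3 * k + 1)))" for k
  proof -
    have "- (3 * pi * t) * (of_int (- int k) - 1 / 6)\<^sup>2 = - (pi * t / 12) + - (pi * t * real (k * (3 * k + 1)))"
      by (simp add: power2_eq_square field_simps)
    then have "exp (- (3 * pi * t) * (of_int (- int k) - 1 / 6)\<^sup>2) = exp (- (pi * t / 12)) * r ^ (k * (3 * k + 1))"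
      unfolding rp by (simp only: exp_add)
    then show ?thesis unfolding f_def cis_pi_int c_def by simp
  qed
  have f2: "f (int k) = c * of_real ((-1) ^ k * r ^ (k * (3 * k - 1)))" if "k \<ge> 1" for k
  proof -
    have e: "real (k * (3 * k - 1)) = 3 * (real k)\<^sup>2 - real k" using that by (simp add: of_nat_diff power2_eq_square algebra_simps)
    have "- (3 * pi * t) * (of_int (int k) - 1 / 6)\<^sup>2 = - (pi * t / 12) + - (pi * t * real (k * (3 * k - 1)))"
      unfolding e by (simp add: power2_eq_square field_simps)
    then have "exp (- (3 * pi * t) * (of_int (int k) - 1 / 6)\<^sup>2) = exp (- (pi * t / 12)) * r ^ (k * (3 * k - 1))"
      unfolding rp by (simp only: exp_add)
    then show ?thesis unfolding f_def cis_pi_int c_def by simp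
  qed
  define u where "u k = (-1) ^ k * r ^ (k * (3 * k + 1))" for k
  define v where "v k = (-1) ^ k * r ^ (k * (3 * k - 1))" for k
  have "(\<Sum>j\<in>{- int n..int n}. f j) = c * of_real (1 + (\<Sum>k=1..n. u k + v k))" for n
  proof (induction n)
    case 0
    show ?case using f1[of 0] by (simp add: u_def)
  next
    case (Suc n)
    have "{- int (Suc n)..int (Suc n)} = insert (- int (Suc n)) (insert (int (Suc n)) {- int n..int n})" by auto
    then have "(\<Sum>j\<in>{- int (Suc n)..int (Suc n)}. f j) = f (- int (Suc n)) + (f (int (Suc n)) + (\<Sum>j\<in>{- int n..int n}. f j))"
      by (simp del: of_nat_Suc)
    then show ?case unfolding Suc f1 u_def[symmetric] using f2[of "Suc n", folded v_def] by (simp add: ring_distribs del: of_nat_Suc)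
  qed
  then have part: "(\<Sum>j\<in>{- int n..int n}. f j) = c * of_real (1 + (\<Sum>k=1..n. (-1) ^ k * (r ^ (k * (3 * k + 1)) + r ^ (k * (3 * k - 1)))))" for n
    by (simp add: u_def v_def distrib_left)
  have "(f has_sum eta_series t) UNIV"
    unfolding eta_series_def f_def by (rule has_sum_infsum[OF eta_series_summable[OF t]])
  then have "((\<lambda>X. sum f X) \<longlongrightarrow> eta_series t) (finite_subsets_at_top UNIV)" by (simp add: has_sum_def)
  moreover have "filterlim (\<lambda>n. {- int n..int n}) (finite_subsets_at_top UNIV) sequentially"
  proof (rule filterlim_finite_subsets_at_top_UNIV)
    fix x :: int
    show "\<forall>\<^sub>F n in sequentially. x \<in> {- int n..int n}"
      using eventually_ge_at_top[of "nat \<bar>x\<bar>"] by eventually_elim auto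
  qed simp
  ultimately have "(\<lambda>n. \<Sum>j\<in>{- int n..int n}. f j) \<longlonglongrightarrow> eta_series t" by (rule filterlim_compose)
  moreover have "(\<lambda>n. \<Sum>j\<in>{- int n..int n}. f j) \<longlonglongrightarrow> c * euler_prod (of_real (r\<^sup>2))"
    unfolding part by (intro tendsto_mult_left pentagonal_tendsto r)
  ultimately have "eta_series t = c * euler_prod (of_real (r\<^sup>2))" by (rule LIMSEQ_unique)
  moreover have "r\<^sup>2 = exp (- (2 * pi * t))" unfolding rp by (simp add: mult_ac)
  ultimately show ?thesis by (simp add: c_def)
qed

lemma infsum_int_mod_3:
  fixes f :: "int \<Rightarrow> complex"
  assumes "f summable_on UNIV"
  shows "infsum f UNIV = (\<Sum>\<^sub>\<infinity>n. f (3 * n)) + (\<Sum>\<^sub>\<infinity>n. f (3 * n + 1)) + (\<Sum>\<^sub>\<infinity>n. f (3 * n + 2))"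
proof -
  let ?A = "\<lambda>j. range (\<lambda>n::int. 3 * n + j)"
  have s: "f summable_on A" for A using summable_on_subset_banach[OF assms] by blast
  have m: "k \<in> ?A 0 \<union> ?A 1 \<union> ?A 2" for k :: int
  proof -
    have "\<exists>n. k = 3 * n + 0 \<or> k = 3 * n + 1 \<or> k = 3 * n + 2" by presburger
    then show ?thesis by blast
  qed
  then have U: "UNIV = ?A 0 \<union> ?A 1 \<union> ?A 2" by blast
  have d: "(?A 0 \<union> ?A 1) \<inter> ?A 2 = {}" "?A 0 \<inter> ?A 1 = {}" by (auto, presburger+)
  have "infsum f (?A 0 \<union> ?A 1 \<union> ?A 2) = infsum f (?A 0) + infsum f (?A 1) + infsum f (?A 2)"
    unfolding infsum_Un_disjoint[OF s s d(1)] infsum_Un_disjoint[OF s s d(2)] ..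
  then have "infsum f UNIV = infsum f (?A 0) + infsum f (?A 1) + infsum f (?A 2)"
    by (simp only: U[symmetric])
  moreover have J: "infsum f (?A j) = (\<Sum>\<^sub>\<infinity>n. f (3 * n + j))" for j
    by (subst infsum_reindex) (auto simp: inj_on_def o_def)
  ultimately show ?thesis using J[of 0] by simp
qed

text \<open>Poisson summation with shift -1/6 and character 1/2 gives a dual sum with centre 1/2 and
  sixth roots of unity as phases. Modulo 3, the class 0 is the series at \<open>1 / t\<close>, the
  class 1 is a rotated copy of it, and the class 2 cancels itself.\<close>

theorem eta_series_inversion:
  assumes t: "t > 0"
  shows "eta_series (1 / t) = of_real (sqrt t) * eta_series t"
proof -
  define a where "a k = complex_of_real (exp (- pi * (of_int k - 1 / 2)\<^sup>2 / (3 * t))) * cis (2 * pi * of_int k * (- 1 / 6))" for k :: int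
  have poisson: "(\<Sum>\<^sub>\<infinity>m::int. of_real (exp (- pi * (3 * t) * (- 1 / 6 + of_int m)\<^sup>2)) * cis (2 * pi * (- 1 / 6 + of_int m) * (1 / 2)))
    = of_real (1 / sqrt (3 * t)) * infsum a UNIV"
    unfolding a_def using poisson_summation_gaussian[of "3 * t" "- 1 / 6" "1 / 2"] t by simp
  have "of_real (exp (- pi * (3 * t) * (- 1 / 6 + of_int m)\<^sup>2)) * cis (2 * pi * (- 1 / 6 + of_int m) * (1 / 2))
    = cis (- pi / 6) * (cis (pi * of_int m) * of_real (exp (- (3 * pi * t) * (of_int m - 1 / 6)\<^sup>2)))" for m :: int
  proof -
    have "cis (2 * pi * (- 1 / 6 + of_int m) * (1 / 2)) = cis (- pi / 6) * cis (pi * of_int m)"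
      by (simp add: cis_mult algebra_simps)
    moreover have "- pi * (3 * t) * (- 1 / 6 + of_int m)\<^sup>2 = - (3 * pi * t) * (of_int m - 1 / 6)\<^sup>2"
      by (simp add: algebra_simps)
    ultimately show ?thesis by (simp add: mult_ac)
  qed
  then have lhs: "cis (- pi / 6) * eta_series t = of_real (1 / sqrt (3 * t)) * infsum a UNIV"
    unfolding eta_series_def poisson[symmetric] by (simp only: infsum_cmult_right')
  have asum: "a summable_on UNIV"
  proof (rule abs_summable_summable)
    show "(\<lambda>j. norm (a j)) summable_on UNIV"
      using gaussian_int_summable[of "pi / (3 * t)" "- 1 / 2"] t by (simp add: a_def norm_mult)
  qed
  let ?h = "\<lambda>j::int. cis (pi * of_int j) * of_real (exp (- (3 * pi * (1 / t)) * (of_int j - 1 / 6)\<^sup>2))"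
  have cm: "cis (- (pi * of_int n)) = cis (pi * of_int n)" for n :: int
  proof -
    have "cis (- (pi * of_int n)) = cis (pi * of_int n) * cis (2 * pi * of_int (- n))"
      by (simp add: cis_mult)
    then show ?thesis using cis_multiple_2pi[of "of_int (- n)"] by simp
  qed
  have a0: "(\<Sum>\<^sub>\<infinity>n. a (3 * n)) = eta_series (1 / t)"
    unfolding eta_series_def
  proof (rule infsum_cong)
    fix n :: int
    have "- pi * (of_int (3 * n) - 1 / 2)\<^sup>2 / (3 * t) = - (3 * pi * (1 / t)) * (of_int n - 1 / 6)\<^sup>2"
      using t by (simp add: power2_eq_square field_simps)
    moreover have "cis (2 * pi * of_int (3 * n) * (- 1 / 6)) = cis (pi * of_int n)" using cm[of n] by simp
    ultimately show "a (3 * n) = ?h n" unfolding a_def by (simp only: mult.commute)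
  qed
  have a1: "(\<Sum>\<^sub>\<infinity>n. a (3 * n + 1)) = cis (- pi / 3) * eta_series (1 / t)"
  proof -
    have "(\<Sum>\<^sub>\<infinity>n. a (3 * n + 1)) = (\<Sum>\<^sub>\<infinity>n. a (3 * (- n) + 1))"
      by (rule infsum_reindex_bij_witness[of _ uminus uminus]) auto
    also have "\<dots> = (\<Sum>\<^sub>\<infinity>n. cis (- pi / 3) * ?h n)"
    proof (rule infsum_cong)
      fix n :: int
      have "- pi * (of_int (3 * (- n) + 1) - 1 / 2)\<^sup>2 / (3 * t) = - (3 * pi * (1 / t)) * (of_int n - 1 / 6)\<^sup>2"
        using t by (simp add: power2_eq_square field_simps)
      moreover have "cis (2 * pi * of_int (3 * (- n) + 1) * (- 1 / 6)) = cis (- pi / 3) * cis (pi * of_int n)"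
        by (simp add: cis_mult algebra_simps)
      ultimately show "a (3 * (- n) + 1) = cis (- pi / 3) * ?h n" unfolding a_def by (simp only: mult_ac)
    qed
    finally show ?thesis by (simp only: infsum_cmult_right' eta_series_def)
  qed
  \<comment> \<open>The reflection of \<open>n\<close> to \<open>- 1 - n\<close> negates
    \<open>3 n + 3/2\<close>, hence keeps the Gaussian, while it reverses the sign of the
    phase.\<close>
  have a2: "(\<Sum>\<^sub>\<infinity>n. a (3 * n + 2)) = 0"
  proof -
    have "(\<Sum>\<^sub>\<infinity>n. a (3 * n + 2)) = (\<Sum>\<^sub>\<infinity>n. a (3 * (- 1 - n) + 2))"
      by (rule infsum_reindex_bij_witness[of _ "\<lambda>n. - 1 - n" "\<lambda>n. - 1 - n"]) auto
    also have "\<dots> = (\<Sum>\<^sub>\<infinity>n. - 1 * a (3 * n + 2))"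
    proof (rule infsum_cong)
      fix n :: int
      have "- pi * (of_int (3 * (- 1 - n) + 2) - 1 / 2)\<^sup>2 / (3 * t) = - pi * (of_int (3 * n + 2) - 1 / 2)\<^sup>2 / (3 * t)"
        using t by (simp add: power2_eq_square field_simps)
      moreover have "cis (2 * pi * of_int (3 * (- 1 - n) + 2) * (- 1 / 6)) = cis (pi * of_int n) * cis (pi / 3)"
        "cis (2 * pi * of_int (3 * n + 2) * (- 1 / 6)) = cis (- (pi * of_int n)) * cis (- (2 * pi / 3))"
        by (simp_all add: cis_mult algebra_simps)
      moreover have "cis (- (2 * pi / 3)) = - cis (pi / 3)"
        by (simp add: complex_eq_iff cos_120 sin_120 cos_60 sin_60)
      ultimately show "a (3 * (- 1 - n) + 2) = - 1 * a (3 * n + 2)" unfolding a_def cm by simp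
    qed
    finally show ?thesis unfolding infsum_cmult_right' by simp
  qed
  \<comment> \<open>The sum of the classes 0 and 1: \<open>sqrt 3\<close> cancels against the scale
    \<open>3 * t\<close>, and \<open>cis (- pi / 6)\<close> against the phase that the shifted
    character leaves on the other side.\<close>
  have "1 + cis (- pi / 3) = of_real (sqrt 3) * cis (- pi / 6)"
    by (simp add: complex_eq_iff cos_60 sin_60 cos_30 sin_30)
  then have "infsum a UNIV = of_real (sqrt 3) * cis (- pi / 6) * eta_series (1 / t)"
    unfolding infsum_int_mod_3[OF asum] a0 a1 a2 by (metis (no_types, lifting) add.right_neutral distrib_right mult_1)
  then have "cis (- pi / 6) * eta_series t = cis (- pi / 6) * (of_real (1 / sqrt t) * eta_series (1 / t))"
    unfolding lhs by (simp add: real_sqrt_mult)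
  then have "eta_series t = of_real (1 / sqrt t) * eta_series (1 / t)"
    using mult_left_cancel[OF cis_neq_zero[of "- pi / 6"]] by blast
  then show ?thesis using t by (simp add: field_simps)
qed

text \<open>The 24th power of the eta inversion removes the fractional power of \<open>q\<close> and
  the square root of \<open>t\<close>: this is the weight 12 law of the discriminant.\<close>

lemma euler_prod_inversion:
  assumes t: "t > 0"
  shows "of_real (exp (- (2 * pi / t))) * euler_prod (of_real (exp (- (2 * pi / t)))) ^ 24
    = of_real (t ^ 12) * (of_real (exp (- (2 * pi * t))) * euler_prod (of_real (exp (- (2 * pi * t)))) ^ 24)"
proof -
  have e24: "eta_series t ^ 24 = of_real (exp (- (2 * pi * t))) * euler_prod (of_real (exp (- (2 * pi * t)))) ^ 24"
    if "t > 0" for t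
    unfolding eta_series_eq[OF that] power_mult_distrib of_real_power[symmetric] exp_of_nat_mult[symmetric] by (simp add: mult_ac)
  have "sqrt t ^ 24 = (sqrt t ^ 2) ^ 12" by (simp only: power_mult[symmetric]) simp
  then have "sqrt t ^ 24 = t ^ 12" using t by simp
  then have "eta_series (1 / t) ^ 24 = of_real (t ^ 12) * eta_series t ^ 24"
    unfolding eta_series_inversion[OF t] power_mult_distrib by (simp flip: of_real_power)
  then show ?thesis using e24[of t] e24[of "1 / t"] t by simp
qed

section \<open>Theta series with isotropic coefficients\<close>

text \<open>Convergence at all real points gives an entire function; it vanishes on the real axis,
  hence everywhere. This permits comparing coefficients in identities known for real parameters
  only.\<close>

lemma real_power_series_zero:
  fixes \<gamma> :: "nat \<Rightarrow> complex"
  assumes "\<And>z::real. (\<lambda>d. \<gamma> d * of_real z ^ d) sums 0"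
  shows "\<gamma> d = 0"
proof -
  have "conv_radius \<gamma> \<ge> \<infinity>"
  proof (rule conv_radius_geI_ex)
    fix r :: real assume "0 < r" "ereal r < \<infinity>"
    then show "\<exists>z. norm z = r \<and> summable (\<lambda>n. \<gamma> n * z ^ n)"
      using assms[of r] sums_summable by (intro exI[of _ "of_real r"]) auto
  qed
  then have R: "fps_conv_radius (Abs_fps \<gamma>) = \<infinity>" by (simp add: fps_conv_radius_def)
  have "eval_fps (Abs_fps \<gamma>) z = 0" for z
  proof (rule analytic_continuation[where f = "eval_fps (Abs_fps \<gamma>)" and S = UNIV and U = \<real> and \<xi> = 0])
    show "eval_fps (Abs_fps \<gamma>) holomorphic_on UNIV" by (rule holomorphic_on_eval_fps) (simp add: R)
    show "(0::complex) islimpt \<real>"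
      unfolding islimpt_approachable
    proof (intro allI impI)
      fix \<epsilon> :: real assume "\<epsilon> > 0"
      then show "\<exists>x'\<in>\<real>. x' \<noteq> (0::complex) \<and> dist x' 0 < \<epsilon>"
        by (intro bexI[of _ "of_real (\<epsilon> / 2)"]) (auto simp del: of_real_divide)
    qed
    fix x :: complex assume "x \<in> \<real>"
    then show "eval_fps (Abs_fps \<gamma>) x = 0" using assms by (auto simp: eval_fps_def sums_iff elim!: Reals_cases)
  qed auto
  then have "Abs_fps \<gamma> = 0" using R by (intro eval_fps_eqD) (auto intro: always_eventually)
  then show ?thesis by (metis fps_nth_Abs_fps fps_zero_nth)
qed

text \<open>Interchange of the sum over \<open>A\<close> with the exponential series; the assumption
  is summability of the absolute values of the double series.\<close>

lemma exp_infsum_power_series: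
  fixes \<rho> f :: "'a \<Rightarrow> complex"
  assumes "(\<lambda>x. norm (\<rho> x) * exp (norm (f x))) summable_on A"
  shows "(\<lambda>d. (\<Sum>\<^sub>\<infinity>x\<in>A. \<rho> x * f x ^ d) / fact d) sums (\<Sum>\<^sub>\<infinity>x\<in>A. \<rho> x * exp (f x))"
proof -
  let ?g = "\<lambda>x d. \<rho> x * f x ^ d / fact d"
  have exph: "((\<lambda>d. z ^ d / fact d) has_sum exp z) UNIV" for z :: complex
  proof (rule norm_summable_imp_has_sum)
    show "summable (\<lambda>d. norm (z ^ d / fact d))"
      using summable_norm_exp[of z] by (simp add: scaleR_conv_of_real divide_inverse mult.commute norm_mult norm_inverse norm_power)
    show "(\<lambda>d. z ^ d / fact d) sums exp z"
      using exp_converges[of z] by (simp add: scaleR_conv_of_real divide_inverse mult.commute)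
  qed
  have exphr: "((\<lambda>d. y ^ d / fact d) has_sum exp y) UNIV" if "y \<ge> 0" for y :: real
  proof (rule sums_nonneg_imp_has_sum)
    show "(\<lambda>d. y ^ d / fact d) sums exp y"
      using exp_converges[of y] by (simp add: divide_inverse mult.commute)
  qed (use that in auto)
  have sm: "(\<lambda>(x, d). ?g x d) summable_on (A \<times> UNIV)"
  proof (rule abs_summable_summable)
    have "(\<lambda>(x, d). norm (\<rho> x) * (norm (f x) ^ d / fact d)) summable_on (A \<times> UNIV)"
    proof (rule summable_on_SigmaI)
      show "((\<lambda>d. case (x, d) of (x, d) \<Rightarrow> norm (\<rho> x) * (norm (f x) ^ d / fact d)) has_sum (norm (\<rho> x) * exp (norm (f x)))) UNIV" for x
        unfolding prod.case by (intro has_sum_cmult_right exphr) auto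
    qed (use assms in auto)
    then show "(\<lambda>z. norm (case z of (x, d) \<Rightarrow> ?g x d)) summable_on (A \<times> UNIV)"
      by (simp add: case_prod_unfold norm_mult norm_divide norm_power)
  qed
  have "(\<Sum>\<^sub>\<infinity>x\<in>A. \<rho> x * exp (f x)) = (\<Sum>\<^sub>\<infinity>x\<in>A. \<Sum>\<^sub>\<infinity>d. ?g x d)"
    using infsumI[OF has_sum_cmult_right[OF exph]] by (simp add: mult.assoc divide_inverse)
  also have "\<dots> = (\<Sum>\<^sub>\<infinity>d. \<Sum>\<^sub>\<infinity>x\<in>A. ?g x d)" by (rule infsum_swap_banach[OF sm])
  finally have eq: "(\<Sum>\<^sub>\<infinity>x\<in>A. \<rho> x * exp (f x)) = (\<Sum>\<^sub>\<infinity>d. \<Sum>\<^sub>\<infinity>x\<in>A. ?g x d)" .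
  have sm': "(\<lambda>(d, x). ?g x d) summable_on (UNIV \<times> A)"
    using sm summable_on_swap[of "\<lambda>(x, d). ?g x d" A UNIV] by (simp add: case_prod_unfold)
  have "(\<lambda>d. \<Sum>\<^sub>\<infinity>x\<in>A. ?g x d) summable_on UNIV"
    using summable_on_Sigma_banach[OF sm'] .
  then have "(\<lambda>d. \<Sum>\<^sub>\<infinity>x\<in>A. ?g x d) sums (\<Sum>\<^sub>\<infinity>x\<in>A. \<rho> x * exp (f x))"
    unfolding eq by (intro has_sum_imp_sums has_sum_infsum)
  moreover have "(\<Sum>\<^sub>\<infinity>x\<in>A. ?g x d) = (\<Sum>\<^sub>\<infinity>x\<in>A. \<rho> x * f x ^ d) / fact d" for d
    unfolding divide_inverse by (rule infsum_cmult_left')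
  ultimately show ?thesis by simp
qed

definition cpair :: "'a::real_inner \<Rightarrow> 'a \<Rightarrow> 'a \<Rightarrow> complex" where
  "cpair u w x = of_real (u \<bullet> x) + \<i> * of_real (w \<bullet> x)"

lemma norm_cpair_le: "norm (cpair u w x) \<le> (norm u + norm w) * norm x"
proof -
  have "norm (cpair u w x) \<le> norm (complex_of_real (u \<bullet> x)) + norm (\<i> * complex_of_real (w \<bullet> x))"
    unfolding cpair_def by (rule norm_triangle_ineq)
  also have "\<dots> \<le> norm u * norm x + norm w * norm x"
    using Cauchy_Schwarz_ineq2[of u x] Cauchy_Schwarz_ineq2[of w x] by (simp add: norm_mult)
  finally show ?thesis by (simp add: distrib_right)
qed

lemma gaussian_exp_summable:
  fixes b :: "nat \<Rightarrow> 'a::real_inner"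
  assumes "lin_indep n b" "t > 0" and R: "R \<ge> 0"
  shows "(\<lambda>x. exp (- t * (x \<bullet> x)) * exp (R * norm (cpair u w x))) summable_on zspan n b"
proof (rule summable_on_comparison_test)
  define M where "M = R * (norm u + norm w)"
  have "0 \<in> rspan n b" using rspanI[where n = n and b = b and x = "\<lambda>_. 0"] by simp
  then show "(\<lambda>x. exp (M\<^sup>2 / (2 * t)) * exp (- (t / 2) * (x \<bullet> x))) summable_on zspan n b"
    using gaussian_zspan_summable[OF assms(1), of "t / 2" 0] assms(2) by (intro summable_on_cmult_right) simp
  fix x
  have "R * norm (cpair u w x) \<le> M * norm x"
    unfolding M_def using norm_cpair_le[of u w x] R by (simp add: mult.assoc mult_left_mono)
  \<comment> \<open>This is \<open>(M - t * norm x)^2 \<ge> 0\<close> divided by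
    \<open>2 * t\<close>: half of the Gaussian absorbs the linear exponent.\<close>
  also have "\<dots> \<le> M\<^sup>2 / (2 * t) + (t / 2) * (norm x)\<^sup>2"
    using zero_le_power2[of "M - t * norm x"] assms(2) by (simp add: power2_eq_square field_simps)
  finally have "- t * (x \<bullet> x) + R * norm (cpair u w x) \<le> M\<^sup>2 / (2 * t) + - (t / 2) * (x \<bullet> x)"
    by (simp add: power2_norm_eq_inner)
  then show "exp (- t * (x \<bullet> x)) * exp (R * norm (cpair u w x)) \<le> exp (M\<^sup>2 / (2 * t)) * exp (- (t / 2) * (x \<bullet> x))"
    unfolding exp_add[symmetric] exp_le_cancel_iff .
qed auto

lemma gaussian_power_summable:
  fixes b :: "nat \<Rightarrow> 'a::real_inner"
  assumes "lin_indep n b" "t > 0"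
  shows "(\<lambda>x. norm (cpair u w x) ^ d * exp (- t * (x \<bullet> x))) summable_on zspan n b"
proof (rule summable_on_comparison_test)
  show "(\<lambda>x. fact d * (exp (- t * (x \<bullet> x)) * exp (1 * norm (cpair u w x)))) summable_on zspan n b"
    by (intro summable_on_cmult_right gaussian_exp_summable assms) simp
  fix x
  have "norm (cpair u w x) ^ d / fact d \<le> exp (norm (cpair u w x))"
  proof -
    have "(\<lambda>d. norm (cpair u w x) ^ d / fact d) sums exp (norm (cpair u w x))"
      using exp_converges[of "norm (cpair u w x)"] by (simp add: divide_inverse mult.commute)
    then show ?thesis using sum_le_suminf[of "\<lambda>d. norm (cpair u w x) ^ d / fact d" "{d}"] by (auto simp: sums_iff)
  qed
  then have "norm (cpair u w x) ^ d \<le> fact d * exp (norm (cpair u w x))" by (simp add: field_simps)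
  then have "norm (cpair u w x) ^ d * exp (- t * (x \<bullet> x)) \<le> fact d * exp (norm (cpair u w x)) * exp (- t * (x \<bullet> x))"
    by (intro mult_right_mono) auto
  then show "norm (cpair u w x) ^ d * exp (- t * (x \<bullet> x)) \<le> fact d * (exp (- t * (x \<bullet> x)) * exp (1 * norm (cpair u w x)))"
    by (simp add: mult_ac)
qed auto

text \<open>The Gaussian is constant on the shell, so its summability over the lattice bounds the
  number of elements.\<close>

lemma finite_shell_zspan:
  fixes b :: "nat \<Rightarrow> 'a::real_inner"
  assumes "lin_indep n b"
  shows "finite {x \<in> zspan n b. x \<bullet> x = r}"
proof (rule conjunct1[OF finite_if_finite_subsets_card_bdd])
  let ?f = "\<lambda>x::'a. exp (- 1 * (x \<bullet> x))"
  have "0 \<in> rspan n b" using rspanI[where n = n and b = b and x = "\<lambda>_. 0"] by simp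
  then have s: "?f summable_on zspan n b" using gaussian_zspan_summable[OF assms, of 1 0] by simp
  fix F assume F: "F \<subseteq> {x \<in> zspan n b. x \<bullet> x = r}" "finite F"
  have "real (card F) * exp (- r) = sum ?f F" using F by (subst sum.cong[where h = "\<lambda>_. exp (- r)"]) auto
  also have "\<dots> \<le> infsum ?f (zspan n b)" using F s by (intro finite_sum_le_infsum) auto
  finally have "real (card F) \<le> infsum ?f (zspan n b) * exp r" by (simp add: exp_minus field_simps)
  then show "card F \<le> nat \<lceil>infsum ?f (zspan n b) * exp r\<rceil>" by linarith
qed

section \<open>Moments of a self-dual lattice under inversion\<close>

locale self_dual_lattice =
  fixes n :: nat and b :: "nat \<Rightarrow> 'a::real_inner" and L :: "'a set"
  assumes ind: "lin_indep n b" and L_def: "L = zspan n b" and self_dual: "zdual n b = zspan n b"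
begin

lemma zero_in_rspan: "0 \<in> rspan n b" using rspanI[where n = n and b = b and x = "\<lambda>_. 0"] by simp

lemma zero_in_L: "0 \<in> L" using zspanI[where n = n and b = b and c = "\<lambda>_. 0"] by (simp add: L_def)

lemma poisson_self_dual:
  assumes "t > 0" "p \<in> rspan n b" "v \<in> rspan n b"
  shows "(\<Sum>\<^sub>\<infinity>x\<in>L. of_real (exp (- pi * t * ((x + p) \<bullet> (x + p)))) * cis (2 * pi * (v \<bullet> (x + p))))
    = of_real ((1 / sqrt t) ^ n) *
      (\<Sum>\<^sub>\<infinity>y\<in>L. of_real (exp (- (pi / t) * ((y - v) \<bullet> (y - v)))) * cis (2 * pi * (y \<bullet> p)))"
proof -
  from poisson_summation_lattice[OF ind] obtain C where C_all: "C > 0 \<and> (\<forall>t>0. \<forall>p\<in>rspan n b. \<forall>v\<in>rspan n b.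
    (\<Sum>\<^sub>\<infinity>x\<in>zspan n b. of_real (exp (- pi * t * ((x + p) \<bullet> (x + p)))) * cis (2 * pi * (v \<bullet> (x + p))))
    = of_real (C * (1 / sqrt t) ^ n) *
      (\<Sum>\<^sub>\<infinity>y\<in>zdual n b. of_real (exp (- (pi / t) * ((y - v) \<bullet> (y - v)))) * cis (2 * pi * (y \<bullet> p))))"
    by (rule exE)
  note C = conjunct1[OF C_all] and P = conjunct2[OF C_all, rule_format, unfolded self_dual L_def[symmetric]]
  let ?g = "\<lambda>x::'a. exp (- pi * (x \<bullet> x))"
  have s: "?g summable_on L"
    using gaussian_zspan_summable[OF ind, of pi 0] zero_in_rspan by (simp add: L_def)
  have "sum ?g {0} \<le> infsum ?g L" using s zero_in_L by (intro finite_sum_le_infsum) auto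
  then have pos: "infsum ?g L > 0" by simp
  \<comment> \<open>At \<open>t = 1\<close> without shift and character, both sides contain the same
    positive sum, which forces \<open>C = 1\<close>.\<close>
  have "(\<Sum>\<^sub>\<infinity>x\<in>L. complex_of_real (?g x)) = of_real C * (\<Sum>\<^sub>\<infinity>x\<in>L. complex_of_real (?g x))"
    using P[of 1 0 0] zero_in_rspan by simp
  moreover have "(\<Sum>\<^sub>\<infinity>x\<in>L. complex_of_real (?g x)) = of_real (infsum ?g L)"
    using has_sum_of_real[OF has_sum_infsum[OF s], where 'a = complex] by (rule infsumI)
  ultimately have "of_real (infsum ?g L) = (of_real (C * infsum ?g L) :: complex)" by simp
  then have "C = 1" using pos by (simp only: of_real_eq_iff) simp
  then show ?thesis using P[OF assms] by simp
qed

definition moment :: "'a \<Rightarrow> 'a \<Rightarrow> nat \<Rightarrow> real \<Rightarrow> complex" where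
  "moment u w d t = (\<Sum>\<^sub>\<infinity>x\<in>L. of_real (exp (- pi * t * (x \<bullet> x))) * cpair u w x ^ d)"

text \<open>Poisson summation with shift \<open>(z / t) *\<^sub>R w\<close> and character
  \<open>z *\<^sub>R u\<close>. Expanding the squares leaves
  \<open>exp (- pi z^2 (w \<bullet> w) / t)\<close> on one side and the same with \<open>u\<close>
  on the other; equal lengths make this a common factor \<open>K\<close>, and orthogonality removes
  the constant phase. The parameter \<open>z\<close> generates all degrees at once.\<close>

lemma isotropic_theta_inversion:
  assumes t: "t > 0" and u: "u \<in> rspan n b" and w: "w \<in> rspan n b" and uw: "u \<bullet> w = 0" "u \<bullet> u = w \<bullet> w"
  shows "(\<Sum>\<^sub>\<infinity>x\<in>L. of_real (exp (- pi * t * (x \<bullet> x))) * exp (of_real z * (2 * of_real pi * \<i>) * cpair u w x))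
    = of_real ((1 / sqrt t) ^ n) * (\<Sum>\<^sub>\<infinity>y\<in>L. of_real (exp (- pi * (1 / t) * (y \<bullet> y))) * exp (of_real z * (2 * of_real pi / of_real t) * cpair u w y))"
proof -
  define K where "K = complex_of_real (exp (- pi * z\<^sup>2 * (w \<bullet> w) / t))"
  have "K \<noteq> 0" by (simp add: K_def)
  have 1: "of_real (exp (- pi * t * ((x + (z / t) *\<^sub>R w) \<bullet> (x + (z / t) *\<^sub>R w)))) * cis (2 * pi * ((z *\<^sub>R u) \<bullet> (x + (z / t) *\<^sub>R w)))
    = K * (of_real (exp (- pi * t * (x \<bullet> x))) * exp (of_real z * (2 * of_real pi * \<i>) * cpair u w x))" for x
  proof -
    have "- pi * t * ((x + (z / t) *\<^sub>R w) \<bullet> (x + (z / t) *\<^sub>R w)) = - pi * z\<^sup>2 * (w \<bullet> w) / t + - pi * t * (x \<bullet> x) + - (2 * pi * z * (w \<bullet> x))"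
      using t by (simp add: inner_add_left inner_add_right inner_commute[of x w] power2_eq_square field_simps)
    moreover have "2 * pi * ((z *\<^sub>R u) \<bullet> (x + (z / t) *\<^sub>R w)) = 2 * pi * z * (u \<bullet> x)"
      using uw by (simp add: inner_add_right)
    moreover have "exp (of_real z * (2 * of_real pi * \<i>) * cpair u w x) = of_real (exp (- (2 * pi * z * (w \<bullet> x)))) * cis (2 * pi * z * (u \<bullet> x))"
      by (simp add: cpair_def cis_conv_exp exp_of_real[symmetric] exp_add[symmetric] algebra_simps)
    ultimately show ?thesis by (simp only: exp_add K_def of_real_mult mult_ac)
  qed
  have 2: "of_real (exp (- (pi / t) * ((y - z *\<^sub>R u) \<bullet> (y - z *\<^sub>R u)))) * cis (2 * pi * (y \<bullet> ((z / t) *\<^sub>R w)))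
    = K * (of_real (exp (- pi * (1 / t) * (y \<bullet> y))) * exp (of_real z * (2 * of_real pi / of_real t) * cpair u w y))" for y
  proof -
    have "- (pi / t) * ((y - z *\<^sub>R u) \<bullet> (y - z *\<^sub>R u)) = - pi * z\<^sup>2 * (w \<bullet> w) / t + - pi * (1 / t) * (y \<bullet> y) + 2 * pi * z * (u \<bullet> y) / t"
      using t uw(2) by (simp add: inner_diff_left inner_diff_right inner_commute[of y u] power2_eq_square field_simps)
    moreover have "2 * pi * (y \<bullet> ((z / t) *\<^sub>R w)) = 2 * pi * z * (w \<bullet> y) / t" by (simp add: inner_commute)
    moreover have "exp (of_real z * (2 * of_real pi / of_real t) * cpair u w y) = of_real (exp (2 * pi * z * (u \<bullet> y) / t)) * cis (2 * pi * z * (w \<bullet> y) / t)"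
      using t by (simp add: cpair_def cis_conv_exp exp_of_real[symmetric] exp_add[symmetric] field_simps)
    ultimately show ?thesis by (simp only: exp_add K_def of_real_mult mult_ac)
  qed
  have "K * (\<Sum>\<^sub>\<infinity>x\<in>L. of_real (exp (- pi * t * (x \<bullet> x))) * exp (of_real z * (2 * of_real pi * \<i>) * cpair u w x))
    = of_real ((1 / sqrt t) ^ n) * (K * (\<Sum>\<^sub>\<infinity>y\<in>L. of_real (exp (- pi * (1 / t) * (y \<bullet> y))) * exp (of_real z * (2 * of_real pi / of_real t) * cpair u w y)))"
    using poisson_self_dual[OF t rspan_scaleR[OF w, of "z / t"] rspan_scaleR[OF u, of z]]
    unfolding 1 2 infsum_cmult_right' .
  then show ?thesis using \<open>K \<noteq> 0\<close> by simp
qed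

text \<open>Both sides of \<open>isotropic_theta_inversion\<close> are power series in
  \<open>z\<close> with moments as coefficients. In degree \<open>d\<close> the ratio of
  \<open>(2 pi \<i>)^d\<close> to \<open>(2 pi / t)^d\<close> remains, which is the source of the
  additional weight \<open>d\<close>.\<close>

lemma moment_inversion:
  assumes t: "t > 0" and u: "u \<in> rspan n b" and w: "w \<in> rspan n b" and uw: "u \<bullet> w = 0" "u \<bullet> u = w \<bullet> w"
  shows "moment u w d (1 / t) = \<i> ^ d * of_real (sqrt t ^ n * t ^ d) * moment u w d t"
proof -
  have ser: "(\<lambda>d. \<kappa> ^ d / fact d * moment u w d s * of_real z ^ d) sums
     (\<Sum>\<^sub>\<infinity>x\<in>L. of_real (exp (- pi * s * (x \<bullet> x))) * exp (of_real z * \<kappa> * cpair u w x))" if "s > 0" for s z \<kappa>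
  proof -
    have "(\<lambda>d. (\<Sum>\<^sub>\<infinity>x\<in>L. of_real (exp (- pi * s * (x \<bullet> x))) * (of_real z * \<kappa> * cpair u w x) ^ d) / fact d) sums
     (\<Sum>\<^sub>\<infinity>x\<in>L. of_real (exp (- pi * s * (x \<bullet> x))) * exp (of_real z * \<kappa> * cpair u w x))"
    proof (rule exp_infsum_power_series)
      show "(\<lambda>x. norm (complex_of_real (exp (- pi * s * (x \<bullet> x)))) * exp (norm (of_real z * \<kappa> * cpair u w x))) summable_on L"
        using gaussian_exp_summable[OF ind, of "pi * s" "\<bar>z\<bar> * norm \<kappa>" u w] that by (simp add: L_def norm_mult)
    qed
    moreover have "(\<Sum>\<^sub>\<infinity>x\<in>L. of_real (exp (- pi * s * (x \<bullet> x))) * (of_real z * \<kappa> * cpair u w x) ^ d) = (of_real z * \<kappa>) ^ d * moment u w d s" for d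
      unfolding moment_def infsum_cmult_right'[symmetric] by (simp only: power_mult_distrib mult_ac)
    ultimately show ?thesis by (simp add: power_mult_distrib mult_ac)
  qed
  define \<gamma> where "\<gamma> d = (2 * of_real pi * \<i>) ^ d / fact d * moment u w d t
      - of_real ((1 / sqrt t) ^ n) * ((2 * of_real pi / of_real t) ^ d / fact d * moment u w d (1 / t))" for d
  have "(\<lambda>d. \<gamma> d * of_real z ^ d) sums 0" for z :: real
  proof -
    have "(\<lambda>d. (2 * of_real pi * \<i>) ^ d / fact d * moment u w d t * of_real z ^ d
        - of_real ((1 / sqrt t) ^ n) * ((2 * of_real pi / of_real t) ^ d / fact d * moment u w d (1 / t) * of_real z ^ d)) sums 0"
      using sums_diff[OF ser[OF t, of "2 * of_real pi * \<i>" z] sums_mult[OF ser[of "1 / t" "2 * of_real pi / of_real t" z], of "of_real ((1 / sqrt t) ^ n)"]]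
        t isotropic_theta_inversion[OF t u w uw, of z] by simp
    then show ?thesis by (simp add: \<gamma>_def algebra_simps)
  qed
  then have "\<gamma> d = 0" by (rule real_power_series_zero)
  then have "of_real ((1 / sqrt t) ^ n) * ((2 * of_real pi / of_real t) ^ d / fact d * moment u w d (1 / t)) = (2 * of_real pi * \<i>) ^ d / fact d * moment u w d t"
    by (simp add: \<gamma>_def)
  then have "of_real ((1 / sqrt t) ^ n) * (1 / of_real t) ^ d * moment u w d (1 / t) = \<i> ^ d * moment u w d t"
  proof -
    assume eq: "of_real ((1 / sqrt t) ^ n) * ((2 * of_real pi / of_real t) ^ d / fact d * moment u w d (1 / t)) = (2 * of_real pi * \<i>) ^ d / fact d * moment u w d t"
    define c :: complex where "c = (2 * of_real pi) ^ d / fact d"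
    have c: "(2 * of_real pi / of_real t) ^ d / fact d = c * (1 / of_real t) ^ d" "(2 * of_real pi * \<i>) ^ d / fact d = c * \<i> ^ d"
      by (simp_all add: c_def power_mult_distrib power_divide)
    have "c \<noteq> 0" by (simp add: c_def)
    moreover have "c * (of_real ((1 / sqrt t) ^ n) * (1 / of_real t) ^ d * moment u w d (1 / t)) = c * (\<i> ^ d * moment u w d t)"
      using eq unfolding c by (simp only: mult_ac)
    ultimately show ?thesis by (simp only: mult_cancel_left) simp
  qed
  then show ?thesis using t by (simp add: power_divide field_simps)
qed

end

section \<open>Expansion over shells and vanishing of the shell moments\<close>

lemma conv_radius_ge_1:
  fixes a :: "nat \<Rightarrow> complex"
  assumes "\<And>r. 0 < r \<Longrightarrow> r < 1 \<Longrightarrow> summable (\<lambda>k. norm (a k) * r ^ k)"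
  shows "conv_radius a \<ge> 1"
proof (rule conv_radius_geI_ex)
  fix r :: real assume r: "0 < r" "ereal r < 1"
  then have "summable (\<lambda>k. norm (a k * of_real r ^ k))"
    using assms[of r] by (simp add: norm_mult norm_power one_ereal_def)
  then show "\<exists>z. norm z = r \<and> summable (\<lambda>n. a n * z ^ n)"
    using r summable_norm_cancel by (intro exI[of _ "of_real r"]) auto
qed

context self_dual_lattice
begin

definition half_norm_shell :: "nat \<Rightarrow> 'a set" where
  "half_norm_shell k = {x \<in> L. x \<bullet> x = 2 * real k}"

definition shell_moment :: "'a \<Rightarrow> 'a \<Rightarrow> nat \<Rightarrow> nat \<Rightarrow> complex" where
  "shell_moment u w d k = (\<Sum>x\<in>half_norm_shell k. cpair u w x ^ d)"

lemma finite_half_norm_shell: "finite (half_norm_shell k)"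
  using finite_shell_zspan[OF ind, of "2 * real k"] unfolding half_norm_shell_def unfolding L_def .

text \<open>On the shell of norm \<open>2 k\<close> the Gaussian equals \<open>q ^ k\<close> with
  \<open>q = exp (- 2 pi t)\<close>; grouping by shells makes the moment a power series in
  \<open>q\<close>.\<close>

lemma moment_q_expansion:
  assumes even: "\<And>x. x \<in> L \<Longrightarrow> \<exists>k::int. x \<bullet> x = 2 * of_int k" and t: "t > 0"
  shows "(\<lambda>k. shell_moment u w d k * of_real (exp (- (2 * pi * t))) ^ k) sums moment u w d t"
    and "summable (\<lambda>k. norm (shell_moment u w d k) * exp (- (2 * pi * t)) ^ k)"
proof -
  define f where "f x = complex_of_real (exp (- pi * t * (x \<bullet> x))) * cpair u w x ^ d" for x
  have bij: "bij_betw snd (SIGMA k:UNIV. half_norm_shell k) L"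
  proof (rule bij_betw_imageI)
    show "inj_on snd (SIGMA k:UNIV. half_norm_shell k)" by (auto simp: inj_on_def half_norm_shell_def)
    have "x \<in> snd ` (SIGMA k:UNIV. half_norm_shell k)" if x: "x \<in> L" for x
    proof -
      obtain k :: int where k: "x \<bullet> x = 2 * of_int k" using even[OF x] by blast
      then have "k \<ge> 0" using inner_ge_zero[of x] by simp
      then have "x \<in> half_norm_shell (nat k)" using x k by (simp add: half_norm_shell_def)
      then show ?thesis by (intro image_eqI[of _ _ "(nat k, x)"]) auto
    qed
    then show "snd ` (SIGMA k:UNIV. half_norm_shell k) = L" by (auto simp: half_norm_shell_def)
  qed
  have "(\<lambda>x. norm (f x)) summable_on L"
    using gaussian_power_summable[OF ind, of "pi * t" u w d] t
    by (simp add: f_def norm_mult norm_power L_def mult.commute)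
  then have ns: "(\<lambda>z. norm (f (snd z))) summable_on (SIGMA k:UNIV. half_norm_shell k)"
    using summable_on_reindex_bij_betw[OF bij, of "\<lambda>x. norm (f x)"] by simp
  then have s: "(\<lambda>z. f (snd z)) summable_on (SIGMA k:UNIV. half_norm_shell k)" by (rule abs_summable_summable)
  have ef: "exp (- pi * t * (x \<bullet> x)) = exp (- (2 * pi * t)) ^ k" if "x \<in> half_norm_shell k" for x k
    using that by (simp add: half_norm_shell_def mult_ac flip: exp_of_nat_mult)
  have inner: "(\<Sum>\<^sub>\<infinity>x\<in>half_norm_shell k. f (snd (k, x))) = shell_moment u w d k * of_real (exp (- (2 * pi * t))) ^ k" for k
  proof -
    have "f x = cpair u w x ^ d * of_real (exp (- (2 * pi * t))) ^ k" if "x \<in> half_norm_shell k" for x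
      unfolding f_def ef[OF that] by simp
    then show ?thesis by (simp add: finite_half_norm_shell shell_moment_def sum_distrib_right)
  qed
  have "moment u w d t = (\<Sum>\<^sub>\<infinity>z\<in>(SIGMA k:UNIV. half_norm_shell k). f (snd z))"
    unfolding moment_def f_def[symmetric] using infsum_reindex_bij_betw[OF bij, of f] by simp
  also have "\<dots> = (\<Sum>\<^sub>\<infinity>k. shell_moment u w d k * of_real (exp (- (2 * pi * t))) ^ k)"
    unfolding inner[symmetric] by (rule infsum_Sigma_banach[OF s, symmetric])
  finally have m: "moment u w d t = (\<Sum>\<^sub>\<infinity>k. shell_moment u w d k * of_real (exp (- (2 * pi * t))) ^ k)" .
  have s': "(\<lambda>(k, x). f x) summable_on (SIGMA k:UNIV. half_norm_shell k)"
    using s by (simp add: case_prod_unfold)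
  have "(\<lambda>k. shell_moment u w d k * of_real (exp (- (2 * pi * t))) ^ k) summable_on UNIV"
    using summable_on_Sigma_banach[OF s'] inner by simp
  then show "(\<lambda>k. shell_moment u w d k * of_real (exp (- (2 * pi * t))) ^ k) sums moment u w d t"
    unfolding m by (intro has_sum_imp_sums has_sum_infsum)
  have ns': "(\<lambda>(k, x). norm (f x)) summable_on (SIGMA k:UNIV. half_norm_shell k)"
    using ns by (simp add: case_prod_unfold)
  have "summable (\<lambda>k. \<Sum>\<^sub>\<infinity>x\<in>half_norm_shell k. norm (f x))"
    by (rule summable_on_imp_summable[OF summable_on_Sigma_banach[OF ns']])
  then show "summable (\<lambda>k. norm (shell_moment u w d k) * exp (- (2 * pi * t)) ^ k)"
  proof (rule summable_comparison_test')
    fix k :: nat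
    have "norm (norm (shell_moment u w d k) * exp (- (2 * pi * t)) ^ k) = norm (\<Sum>x\<in>half_norm_shell k. f x)"
      using inner[of k] by (simp add: finite_half_norm_shell norm_mult norm_power)
    also have "\<dots> \<le> (\<Sum>x\<in>half_norm_shell k. norm (f x))" by (rule norm_sum)
    finally show "norm (norm (shell_moment u w d k) * exp (- (2 * pi * t)) ^ k) \<le> (\<Sum>\<^sub>\<infinity>x\<in>half_norm_shell k. norm (f x))"
      by (simp add: finite_half_norm_shell)
  qed
qed

text \<open>The theta series with the harmonic coefficient \<open>cpair u w x ^ d\<close> behaves like a cusp form of
  weight \<open>36 + d\<close> vanishing to order 4. Its sixth power divided by the power of the discriminant
  \<open>q P(q)\<^sup>2\<^sup>4\<close> of the same weight \<open>6 (36 + d)\<close> is invariant and still vanishes at \<open>q = 0\<close>.\<close>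

theorem shell_moment_eq_0:
  assumes n: "n = 72"
    and even: "\<And>x. x \<in> L \<Longrightarrow> \<exists>k::int. x \<bullet> x = 2 * of_int k"
    and minimum: "\<And>x. x \<in> L \<Longrightarrow> x \<noteq> 0 \<Longrightarrow> x \<bullet> x \<ge> 8"
    and u: "u \<in> rspan n b" and w: "w \<in> rspan n b" and uw: "u \<bullet> w = 0" "u \<bullet> u = w \<bullet> w"
    and d: "even d" "0 < d" "d < 12"
  shows "shell_moment u w d k = 0"
proof -
  define a where "a = shell_moment u w d"
  define a4 where "a4 k = a (k + 4)" for k
  \<comment> \<open>The sixth power has weight \<open>6 (36 + d)\<close>, which for even
    \<open>d\<close> equals \<open>12 h\<close>; and \<open>d < 12\<close> gives
    \<open>h < 24\<close>.\<close>
  define h where "h = 18 + d div 2"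
  have h: "36 + d = 2 * h" "h < 24" using d by (auto simp: h_def)
  have low: "a k = 0" if "k < 4" for k
  proof -
    have "cpair u w x ^ d = 0" if x: "x \<in> half_norm_shell k" for x
    proof -
      have "x = 0" using minimum[of x] x \<open>k < 4\<close> by (fastforce simp: half_norm_shell_def)
      then show ?thesis using d by (simp add: cpair_def)
    qed
    then show ?thesis unfolding a_def shell_moment_def by (intro sum.neutral) auto
  qed
  have as: "summable (\<lambda>k. norm (a k) * r ^ k)" if r: "0 < r" "r < 1" for r
  proof -
    have "- ln r / (2 * pi) > 0" using r by (intro divide_pos_pos) auto
    from moment_q_expansion(2)[OF even this, of u w d] show ?thesis using r by (simp add: a_def)
  qed
  have a4s: "summable (\<lambda>k. norm (a4 k) * r ^ k)" if r: "0 < r" "r < 1" for r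
  proof -
    have "summable (\<lambda>k. norm (a (k + 4)) * r ^ (k + 4) * (1 / r ^ 4))"
      using summable_ignore_initial_segment[OF as[OF r], of 4] by (intro summable_mult2) simp
    then show ?thesis using r by (simp add: a4_def power_add)
  qed
  define A where "A = eval_fps (Abs_fps a)"
  define B where "B = eval_fps (Abs_fps a4)"
  have Ra: "fps_conv_radius (Abs_fps a) \<ge> 1" using conv_radius_ge_1[OF as] by (simp add: fps_conv_radius_def)
  have Ra4: "fps_conv_radius (Abs_fps a4) \<ge> 1" using conv_radius_ge_1[OF a4s] by (simp add: fps_conv_radius_def)
  have ball: "ball 0 1 \<subseteq> eball (0::complex) R" if "R \<ge> 1" for R
  proof
    fix z :: complex assume "z \<in> ball 0 1"
    then have "ereal (norm z) < 1" by (simp add: one_ereal_def)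
    also note that
    finally show "z \<in> eball 0 R" by (simp add: in_eball_iff)
  qed
  have Bh: "B holomorphic_on ball 0 1" unfolding B_def by (rule holomorphic_on_eval_fps[OF ball[OF Ra4]])
  have AB: "A q = q ^ 4 * B q" if "q \<in> ball 0 1" for q
  proof -
    have "(\<lambda>k. a4 k * q ^ k) sums B q"
      using sums_eval_fps[of q "Abs_fps a4"] ball[OF Ra4] that by (auto simp: B_def)
    then have "(\<lambda>k. q ^ 4 * (a4 k * q ^ k)) sums (q ^ 4 * B q)" by (rule sums_mult)
    then have "(\<lambda>k. a (k + 4) * q ^ (k + 4)) sums (q ^ 4 * B q)" by (simp add: a4_def power_add mult_ac)
    then have "(\<lambda>k. a k * q ^ k) sums (q ^ 4 * B q + (\<Sum>k<4. a k * q ^ k))" by (subst (asm) sums_iff_shift) auto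
    then have "(\<lambda>k. a k * q ^ k) sums (q ^ 4 * B q)" using low by simp
    then show ?thesis by (simp add: A_def eval_fps_def sums_iff)
  qed
  define D where "D q = q * euler_prod q ^ 24" for q
  \<comment> \<open>This is \<open>A ^ 6 / D ^ h\<close> with \<open>q ^ h\<close> cancelled against
    the 24 factors of \<open>q\<close> in \<open>A ^ 6\<close>: it is holomorphic at 0 as well, and
    the surplus \<open>q ^ (24 - h)\<close> makes it vanish there.\<close>
  define g where "g q = B q ^ 6 * q ^ (24 - h) / euler_prod q ^ (24 * h)" for q
  have gD: "g q = A q ^ 6 / D q ^ h" if "q \<in> ball 0 1" "q \<noteq> 0" for q
  proof -
    have "q ^ 24 = q ^ (24 - h) * q ^ h" using h by (simp flip: power_add)
    then show ?thesis
      using that by (simp add: AB D_def g_def power_mult_distrib power_mult[symmetric] euler_prod_nonzero)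
  qed
  have qb: "complex_of_real (exp (- (2 * pi * t))) \<in> ball 0 1" if "t > 0" for t using that by simp
  have Am: "A (of_real (exp (- (2 * pi * t)))) = moment u w d t" if "t > 0" for t
    using moment_q_expansion(1)[OF even that, of u w d] by (simp add: A_def a_def eval_fps_def sums_iff)
  have zero: "g q = g 0" if "q \<in> ball 0 1" for q
  proof (rule modular_invariant_constant[OF _ _ that])
    show "g holomorphic_on ball 0 1" unfolding g_def
      using euler_prod_nonzero by (intro holomorphic_intros Bh euler_prod_holomorphic) auto
    fix t :: real assume t: "t > 0"
    define q where "q = complex_of_real (exp (- (2 * pi * t)))"
    define q' where "q' = complex_of_real (exp (- (2 * pi * (1 / t))))"
    have qs: "q \<in> ball 0 1" "q \<noteq> 0" "q' \<in> ball 0 1" "q' \<noteq> 0"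
      unfolding q_def q'_def using qb[of t] qb[of "1 / t"] t by auto
    have D': "D q' = of_real t ^ 12 * D q" using euler_prod_inversion[OF t] by (simp add: D_def q_def q'_def)
    have s72: "sqrt t ^ 72 = t ^ 36"
    proof -
      have "sqrt t ^ 72 = (sqrt t ^ 2) ^ 36" by (simp only: power_mult[symmetric]) simp
      then show ?thesis using t by simp
    qed
    have "A q' = \<i> ^ d * of_real t ^ (36 + d) * A q"
      using moment_inversion[OF t u w uw, of d] Am[OF t] Am[of "1 / t"] t s72
      by (simp add: q_def q'_def n power_add)
    \<comment> \<open>For even \<open>d\<close> the sixth power also removes the sign that
      \<open>\<i> ^ d\<close> would leave in the transformation law.\<close>
    moreover have "(\<i> ^ d) ^ 6 = 1"
    proof -
      obtain m where "d = 2 * m" using d(1) by blast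
      then have "(\<i> ^ d) ^ 6 = (((\<i>\<^sup>2) ^ 2) ^ 3) ^ m" by (simp only: power_mult[symmetric]) (simp add: mult_ac)
      then show ?thesis by simp
    qed
    ultimately have "A q' ^ 6 = of_real t ^ (12 * h) * A q ^ 6"
      unfolding h(1) by (simp add: power_mult_distrib power_mult[symmetric] mult_ac)
    moreover have "D q' ^ h = of_real t ^ (12 * h) * D q ^ h"
      unfolding D' by (simp add: power_mult_distrib power_mult[symmetric])
    ultimately have "g q' = g q" using t qs by (simp add: gD)
    then show "g (of_real (exp (- (2 * pi / t)))) = g (of_real (exp (- (2 * pi * t))))"
      by (simp add: q_def q'_def)
  qed
  have "g 0 = 0" using h by (simp add: g_def)
  have A0: "A q = 0" if q: "q \<in> ball 0 1" for q
  proof (cases "q = 0")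
    case True
    then show ?thesis using AB[OF q] by simp
  next
    case False
    then have "D q \<noteq> 0" using euler_prod_nonzero[OF q] by (simp add: D_def)
    then show ?thesis using zero[OF q] gD[OF q False] \<open>g 0 = 0\<close> by simp
  qed
  have "Abs_fps a = 0"
  proof (rule eval_fps_eqD)
    show "0 < fps_conv_radius (Abs_fps a)" by (rule less_le_trans[OF _ Ra]) simp
    have "\<forall>\<^sub>F q in nhds (0::complex). q \<in> ball 0 1" by (intro eventually_nhds_in_open) auto
    then show "\<forall>\<^sub>F q in nhds 0. eval_fps (Abs_fps a) q = eval_fps 0 q"
      by eventually_elim (use A0 in \<open>simp add: A_def\<close>)
  qed auto
  then have "fps_nth (Abs_fps a) k = 0" by simp
  then show ?thesis by (simp add: a_def)
qed

end

section \<open>Zonal harmonics\<close>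

text \<open>Gram-Schmidt along \<open>lattice_step\<close>. Orthonormality is recorded as unit
  length and Parseval's identity, the form used for traces and Laplacians.\<close>

lemma orthonormal_basis_exists:
  assumes "lin_indep n b"
  shows "\<exists>f. (\<forall>i<n. f i \<in> rspan n b \<and> f i \<bullet> f i = 1) \<and> (\<forall>x\<in>rspan n b. (\<Sum>i<n. (f i \<bullet> x)\<^sup>2) = x \<bullet> x)"
  using assms
proof (induction n arbitrary: b)
  case (Suc n)
  obtain e b' \<eta> N where "lattice_step n b e b' \<eta> N" using lattice_step_exists[OF Suc.prems] by blast
  then interpret lattice_step n b e b' \<eta> N .
  from Suc.IH[OF ind'] obtain f where f: "\<And>i. i < n \<Longrightarrow> f i \<in> rspan n b'" "\<And>i. i < n \<Longrightarrow> f i \<bullet> f i = 1"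
    "\<And>x. x \<in> rspan n b' \<Longrightarrow> (\<Sum>i<n. (f i \<bullet> x)\<^sup>2) = x \<bullet> x" by blast
  define g where "g = f(n := (1 / sqrt N) *\<^sub>R e)"
  have gi: "g i = f i" if "i < n" for i using that by (simp add: g_def)
  have gn: "g n = (1 / sqrt N) *\<^sub>R e" by (simp add: g_def)
  have mem: "g i \<in> rspan (Suc n) b" if i: "i < Suc n" for i
  proof (cases "i = n")
    case True
    have "g n = 0 + (1 / sqrt N) *\<^sub>R e" by (simp add: gn)
    moreover have "0 \<in> rspan n b'" using rspanI[where n = n and b = b' and x = "\<lambda>_. 0"] by simp
    ultimately show ?thesis unfolding rspan_iff True by blast
  next
    case False
    then have "f i \<in> rspan n b'" "g i = f i + 0 *\<^sub>R e" using f(1)[of i] gi[of i] i by auto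
    then show ?thesis unfolding rspan_iff by blast
  qed
  have unit: "g i \<bullet> g i = 1" if "i < Suc n" for i
    using that f(2)[of i] gi[of i] gn N_pos N_def by (cases "i = n") auto
  have sum: "(\<Sum>i<Suc n. (g i \<bullet> x)\<^sup>2) = x \<bullet> x" if x: "x \<in> rspan (Suc n) b" for x
  proof -
    obtain u r where u: "u \<in> rspan n b'" and xu: "x = u + r *\<^sub>R e" using x by (auto simp: rspan_iff)
    have ue: "u \<bullet> e = 0" "e \<bullet> u = 0" using rspan'_e u by auto
    have "f i \<bullet> x = f i \<bullet> u" if "i < n" for i
      using rspan'_e[OF f(1)[OF that]] by (simp add: xu inner_add_right)
    then have "(\<Sum>i<n. (g i \<bullet> x)\<^sup>2) = (\<Sum>i<n. (f i \<bullet> u)\<^sup>2)" by (intro sum.cong) (auto simp: gi)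
    then have "(\<Sum>i<n. (g i \<bullet> x)\<^sup>2) = u \<bullet> u" using f(3)[OF u] by simp
    moreover have "(g n \<bullet> x)\<^sup>2 = r\<^sup>2 * N"
      using ue N_pos by (simp add: gn xu inner_add_right N_def[symmetric] power_mult_distrib power_divide power2_eq_square)
    moreover have "x \<bullet> x = u \<bullet> u + r\<^sup>2 * N"
      using ue by (simp add: xu inner_add_left inner_add_right N_def[symmetric] power2_eq_square)
    ultimately show ?thesis by simp
  qed
  show ?case using mem unit sum by blast
qed auto

text \<open>Formal Laplacian, in \<open>\<nu>\<close> variables \<open>\<beta>\<close>, applied \<open>N\<close> times to
  \<open>\<Sum>k\<le>N. c k * (\<beta> \<bullet> \<beta>)^(N - k) * (\<beta> \<bullet> x)^(2 * k)\<close>, where \<open>r = x \<bullet> x\<close>.\<close>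

fun iterated_laplacian :: "real \<Rightarrow> real \<Rightarrow> nat \<Rightarrow> (nat \<Rightarrow> real) \<Rightarrow> real" where
  "iterated_laplacian \<nu> r 0 c = c 0"
| "iterated_laplacian \<nu> r (Suc N) c = iterated_laplacian \<nu> r N
     (\<lambda>k. c k * (2 * real (Suc N - k) * (\<nu> + 2 * real (Suc N - k) - 2 + 4 * real k))
        + c (Suc k) * (real (2 * k + 2) * real (2 * k + 1)) * r)"

section \<open>The Laplacian along a Parseval frame\<close>

lemma DERIV_zero_unique: "(\<And>s. f s = 0) \<Longrightarrow> (f has_real_derivative D) (at s) \<Longrightarrow> D = 0"
  using DERIV_const[of 0 "at s"] DERIV_unique by (metis DERIV_cong_ev[OF refl always_eventually refl])

text \<open>On a line from \<open>\<beta>\<close> in direction \<open>e\<close>, \<open>Q\<close> is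
  the squared length, with \<open>B = \<beta> \<bullet> e\<close>, and \<open>l\<close> the product
  with a fixed vector. Where an exponent is truncated at 0, its coefficient vanishes too.\<close>

lemma second_derivative_term:
  fixes B q e2 y z :: real
  defines "Q \<equiv> \<lambda>s. q + 2 * s * B + s\<^sup>2 * e2" and "l \<equiv> \<lambda>s. y + s * z"
  shows "((\<lambda>s. Q s ^ m * l s ^ j) has_real_derivative
      (real m * Q s ^ (m - 1) * (2 * B + 2 * s * e2) * l s ^ j + Q s ^ m * (real j * l s ^ (j - 1) * z))) (at s)"
    and "((\<lambda>s. real m * Q s ^ (m - 1) * (2 * B + 2 * s * e2) * l s ^ j + Q s ^ m * (real j * l s ^ (j - 1) * z)) has_real_derivative
      (real m * real (m - 1) * q ^ (m - 2) * (2 * B)\<^sup>2 * y ^ j + real m * q ^ (m - 1) * (2 * e2) * y ^ j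
       + 2 * (real m * q ^ (m - 1) * (2 * B) * (real j * y ^ (j - 1) * z)) + q ^ m * (real j * real (j - 1) * y ^ (j - 2) * z\<^sup>2))) (at 0)"
  unfolding Q_def l_def
  by (auto intro!: derivative_eq_intros simp: power2_eq_square algebra_simps numeral_2_eq_2)

text \<open>Projecting an orthonormal basis to the complement of a vector yields such a frame, not a
  basis. The second derivatives along its members still add up to the Laplacian, with the trace
  \<open>\<nu>\<close> as the dimension.\<close>

locale parseval_frame =
  fixes V :: "'a::real_inner set" and e :: "nat \<Rightarrow> 'a" and m :: nat and \<nu> :: real
  assumes V_add: "u \<in> V \<Longrightarrow> v \<in> V \<Longrightarrow> u + v \<in> V" and V_scale: "u \<in> V \<Longrightarrow> r *\<^sub>R u \<in> V"
    and e_V: "i < m \<Longrightarrow> e i \<in> V"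
    and frame: "x \<in> V \<Longrightarrow> (\<Sum>i<m. (e i \<bullet> x)\<^sup>2) = x \<bullet> x"
    and trace: "(\<Sum>i<m. e i \<bullet> e i) = \<nu>"
begin

lemma frame_polar:
  assumes "x \<in> V" "y \<in> V"
  shows "(\<Sum>i<m. (e i \<bullet> x) * (e i \<bullet> y)) = x \<bullet> y"
proof -
  have "(\<Sum>i<m. (e i \<bullet> (x + y))\<^sup>2) = (\<Sum>i<m. (e i \<bullet> x)\<^sup>2) + (\<Sum>i<m. (e i \<bullet> y)\<^sup>2) + 2 * (\<Sum>i<m. (e i \<bullet> x) * (e i \<bullet> y))"
    by (simp add: inner_add_right power2_sum sum.distrib sum_distrib_left mult.assoc)
  then show ?thesis
    using frame[OF V_add[OF assms]] frame[OF assms(1)] frame[OF assms(2)]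
    by (simp add: inner_add_left inner_add_right inner_commute)
qed

text \<open>With \<open>m = Suc N - k\<close> and \<open>j = 2 * k\<close>, the Laplacian of
  \<open>(\<beta> \<bullet> \<beta>)^m (\<beta> \<bullet> x)^j\<close> is \<open>2 m (\<nu> + 2 m -
  2 + 2 j) (\<beta> \<bullet> \<beta>)^(m - 1) (\<beta> \<bullet> x)^j + j (j - 1) (x \<bullet> x)
  (\<beta> \<bullet> \<beta>)^m (\<beta> \<bullet> x)^(j - 2)\<close>. Collecting equal powers gives
  the new coefficients, and the Laplacian of the zero function is zero.\<close>

lemma laplacian_step:
  assumes fin: "finite S" and p: "\<And>x. x \<in> S \<Longrightarrow> p x \<in> V"
    and zero: "\<And>\<beta>. \<beta> \<in> V \<Longrightarrow> (\<Sum>x\<in>S. \<Sum>k\<le>Suc N. c x k * ((\<beta> \<bullet> \<beta>) ^ (Suc N - k) * (\<beta> \<bullet> p x) ^ (2 * k))) = 0"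
    and \<beta>: "\<beta> \<in> V"
  shows "(\<Sum>x\<in>S. \<Sum>k\<le>N. (c x k * (2 * real (Suc N - k) * (\<nu> + 2 * real (Suc N - k) - 2 + 4 * real k))
        + c x (Suc k) * (real (2 * k + 2) * real (2 * k + 1)) * (p x \<bullet> p x)) * ((\<beta> \<bullet> \<beta>) ^ (N - k) * (\<beta> \<bullet> p x) ^ (2 * k))) = 0"
proof -
  define q where "q = \<beta> \<bullet> \<beta>"
  define D2 where "D2 i x k = real (Suc N - k) * real (Suc N - k - 1) * q ^ (Suc N - k - 2) * (2 * (\<beta> \<bullet> e i))\<^sup>2 * (\<beta> \<bullet> p x) ^ (2 * k)
      + real (Suc N - k) * q ^ (Suc N - k - 1) * (2 * (e i \<bullet> e i)) * (\<beta> \<bullet> p x) ^ (2 * k)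
       + 2 * (real (Suc N - k) * q ^ (Suc N - k - 1) * (2 * (\<beta> \<bullet> e i)) * (real (2 * k) * (\<beta> \<bullet> p x) ^ (2 * k - 1) * (e i \<bullet> p x)))
       + q ^ (Suc N - k) * (real (2 * k) * real (2 * k - 1) * (\<beta> \<bullet> p x) ^ (2 * k - 2) * (e i \<bullet> p x)\<^sup>2)" for i x k
  have dir: "(\<Sum>x\<in>S. \<Sum>k\<le>Suc N. c x k * D2 i x k) = 0" if i: "i < m" for i
  proof -
    define Q where "Q s = q + 2 * s * (\<beta> \<bullet> e i) + s\<^sup>2 * (e i \<bullet> e i)" for s
    define l where "l x s = \<beta> \<bullet> p x + s * (e i \<bullet> p x)" for x s
    define D1 where "D1 x k s = real (Suc N - k) * Q s ^ (Suc N - k - 1) * (2 * (\<beta> \<bullet> e i) + 2 * s * (e i \<bullet> e i)) * l x s ^ (2 * k)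
      + Q s ^ (Suc N - k) * (real (2 * k) * l x s ^ (2 * k - 1) * (e i \<bullet> p x))" for x k s
    have z0: "(\<Sum>x\<in>S. \<Sum>k\<le>Suc N. c x k * (Q s ^ (Suc N - k) * l x s ^ (2 * k))) = 0" for s
    proof -
      have "\<beta> + s *\<^sub>R e i \<in> V" by (intro V_add \<beta> V_scale e_V i)
      moreover have "(\<beta> + s *\<^sub>R e i) \<bullet> (\<beta> + s *\<^sub>R e i) = Q s"
        by (simp add: Q_def q_def inner_add_left inner_add_right inner_commute power2_eq_square)
      moreover have "(\<beta> + s *\<^sub>R e i) \<bullet> p x = l x s" for x by (simp add: l_def inner_add_left)
      ultimately show ?thesis using zero[of "\<beta> + s *\<^sub>R e i"] by simp
    qed
    have "((\<lambda>s. \<Sum>x\<in>S. \<Sum>k\<le>Suc N. c x k * (Q s ^ (Suc N - k) * l x s ^ (2 * k))) has_real_derivative (\<Sum>x\<in>S. \<Sum>k\<le>Suc N. c x k * D1 x k s)) (at s)" for s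
      unfolding D1_def Q_def l_def by (intro DERIV_sum DERIV_cmult second_derivative_term(1))
    then have z1: "(\<Sum>x\<in>S. \<Sum>k\<le>Suc N. c x k * D1 x k s) = 0" for s by (rule DERIV_zero_unique[OF z0])
    have "((\<lambda>s. \<Sum>x\<in>S. \<Sum>k\<le>Suc N. c x k * D1 x k s) has_real_derivative (\<Sum>x\<in>S. \<Sum>k\<le>Suc N. c x k * D2 i x k)) (at 0)"
      unfolding D1_def D2_def Q_def l_def by (intro DERIV_sum DERIV_cmult second_derivative_term(2))
    then show ?thesis by (rule DERIV_zero_unique[OF z1])
  qed
  define E1 where "E1 x k = 2 * real (Suc N - k) * (\<nu> + 2 * real (Suc N - k) - 2 + 4 * real k) * (q ^ (Suc N - k - 1) * (\<beta> \<bullet> p x) ^ (2 * k))" for x k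
  define E2 where "E2 x k = real (2 * k) * real (2 * k - 1) * (p x \<bullet> p x) * (q ^ (Suc N - k) * (\<beta> \<bullet> p x) ^ (2 * k - 2))" for x k
  have lap: "(\<Sum>i<m. D2 i x k) = E1 x k + E2 x k" if x: "x \<in> S" for x k
  proof -
    have s1: "(\<Sum>i<m. (\<beta> \<bullet> e i)\<^sup>2) = q" using frame[OF \<beta>] by (simp add: inner_commute q_def)
    have s2: "(\<Sum>i<m. (\<beta> \<bullet> e i) * (e i \<bullet> p x)) = \<beta> \<bullet> p x" using frame_polar[OF \<beta> p[OF x]] by (simp add: inner_commute)
    have s3: "(\<Sum>i<m. (e i \<bullet> p x)\<^sup>2) = p x \<bullet> p x" using frame[OF p[OF x]] .
    have "(\<Sum>i<m. D2 i x k) = 4 * real (Suc N - k) * real (Suc N - k - 1) * q ^ (Suc N - k - 2) * (\<beta> \<bullet> p x) ^ (2 * k) * (\<Sum>i<m. (\<beta> \<bullet> e i)\<^sup>2)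
      + 2 * real (Suc N - k) * q ^ (Suc N - k - 1) * (\<beta> \<bullet> p x) ^ (2 * k) * (\<Sum>i<m. e i \<bullet> e i)
      + 4 * real (Suc N - k) * q ^ (Suc N - k - 1) * real (2 * k) * (\<beta> \<bullet> p x) ^ (2 * k - 1) * (\<Sum>i<m. (\<beta> \<bullet> e i) * (e i \<bullet> p x))
      + q ^ (Suc N - k) * real (2 * k) * real (2 * k - 1) * (\<beta> \<bullet> p x) ^ (2 * k - 2) * (\<Sum>i<m. (e i \<bullet> p x)\<^sup>2)"
      unfolding D2_def sum.distrib sum_distrib_left by (simp add: power_mult_distrib mult_ac)
    also have "\<dots> = 4 * real (Suc N - k) * real (Suc N - k - 1) * (q ^ (Suc N - k - 2) * q) * (\<beta> \<bullet> p x) ^ (2 * k)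
      + 2 * real (Suc N - k) * q ^ (Suc N - k - 1) * (\<beta> \<bullet> p x) ^ (2 * k) * \<nu>
      + 4 * real (Suc N - k) * q ^ (Suc N - k - 1) * (real (2 * k) * ((\<beta> \<bullet> p x) ^ (2 * k - 1) * (\<beta> \<bullet> p x)))
      + E2 x k"
      unfolding s1 s2 s3 trace E2_def by (simp add: mult_ac)
    also have "real (2 * k) * ((\<beta> \<bullet> p x) ^ (2 * k - 1) * (\<beta> \<bullet> p x)) = real (2 * k) * (\<beta> \<bullet> p x) ^ (2 * k)"
      by (cases k) (simp_all add: mult.commute)
    \<comment> \<open>When \<open>Suc N - k\<close> is at most 1, the powers of \<open>q\<close> do
      not combine under truncated subtraction, but the coefficient is 0.\<close>
    also have "4 * real (Suc N - k) * real (Suc N - k - 1) * (q ^ (Suc N - k - 2) * q) * (\<beta> \<bullet> p x) ^ (2 * k)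
      = 4 * real (Suc N - k) * (real (Suc N - k) - 1) * q ^ (Suc N - k - 1) * (\<beta> \<bullet> p x) ^ (2 * k)"
    proof -
      consider "Suc N - k = 0" | "Suc N - k = 1" | j where "Suc N - k = Suc (Suc j)"
        by (metis One_nat_def old.nat.exhaust)
      then show ?thesis by cases (simp_all add: mult_ac)
    qed
    finally show ?thesis unfolding E1_def by (simp add: algebra_simps)
  qed
  have "0 = (\<Sum>i<m. \<Sum>x\<in>S. \<Sum>k\<le>Suc N. c x k * D2 i x k)" using dir by simp
  also have "\<dots> = (\<Sum>x\<in>S. \<Sum>i<m. \<Sum>k\<le>Suc N. c x k * D2 i x k)" by (rule sum.swap)
  also have "\<dots> = (\<Sum>x\<in>S. \<Sum>k\<le>Suc N. \<Sum>i<m. c x k * D2 i x k)" by (intro sum.cong refl sum.swap)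
  also have "\<dots> = (\<Sum>x\<in>S. \<Sum>k\<le>Suc N. c x k * (E1 x k + E2 x k))"
    by (intro sum.cong refl) (simp add: lap flip: sum_distrib_left)
  also have "\<dots> = (\<Sum>x\<in>S. \<Sum>k\<le>N. (c x k * (2 * real (Suc N - k) * (\<nu> + 2 * real (Suc N - k) - 2 + 4 * real k))
        + c x (Suc k) * (real (2 * k + 2) * real (2 * k + 1)) * (p x \<bullet> p x)) * ((\<beta> \<bullet> \<beta>) ^ (N - k) * (\<beta> \<bullet> p x) ^ (2 * k)))"
  proof (rule sum.cong[OF refl])
    fix x
    have "(\<Sum>k\<le>Suc N. c x k * E1 x k) = (\<Sum>k\<le>N. c x k * E1 x k)" by (simp add: E1_def)
    moreover have "(\<Sum>k\<le>Suc N. c x k * E2 x k) = (\<Sum>k\<le>N. c x (Suc k) * E2 x (Suc k))"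
      by (subst sum.atMost_Suc_shift) (simp add: E2_def)
    ultimately have "(\<Sum>k\<le>Suc N. c x k * (E1 x k + E2 x k)) = (\<Sum>k\<le>N. c x k * E1 x k + c x (Suc k) * E2 x (Suc k))"
      unfolding distrib_left sum.distrib by simp
    also have "\<dots> = (\<Sum>k\<le>N. (c x k * (2 * real (Suc N - k) * (\<nu> + 2 * real (Suc N - k) - 2 + 4 * real k))
        + c x (Suc k) * (real (2 * k + 2) * real (2 * k + 1)) * (p x \<bullet> p x)) * ((\<beta> \<bullet> \<beta>) ^ (N - k) * (\<beta> \<bullet> p x) ^ (2 * k)))"
    proof (intro sum.cong refl)
      fix k assume k: "k \<in> {..N}"
      have a: "Suc N - k - 1 = N - k" "Suc N - Suc k = N - k" "2 * Suc k - 2 = 2 * k" "2 * Suc k = 2 * k + 2" "2 * Suc k - 1 = 2 * k + 1" using k by auto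
      show "c x k * E1 x k + c x (Suc k) * E2 x (Suc k) = (c x k * (2 * real (Suc N - k) * (\<nu> + 2 * real (Suc N - k) - 2 + 4 * real k))
        + c x (Suc k) * (real (2 * k + 2) * real (2 * k + 1)) * (p x \<bullet> p x)) * ((\<beta> \<bullet> \<beta>) ^ (N - k) * (\<beta> \<bullet> p x) ^ (2 * k))"
        unfolding E1_def E2_def a(1,2,3,5) unfolding a(4) q_def[symmetric] by (simp only: distrib_right mult.assoc)
    qed
    finally show "(\<Sum>k\<le>Suc N. c x k * (E1 x k + E2 x k)) = (\<Sum>k\<le>N. (c x k * (2 * real (Suc N - k) * (\<nu> + 2 * real (Suc N - k) - 2 + 4 * real k))
        + c x (Suc k) * (real (2 * k + 2) * real (2 * k + 1)) * (p x \<bullet> p x)) * ((\<beta> \<bullet> \<beta>) ^ (N - k) * (\<beta> \<bullet> p x) ^ (2 * k)))" .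
  qed
  finally show ?thesis by simp
qed

text \<open>Each Laplacian lowers the degree in \<open>\<beta>\<close> by 2, so after
  \<open>N\<close> of them a constant remains, read off at \<open>\<beta> = 0\<close>.\<close>

lemma iterated_laplacian_sum:
  assumes fin: "finite S" and p: "\<And>x. x \<in> S \<Longrightarrow> p x \<in> V" and V0: "0 \<in> V"
    and zero: "\<And>\<beta>. \<beta> \<in> V \<Longrightarrow> (\<Sum>x\<in>S. \<Sum>k\<le>N. c x k * ((\<beta> \<bullet> \<beta>) ^ (N - k) * (\<beta> \<bullet> p x) ^ (2 * k))) = 0"
  shows "(\<Sum>x\<in>S. iterated_laplacian \<nu> (p x \<bullet> p x) N (c x)) = 0"
  using zero
proof (induction N arbitrary: c)
  case 0
  then show ?case using V0 by auto
next
  case (Suc N)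
  show ?case unfolding iterated_laplacian.simps
    by (rule Suc.IH, rule laplacian_step[OF fin p Suc.prems])
qed

end

section \<open>From isotropic moments to zonal harmonics\<close>

lemma sum_even_odd_split:
  fixes f :: "nat \<Rightarrow> 'a::comm_monoid_add"
  shows "(\<Sum>j\<le>2 * N. f j) = (\<Sum>k\<le>N. f (2 * k)) + (\<Sum>k<N. f (2 * k + 1))"
  by (induction N) (simp_all add: add_ac)

lemma Re_even_power:
  fixes X Y :: real
  shows "Re ((of_real X + \<i> * of_real Y) ^ (2 * N)) = (\<Sum>k\<le>N. real (2 * N choose (2 * k)) * (-1) ^ k * X ^ (2 * (N - k)) * Y ^ (2 * k))"
proof -
  have "(of_real X + \<i> * of_real Y) ^ (2 * N) = (\<Sum>j\<le>2 * N. of_nat (2 * N choose j) * (\<i> * of_real Y) ^ j * of_real X ^ (2 * N - j))"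
    by (subst add.commute) (rule binomial_ring)
  also have "Re \<dots> = (\<Sum>j\<le>2 * N. Re (of_nat (2 * N choose j) * (\<i> * of_real Y) ^ j * of_real X ^ (2 * N - j)))"
    by simp
  also have "\<dots> = (\<Sum>k\<le>N. Re (of_nat (2 * N choose (2 * k)) * (\<i> * of_real Y) ^ (2 * k) * of_real X ^ (2 * N - 2 * k)))
     + (\<Sum>k<N. Re (of_nat (2 * N choose (2 * k + 1)) * (\<i> * of_real Y) ^ (2 * k + 1) * of_real X ^ (2 * N - (2 * k + 1))))"
    by (rule sum_even_odd_split)
  also have "(\<Sum>k<N. Re (of_nat (2 * N choose (2 * k + 1)) * (\<i> * of_real Y) ^ (2 * k + 1) * of_real X ^ (2 * N - (2 * k + 1)))) = 0"
    by (intro sum.neutral) (simp add: power_mult_distrib power_mult flip: of_real_power)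
  also have "(\<Sum>k\<le>N. Re (of_nat (2 * N choose (2 * k)) * (\<i> * of_real Y) ^ (2 * k) * of_real X ^ (2 * N - 2 * k)))
    = (\<Sum>k\<le>N. real (2 * N choose (2 * k)) * (-1) ^ k * X ^ (2 * (N - k)) * Y ^ (2 * k))"
  proof (intro sum.cong refl)
    fix k
    have "(\<i> * of_real Y) ^ (2 * k) = complex_of_real ((-1) ^ k * Y ^ (2 * k))"
    proof -
      have "\<i> ^ (2 * k) = (-1) ^ k" by (simp add: power_mult)
      then show ?thesis by (simp add: power_mult_distrib[of \<i>])
    qed
    then have "of_nat (2 * N choose (2 * k)) * (\<i> * of_real Y) ^ (2 * k) * of_real X ^ (2 * N - 2 * k)
      = complex_of_real (real (2 * N choose (2 * k)) * ((-1) ^ k * Y ^ (2 * k)) * X ^ (2 * N - 2 * k))"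
      by (simp only: of_real_mult of_real_power of_real_of_nat_eq)
    then have "Re (of_nat (2 * N choose (2 * k)) * (\<i> * of_real Y) ^ (2 * k) * of_real X ^ (2 * N - 2 * k))
      = real (2 * N choose (2 * k)) * ((-1) ^ k * Y ^ (2 * k)) * X ^ (2 * N - 2 * k)"
      by (simp only: Re_complex_of_real)
    then show "Re (of_nat (2 * N choose (2 * k)) * (\<i> * of_real Y) ^ (2 * k) * of_real X ^ (2 * N - 2 * k))
      = real (2 * N choose (2 * k)) * (-1) ^ k * X ^ (2 * (N - k)) * Y ^ (2 * k)"
      unfolding diff_mult_distrib2 by (simp only: mult_ac)
  qed
  finally show ?thesis by simp
qed

text \<open>For \<open>a \<bullet> a = 8\<close> this is, up to normalisation, the zonal harmonic of degree \<open>2 * N\<close> with axis \<open>a\<close>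
  on 72-dimensional space, as a function of \<open>y = a \<bullet> x\<close> and of the squared length \<open>r\<close> of the component
  of \<open>x\<close> orthogonal to \<open>a\<close>.\<close>

definition zonal :: "nat \<Rightarrow> real \<Rightarrow> real \<Rightarrow> real" where
  "zonal N r y = iterated_laplacian 71 r N (\<lambda>k. real (2 * N choose (2 * k)) * (-8) ^ k * y ^ (2 * (N - k)))"

context self_dual_lattice
begin

text \<open>For \<open>\<beta>\<close> orthogonal to \<open>a\<close>, the real part of the
  isotropic moment is a polynomial in \<open>\<beta>\<close> of the shape that
  \<open>iterated_laplacian_sum\<close> handles; \<open>x\<close> enters only through
  \<open>a \<bullet> x\<close> and the projection \<open>p x\<close>.\<close>

lemma zonal_sum_eq_0:
  assumes n: "n = 72"
    and even: "\<And>x. x \<in> L \<Longrightarrow> \<exists>k::int. x \<bullet> x = 2 * of_int k"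
    and minimum: "\<And>x. x \<in> L \<Longrightarrow> x \<noteq> 0 \<Longrightarrow> x \<bullet> x \<ge> 8"
    and a: "a \<in> L" "a \<bullet> a = 8" and N: "0 < N" "N < 6"
  shows "(\<Sum>x\<in>half_norm_shell K. zonal N (2 * real K - (a \<bullet> x)\<^sup>2 / 8) (a \<bullet> x)) = 0"
proof -
  define V where "V = {v \<in> rspan n b. v \<bullet> a = 0}"
  define p where "p x = x - ((a \<bullet> x) / 8) *\<^sub>R a" for x
  have LR: "L \<subseteq> rspan n b" unfolding L_def by (rule zspan_subset_rspan)
  then have aR: "a \<in> rspan n b" using a(1) by blast
  from orthonormal_basis_exists[OF ind] obtain f where f: "\<And>i. i < n \<Longrightarrow> f i \<in> rspan n b" "\<And>i. i < n \<Longrightarrow> f i \<bullet> f i = 1"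
    "\<And>x. x \<in> rspan n b \<Longrightarrow> (\<Sum>i<n. (f i \<bullet> x)\<^sup>2) = x \<bullet> x" by blast
  have pV: "p x \<in> V" if "x \<in> rspan n b" for x
    using that aR a(2) by (auto simp: V_def p_def inner_diff_left inner_diff_right inner_commute intro!: rspan_diff rspan_scaleR)
  have pin: "\<beta> \<bullet> p x = \<beta> \<bullet> x" "p x \<bullet> \<beta> = x \<bullet> \<beta>" if "\<beta> \<in> V" for \<beta> x
    using that by (simp_all add: V_def p_def inner_diff_right inner_diff_left inner_commute)
  interpret parseval_frame V "\<lambda>i. p (f i)" n 71
  proof
    show "u + v \<in> V" if "u \<in> V" "v \<in> V" for u v using that by (auto simp: V_def inner_add_left rspan_add)
    show "r *\<^sub>R u \<in> V" if "u \<in> V" for u r using that by (auto simp: V_def rspan_scaleR)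
    show "p (f i) \<in> V" if "i < n" for i using pV f that by blast
    show "(\<Sum>i<n. (p (f i) \<bullet> x)\<^sup>2) = x \<bullet> x" if x: "x \<in> V" for x
      using f(3)[of x] x by (simp add: pin V_def)
    have "p (f i) \<bullet> p (f i) = 1 - (f i \<bullet> a)\<^sup>2 / 8" if "i < n" for i
      using f(2)[OF that] a(2) by (simp add: p_def inner_diff_left inner_diff_right inner_commute power2_eq_square)
    then have "(\<Sum>i<n. p (f i) \<bullet> p (f i)) = (\<Sum>i<n. 1 - (f i \<bullet> a)\<^sup>2 / 8)" by (intro sum.cong) auto
    \<comment> \<open>The trace is the dimension of the complement of \<open>a\<close>: 72 -
      1.\<close>
    also have "\<dots> = real n - (a \<bullet> a) / 8" by (simp add: sum_subtractf f(3)[OF aR] flip: sum_divide_distrib)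
    finally show "(\<Sum>i<n. p (f i) \<bullet> p (f i)) = 71" using n a(2) by simp
  qed
  let ?S = "half_norm_shell K"
  have SR: "x \<in> rspan n b" if "x \<in> ?S" for x
    using that LR by (auto simp: half_norm_shell_def)
  have "(\<Sum>x\<in>?S. zonal N (p x \<bullet> p x) (a \<bullet> x)) = 0" unfolding zonal_def
  proof (rule iterated_laplacian_sum)
    show "finite ?S" by (rule finite_half_norm_shell)
    show "p x \<in> V" if "x \<in> ?S" for x using pV SR that by blast
    show "0 \<in> V" using zero_in_rspan by (simp add: V_def)
    fix \<beta> assume \<beta>: "\<beta> \<in> V"
    then have \<beta>': "\<beta> \<in> rspan n b" "\<beta> \<bullet> a = 0" by (auto simp: V_def)
    \<comment> \<open>Cross-scaling gives \<open>u\<close> and \<open>w\<close> the same length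
      \<open>norm a * norm \<beta>\<close>. Both norms then occur in even powers only, so the
      expansion is polynomial in \<open>\<beta>\<close>, and the factor 8 comes from
      \<open>a \<bullet> a\<close>.\<close>
    define u where "u = norm \<beta> *\<^sub>R a"
    define w where "w = norm a *\<^sub>R \<beta>"
    have "shell_moment u w (2 * N) K = 0"
    proof (rule shell_moment_eq_0[OF n even minimum])
      show "u \<in> rspan n b" "w \<in> rspan n b" unfolding u_def w_def by (intro rspan_scaleR aR \<beta>')+
      show "u \<bullet> w = 0" using \<beta>' by (simp add: u_def w_def inner_commute)
      show "u \<bullet> u = w \<bullet> w" by (simp add: u_def w_def power2_norm_eq_inner[symmetric] power2_eq_square)
    qed (use N in auto)
    then have "0 = (\<Sum>x\<in>?S. Re (cpair u w x ^ (2 * N)))"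
      unfolding shell_moment_def by (metis Re_sum zero_complex.sel(1))
    also have "\<dots> = (\<Sum>x\<in>?S. \<Sum>k\<le>N. real (2 * N choose (2 * k)) * (-8) ^ k * (a \<bullet> x) ^ (2 * (N - k)) * ((\<beta> \<bullet> \<beta>) ^ (N - k) * (\<beta> \<bullet> p x) ^ (2 * k)))"
    proof (intro sum.cong refl)
      fix x
      have "real (2 * N choose (2 * k)) * (-1) ^ k * (u \<bullet> x) ^ (2 * (N - k)) * (w \<bullet> x) ^ (2 * k)
        = real (2 * N choose (2 * k)) * (-8) ^ k * (a \<bullet> x) ^ (2 * (N - k)) * ((\<beta> \<bullet> \<beta>) ^ (N - k) * (\<beta> \<bullet> p x) ^ (2 * k))" for k
      proof -
        have "(u \<bullet> x) ^ (2 * (N - k)) = (a \<bullet> x) ^ (2 * (N - k)) * (\<beta> \<bullet> \<beta>) ^ (N - k)"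
          by (simp add: u_def power_mult_distrib power_mult power2_norm_eq_inner)
        moreover have "(w \<bullet> x) ^ (2 * k) = 8 ^ k * (\<beta> \<bullet> p x) ^ (2 * k)"
          unfolding pin(1)[OF \<beta>] by (simp add: w_def power_mult_distrib power_mult power2_norm_eq_inner a(2))
        moreover have "(-8 :: real) ^ k = (-1) ^ k * 8 ^ k" by (simp flip: power_mult_distrib)
        ultimately show ?thesis by (simp add: mult_ac)
      qed
      then show "Re (cpair u w x ^ (2 * N)) = (\<Sum>k\<le>N. real (2 * N choose (2 * k)) * (-8) ^ k * (a \<bullet> x) ^ (2 * (N - k)) * ((\<beta> \<bullet> \<beta>) ^ (N - k) * (\<beta> \<bullet> p x) ^ (2 * k)))"
        unfolding cpair_def Re_even_power by (simp only:)
    qed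
    finally show "(\<Sum>x\<in>?S. \<Sum>k\<le>N. real (2 * N choose (2 * k)) * (-8) ^ k * (a \<bullet> x) ^ (2 * (N - k)) * ((\<beta> \<bullet> \<beta>) ^ (N - k) * (\<beta> \<bullet> p x) ^ (2 * k))) = 0" by simp
  qed
  moreover have "p x \<bullet> p x = 2 * real K - (a \<bullet> x)\<^sup>2 / 8" if "x \<in> ?S" for x
    using that a(2) by (simp add: half_norm_shell_def p_def inner_diff_left inner_diff_right inner_commute power2_eq_square)
  ultimately show ?thesis by simp
qed

end

section \<open>Zonal harmonics of degrees 2 to 10 in closed form\<close>

lemma iterated_laplacian_1: "iterated_laplacian 71 r 1 c = 142 * c 0 + 2 * r * c 1"
  by simp

lemma iterated_laplacian_2: "iterated_laplacian 71 r 2 c = 41464 * c 0 + 584 * r * c 1 + 24 * r ^ 2 * c 2"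
  using iterated_laplacian.simps(2)[of 71 r 1 c]
  by (simp add: iterated_laplacian_1 algebra_simps power_numeral_reduce flip: numeral_2_eq_2)

lemma iterated_laplacian_3: "iterated_laplacian 71 r 3 c = 18658800 * c 0 + 262800 * r * c 1 + 10800 * r ^ 2 * c 2 + 720 * r ^ 3 * c 3"
  using iterated_laplacian.simps(2)[of 71 r 2 c]
  by (simp add: iterated_laplacian_2 algebra_simps power_numeral_reduce flip: numeral_2_eq_2)

lemma iterated_laplacian_4: "iterated_laplacian 71 r 4 c = 11493820800 * c 0 + 161884800 * r * c 1 + 6652800 * r ^ 2 * c 2 + 443520 * r ^ 3 * c 3 + 40320 * r ^ 4 * c 4"
  using iterated_laplacian.simps(2)[of 71 r 3 c]
  by (simp add: iterated_laplacian_3 algebra_simps power_numeral_reduce flip: numeral_2_eq_2)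

lemma iterated_laplacian_5: "iterated_laplacian 71 r 5 c = 9080118432000 * c 0 + 127888992000 * r * c 1 + 5255712000 * r ^ 2 * c 2 + 350380800 * r ^ 3 * c 3 + 31852800 * r ^ 4 * c 4 + 3628800 * r ^ 5 * c 5"
  using iterated_laplacian.simps(2)[of 71 r 4 c]
  by (simp add: iterated_laplacian_4 algebra_simps power_numeral_reduce flip: numeral_2_eq_2)

lemma choose_values:
  "4 choose 2 = (6 :: nat)" "6 choose 2 = (15 :: nat)" "6 choose 4 = (15 :: nat)" "8 choose 2 = (28 :: nat)" "8 choose 4 = (70 :: nat)" "8 choose 6 = (28 :: nat)" "10 choose 2 = (45 :: nat)" "10 choose 4 = (210 :: nat)" "10 choose 6 = (210 :: nat)" "10 choose 8 = (45 :: nat)"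
  by (simp_all add: numeral_eq_Suc)

text \<open>With \<open>r + y^2 / 8\<close> as the norm of the vector, this and the next four
  polynomials are, up to scale, the homogenised Gegenbauer polynomials of parameter 35 = 72/2 -
  1.\<close>

lemma zonal_polynomial_1: "zonal (Suc 0) r y = 2 * (71 * y ^ 2 - 8 * r)"
  unfolding zonal_def One_nat_def[symmetric] iterated_laplacian_1 by (simp add: choose_values algebra_simps power2_eq_square flip: numeral_2_eq_2)

lemma zonal_polynomial_2: "zonal 2 r y = 8 * (5183 * y ^ 4 - 3504 * y ^ 2 * r + 192 * r ^ 2)"
  unfolding zonal_def iterated_laplacian_2 by (simp add: choose_values algebra_simps power2_eq_square flip: numeral_2_eq_2)

lemma zonal_polynomial_3: "zonal 3 r y = 720 * (25915 * y ^ 6 - 43800 * y ^ 4 * r + 14400 * y ^ 2 * r ^ 2 - 512 * r ^ 3)"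
  unfolding zonal_def iterated_laplacian_3 by (simp add: choose_values algebra_simps power2_eq_square flip: numeral_2_eq_2)

lemma zonal_polynomial_4: "zonal 4 r y = 40320 * (285065 * y ^ 8 - 899360 * y ^ 6 * r + 739200 * y ^ 4 * r ^ 2 - 157696 * y ^ 2 * r ^ 3 + 4096 * r ^ 4)"
  unfolding zonal_def iterated_laplacian_4 by (simp add: choose_values algebra_simps power2_eq_square flip: numeral_2_eq_2)

lemma zonal_polynomial_5: "zonal 5 r y = 403200 * (22520135 * y ^ 10 - 114186600 * y ^ 8 * r + 175190400 * y ^ 6 * r ^ 2 - 93434880 * y ^ 4 * r ^ 3 + 14561280 * y ^ 2 * r ^ 4 - 294912 * r ^ 5)"
  unfolding zonal_def iterated_laplacian_5 by (simp add: choose_values algebra_simps power2_eq_square flip: numeral_2_eq_2)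

lemmas zonal_polynomials = zonal_polynomial_1 zonal_polynomial_2 zonal_polynomial_3 zonal_polynomial_4 zonal_polynomial_5

section \<open>Distribution of inner products\<close>

text \<open>Negation pairs the values \<open>j\<close> and \<open>- j\<close>, so only the value 0
  is counted once.\<close>

lemma sum_by_abs_values:
  fixes g :: "'a::real_inner \<Rightarrow> real" and F :: "real \<Rightarrow> real"
  assumes fin: "finite S" and int: "\<And>x. x \<in> S \<Longrightarrow> g x \<in> \<int>" and bound: "\<And>x. x \<in> S \<Longrightarrow> \<bar>g x\<bar> \<le> real J"
    and neg: "\<And>x. x \<in> S \<Longrightarrow> - x \<in> S" "\<And>x. g (- x) = - g x" and F: "\<And>y. F (- y) = F y"
  shows "(\<Sum>x\<in>S. F (g x)) = real (card {x \<in> S. g x = 0}) * F 0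
    + 2 * (\<Sum>j=1..J. real (card {x \<in> S. g x = real j}) * F (real j))"
proof -
  define h where "h x = nat \<lfloor>\<bar>g x\<bar>\<rfloor>" for x
  have h: "\<bar>g x\<bar> = real (h x)" if "x \<in> S" for x
    using int[OF that] by (auto simp: h_def elim!: Ints_cases)
  have hJ: "h ` S \<subseteq> {..J}" using h bound by fastforce
  have abs: "{x \<in> S. h x = j} = {x \<in> S. \<bar>g x\<bar> = real j}" for j using h by auto
  have grp: "(\<Sum>x | x \<in> S \<and> h x = j. F (g x)) = real (card {x \<in> S. \<bar>g x\<bar> = real j}) * F (real j)" for j
  proof -
    have "F (g x) = F (real j)" if "\<bar>g x\<bar> = real j" for x
      using that F[of "g x"] by (cases "g x \<ge> 0") auto
    then have "(\<Sum>x | x \<in> S \<and> h x = j. F (g x)) = (\<Sum>x | x \<in> S \<and> h x = j. F (real j))"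
      unfolding abs by (intro sum.cong) auto
    then show ?thesis by (simp add: abs)
  qed
  have two: "card {x \<in> S. \<bar>g x\<bar> = real j} = 2 * card {x \<in> S. g x = real j}" if "j \<ge> 1" for j
  proof -
    have "bij_betw uminus {x \<in> S. g x = real j} {x \<in> S. g x = - real j}"
    proof (rule bij_betwI)
      show "uminus \<in> {x \<in> S. g x = real j} \<rightarrow> {x \<in> S. g x = - real j}"
        "uminus \<in> {x \<in> S. g x = - real j} \<rightarrow> {x \<in> S. g x = real j}"
        using neg by simp_all
    qed auto
    then have "card {x \<in> S. g x = real j} = card {x \<in> S. g x = - real j}" by (rule bij_betw_same_card)
    moreover have "{x \<in> S. \<bar>g x\<bar> = real j} = {x \<in> S. g x = real j} \<union> {x \<in> S. g x = - real j}" by auto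
    moreover have "{x \<in> S. g x = real j} \<inter> {x \<in> S. g x = - real j} = {}" using that by auto
    ultimately show ?thesis using fin by (simp add: card_Un_disjoint)
  qed
  have "(\<Sum>x\<in>S. F (g x)) = (\<Sum>j\<le>J. real (card {x \<in> S. \<bar>g x\<bar> = real j}) * F (real j))"
    using sum.group[OF fin _ hJ, of "\<lambda>x. F (g x)"] by (simp add: grp)
  also have "{..J} = insert 0 {1..J}" by auto
  also have "(\<Sum>j\<in>insert 0 {1..J}. real (card {x \<in> S. \<bar>g x\<bar> = real j}) * F (real j))
    = real (card {x \<in> S. g x = 0}) * F 0 + (\<Sum>j=1..J. 2 * (real (card {x \<in> S. g x = real j}) * F (real j)))"
    by (subst sum.insert) (auto simp: two intro!: sum.cong)
  finally show ?thesis by (simp add: sum_distrib_left)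
qed

section \<open>Inner product counts in norms 8 and 10\<close>

context self_dual_lattice
begin

lemma L_add: "x \<in> L \<Longrightarrow> y \<in> L \<Longrightarrow> x + y \<in> L"
  and L_minus: "x \<in> L \<Longrightarrow> - x \<in> L"
proof -
  show "x + y \<in> L" if xy: "x \<in> L" "y \<in> L"
  proof -
    obtain c d where "x = (\<Sum>i<n. of_int (c i) *\<^sub>R b i)" "y = (\<Sum>i<n. of_int (d i) *\<^sub>R b i)"
      using xy unfolding L_def zspan_def by blast
    then have "x + y = (\<Sum>i<n. of_int (c i + d i) *\<^sub>R b i)" by (simp add: scaleR_add_left sum.distrib)
    then show ?thesis unfolding L_def using zspanI[where n = n and b = b and c = "\<lambda>i. c i + d i"] by simp
  qed
  show "- x \<in> L" if xL: "x \<in> L"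
  proof -
    obtain c where "x = (\<Sum>i<n. of_int (c i) *\<^sub>R b i)" using xL unfolding L_def zspan_def by blast
    then have "- x = (\<Sum>i<n. of_int (- c i) *\<^sub>R b i)" by (simp add: sum_negf)
    then show ?thesis unfolding L_def using zspanI[where n = n and b = b and c = "\<lambda>i. - c i"] by simp
  qed
qed

lemma L_diff: "x \<in> L \<Longrightarrow> y \<in> L \<Longrightarrow> x - y \<in> L"
  using L_add[of x "- y"] L_minus[of y] by simp

lemma L_inner: "x \<in> L \<Longrightarrow> y \<in> L \<Longrightarrow> x \<bullet> y \<in> \<int>"
proof -
  assume x: "x \<in> L" and y: "y \<in> L"
  have "x \<in> zdual n b" using x by (simp add: L_def self_dual)
  obtain c where "y = (\<Sum>i<n. of_int (c i) *\<^sub>R b i)" using y by (auto simp: L_def zspan_def)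
  then have "x \<bullet> y = (\<Sum>i<n. of_int (c i) * (x \<bullet> b i))" by (simp add: inner_sum_right)
  also have "\<dots> \<in> \<int>" using \<open>x \<in> zdual n b\<close> by (intro Ints_sum Ints_mult) (auto simp: zdual_def)
  finally show ?thesis .
qed

definition inner_count :: "nat \<Rightarrow> 'a \<Rightarrow> nat \<Rightarrow> nat" where
  "inner_count K a j = card {x \<in> half_norm_shell K. a \<bullet> x = real j}"

lemma sum_half_norm_shell:
  assumes a: "a \<in> L" and bound: "\<And>x. x \<in> half_norm_shell K \<Longrightarrow> a \<bullet> x \<le> real J" and F: "\<And>y. F (- y) = F y"
  shows "(\<Sum>x\<in>half_norm_shell K. F (a \<bullet> x)) = real (inner_count K a 0) * F 0
    + 2 * (\<Sum>j=1..J. real (inner_count K a j) * F (real j))"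
proof -
  have neg: "- x \<in> half_norm_shell K" if "x \<in> half_norm_shell K" for x
    using that L_minus by (simp add: half_norm_shell_def)
  have "\<bar>a \<bullet> x\<bar> \<le> real J" if "x \<in> half_norm_shell K" for x
    using bound[OF that] bound[OF neg[OF that]] by (simp add: abs_le_iff)
  then show ?thesis
    using sum_by_abs_values[of "half_norm_shell K" "\<lambda>x. a \<bullet> x" J F] finite_half_norm_shell neg L_inner[OF a] F
    by (simp add: half_norm_shell_def inner_count_def)
qed

text \<open>Expand \<open>(a - x) \<bullet> (a - x) \<ge> 8\<close> with
  \<open>x \<bullet> x = 2 K\<close>. This second use of the minimum leaves few enough unknown
  counts for five equations.\<close>

lemma inner_le:
  assumes minimum: "\<And>x. x \<in> L \<Longrightarrow> x \<noteq> 0 \<Longrightarrow> x \<bullet> x \<ge> 8"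
    and a: "a \<in> L" "a \<bullet> a = 8" and x: "x \<in> half_norm_shell K" "x \<noteq> a"
  shows "a \<bullet> x \<le> real K"
proof -
  have "(a - x) \<bullet> (a - x) \<ge> 8" using x a by (intro minimum L_diff) (auto simp: half_norm_shell_def)
  then show ?thesis using a(2) x(1) by (simp add: half_norm_shell_def inner_diff_left inner_diff_right inner_commute)
qed

context
  fixes a :: 'a
  assumes n: "n = 72"
    and even: "\<And>x. x \<in> L \<Longrightarrow> \<exists>k::int. x \<bullet> x = 2 * of_int k"
    and minimum: "\<And>x. x \<in> L \<Longrightarrow> x \<noteq> 0 \<Longrightarrow> x \<bullet> x \<ge> 8"
    and a: "a \<in> L" "a \<bullet> a = 8"
begin

lemma design_equation:
  assumes N: "0 < N" "N < 6" and bound: "\<And>x. x \<in> half_norm_shell K \<Longrightarrow> a \<bullet> x \<le> real J"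
  defines "F \<equiv> \<lambda>y. zonal N (2 * real K - y\<^sup>2 / 8) y"
  shows "real (inner_count K a 0) * F 0 + 2 * (\<Sum>j=1..J. real (inner_count K a j) * F (real j)) = 0"
proof -
  have "F (- y) = F y" for y by (simp add: F_def zonal_def power_mult)
  from sum_half_norm_shell[of a K J F, OF a(1) bound this] show ?thesis
    using zonal_sum_eq_0[OF n even minimum a N, of K] by (simp add: F_def)
qed

lemma inner_count_4:
  "inner_count 4 a 5 = 0" "inner_count 4 a 6 = 0" "inner_count 4 a 7 = 0" "inner_count 4 a 8 = 1"
proof -
  have le: "a \<bullet> x \<le> 4" if "x \<in> half_norm_shell 4" "x \<noteq> a" for x
    using inner_le[OF minimum a that] by simp
  have "{x \<in> half_norm_shell 4. a \<bullet> x = real 5} = {}" "{x \<in> half_norm_shell 4. a \<bullet> x = real 6} = {}"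
    "{x \<in> half_norm_shell 4. a \<bullet> x = real 7} = {}"
    using le a(2) by fastforce+
  then show "inner_count 4 a 5 = 0" "inner_count 4 a 6 = 0" "inner_count 4 a 7 = 0"
    unfolding inner_count_def by (simp_all only: card.empty)
  have "{x \<in> half_norm_shell 4. a \<bullet> x = 8} = {a}"
    using le a by (fastforce simp: half_norm_shell_def)
  then show "inner_count 4 a 8 = 1" unfolding inner_count_def by simp
qed

text \<open>Five equations for the counts at 0 to 4; the single vector at inner product 8, namely
  \<open>a\<close>, makes the system inhomogeneous and fixes the scale.\<close>

lemma inner_count_3: "inner_count 4 a 3 = 13959168"
proof -
  have bound: "a \<bullet> x \<le> real 8" if "x \<in> half_norm_shell 4" for x
    using inner_le[OF minimum a that] a(2) by (cases "x = a") auto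
  have J: "{1..8::nat} = {1, 2, 3, 4, 5, 6, 7, 8}" by auto
  note eq = design_equation[where K = 4 and J = 8, OF _ _ bound, unfolded J]
  have "real (inner_count 4 a 3) = 13959168"
    \<comment> \<open>The zonal polynomials are evaluated at each inner product, which leaves a
      linear system in the counts with rational coefficients.\<close>
    using eq[of "Suc 0", simplified zonal_polynomials, simplified, simplified power_divide, simplified] eq[of 2, simplified zonal_polynomials, simplified, simplified power_divide, simplified]
      eq[of 3, simplified zonal_polynomials, simplified, simplified power_divide, simplified] eq[of 4, simplified zonal_polynomials, simplified, simplified power_divide, simplified]
      eq[of 5, simplified zonal_polynomials, simplified, simplified power_divide, simplified] inner_count_4
    by linarith
  then show ?thesis by simp
qed

text \<open>Norm \<open>8 - 2 * 5 + 10 = 8\<close> and inner product \<open>8 - 5 = 3\<close>; the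
  map is its own inverse.\<close>

lemma inner_count_5_5: "inner_count 5 a 5 = inner_count 4 a 3"
proof -
  have "bij_betw (\<lambda>x. a - x) {x \<in> half_norm_shell 5. a \<bullet> x = real 5} {x \<in> half_norm_shell 4. a \<bullet> x = real 3}"
    by (rule bij_betwI[of _ _ _ "\<lambda>x. a - x"])
       (use a in \<open>auto simp: half_norm_shell_def inner_diff_left inner_diff_right inner_commute intro!: L_diff\<close>)
  then show ?thesis unfolding inner_count_def by (rule bij_betw_same_card)
qed

lemma bound_5: "x \<in> half_norm_shell 5 \<Longrightarrow> a \<bullet> x \<le> real 5"
  using inner_le[OF minimum a, of x 5] a(2) by (cases "x = a") (auto simp: half_norm_shell_def)

text \<open>Five homogeneous equations in six counts fix the ratios; the count at 5, imported from
  norm 8, sets the scale.\<close>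

lemma inner_count_5:
  "inner_count 5 a 0 = 5723204788224" "inner_count 5 a 1 = 3708252979200" "inner_count 5 a 2 = 975222374400"
  "inner_count 5 a 3 = 93206937600" "inner_count 5 a 4 = 2595532800" "inner_count 5 a 5 = 13959168"
proof -
  have J: "{1..5::nat} = {1, 2, 3, 4, 5}" by auto
  note eq = design_equation[where K = 5 and J = 5, OF _ _ bound_5, unfolded J]
  show c5: "inner_count 5 a 5 = 13959168" using inner_count_5_5 inner_count_3 by simp
  then have c5': "real (inner_count 5 a 5) = 13959168" by simp
  have "real (inner_count 5 a 0) = 5723204788224 \<and> real (inner_count 5 a (Suc 0)) = 3708252979200 \<and>
    real (inner_count 5 a 2) = 975222374400 \<and> real (inner_count 5 a 3) = 93206937600 \<and> real (inner_count 5 a 4) = 2595532800"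
    using eq[of "Suc 0", simplified zonal_polynomials, simplified, simplified power_divide, simplified] eq[of 2, simplified zonal_polynomials, simplified, simplified power_divide, simplified]
      eq[of 3, simplified zonal_polynomials, simplified, simplified power_divide, simplified] eq[of 4, simplified zonal_polynomials, simplified, simplified power_divide, simplified]
      eq[of 5, simplified zonal_polynomials, simplified, simplified power_divide, simplified] c5'
    by (intro conjI; linarith)
  then show "inner_count 5 a 0 = 5723204788224" "inner_count 5 a 1 = 3708252979200" "inner_count 5 a 2 = 975222374400"
    "inner_count 5 a 3 = 93206937600" "inner_count 5 a 4 = 2595532800" by simp_all
qed

lemma card_half_norm_shell_5:
  "card (half_norm_shell 5) = inner_count 5 a 0 + 2 * (\<Sum>j=1..5. inner_count 5 a j)"
proof -
  have "real (card (half_norm_shell 5)) = real (inner_count 5 a 0 + 2 * (\<Sum>j=1..5. inner_count 5 a j))"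
    using sum_half_norm_shell[of a 5 5 "\<lambda>_. 1", OF a(1) bound_5] by simp
  then show ?thesis by linarith
qed

end

end

text \<open>Enumerates the basis set. The two notions of dual agree because lattice and basis have
  the same real span, and integrality against the basis extends to the lattice by integer
  linearity.\<close>

lemma self_dual_lattice_exists:
  assumes "lattice_of_rank n L" "unimodular_lattice L"
  shows "\<exists>b. self_dual_lattice n b L"
proof -
  obtain B where B: "finite B" "independent B" "card B = n"
    and L: "L = {\<Sum>b\<in>B. of_int (c b) *\<^sub>R b | c :: 'a \<Rightarrow> int. True}"
    using assms(1) unfolding lattice_of_rank_def by blast
  obtain h where h: "bij_betw h {..<n} B"
    using ex_bij_betw_nat_finite[OF B(1)] B(3) by (auto simp: atLeast0LessThan)
  define k where "k = inv_into {..<n} h"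
  have kh: "k (h i) = i" if "i < n" for i
    using that h by (simp add: k_def bij_betw_def inv_into_f_f)
  have re: "(\<Sum>v\<in>B. f v) = (\<Sum>i<n. f (h i))" for f :: "'a \<Rightarrow> 'a"
    using sum.reindex_bij_betw[OF h, of f] by simp
  have LZ: "L = zspan n h"
  proof (intro equalityI subsetI)
    fix x assume "x \<in> L"
    then obtain c where "x = (\<Sum>b\<in>B. of_int (c b) *\<^sub>R b)" using L by auto
    then have "x = (\<Sum>i<n. of_int (c (h i)) *\<^sub>R h i)" by (simp add: re)
    then show "x \<in> zspan n h" using zspanI[where n = n and b = h and c = "\<lambda>i. c (h i)"] by simp
  next
    fix x assume "x \<in> zspan n h"
    then obtain c where "x = (\<Sum>i<n. of_int (c i) *\<^sub>R h i)" by (auto simp: zspan_def)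
    also have "\<dots> = (\<Sum>i<n. of_int (c (k (h i))) *\<^sub>R h i)" by (intro sum.cong) (auto simp: kh)
    finally have "x = (\<Sum>v\<in>B. of_int (c (k v)) *\<^sub>R v)" by (simp add: re)
    then show "x \<in> L" unfolding L by (intro CollectI exI[of _ "\<lambda>v. c (k v)"]) simp
  qed
  have spanB: "span B = rspan n h"
  proof (intro equalityI subsetI)
    fix x assume "x \<in> span B"
    then obtain u where "x = (\<Sum>v\<in>B. u v *\<^sub>R v)" using span_finite[OF B(1)] by auto
    then have "x = (\<Sum>i<n. u (h i) *\<^sub>R h i)" by (simp add: re)
    then show "x \<in> rspan n h" using rspanI[where n = n and b = h and x = "\<lambda>i. u (h i)"] by simp
  next
    fix x assume "x \<in> rspan n h"
    then obtain c where x: "x = (\<Sum>i<n. c i *\<^sub>R h i)" by (auto simp: rspan_def)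
    have "h i \<in> B" if "i < n" for i using that h by (auto simp: bij_betw_def)
    then show "x \<in> span B" unfolding x by (intro span_sum span_scale span_base) auto
  qed
  have hL: "h i \<in> L" if "i < n" for i
  proof -
    have "h i = (\<Sum>j<n. of_int (if j = i then 1 else 0) *\<^sub>R h j)"
      using that by (simp add: if_distrib[of of_int] if_distrib[of "\<lambda>r. r *\<^sub>R _"] cong: if_cong)
    then show ?thesis unfolding LZ using zspanI[where n = n and b = h and c = "\<lambda>j. if j = i then 1 else 0"] by simp
  qed
  have spanL: "span L = rspan n h"
  proof (rule antisym)
    have "L \<subseteq> span B" unfolding spanB LZ by (rule zspan_subset_rspan)
    then show "span L \<subseteq> rspan n h" unfolding spanB[symmetric] using span_minimal subspace_span by blast
    have "B \<subseteq> L" using hL h by (auto simp: bij_betw_def)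
    then show "rspan n h \<subseteq> span L" unfolding spanB[symmetric] by (rule span_mono)
  qed
  have "dual_lattice L = zdual n h"
  proof (intro equalityI subsetI)
    fix y assume "y \<in> dual_lattice L"
    then show "y \<in> zdual n h" using hL by (auto simp: dual_lattice_def zdual_def spanL inner_commute)
  next
    fix y assume y: "y \<in> zdual n h"
    have "x \<bullet> y \<in> \<int>" if x: "x \<in> L" for x
    proof -
      obtain c where "x = (\<Sum>i<n. of_int (c i) *\<^sub>R h i)" using x by (auto simp: LZ zspan_def)
      then have "x \<bullet> y = (\<Sum>i<n. of_int (c i) * (y \<bullet> h i))" by (simp add: inner_sum_left inner_sum_right inner_commute[of _ y])
      also have "\<dots> \<in> \<int>" using y by (intro Ints_sum Ints_mult) (auto simp: zdual_def)
      finally show ?thesis .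
    qed
    then show "y \<in> dual_lattice L" using y by (auto simp: dual_lattice_def zdual_def spanL)
  qed
  moreover have "lin_indep n h" unfolding lin_indep_def
  proof (intro allI impI)
    fix x i assume x: "(\<Sum>i<n. x i *\<^sub>R h i) = 0" and i: "i < n"
    have "(\<Sum>v\<in>B. x (k v) *\<^sub>R v) = (\<Sum>i<n. x i *\<^sub>R h i)" unfolding re by (intro sum.cong) (auto simp: kh)
    moreover have "h i \<in> B" using i h by (auto simp: bij_betw_def)
    ultimately have "x (k (h i)) = 0" using independentD[OF B(2) B(1) subset_refl, of "\<lambda>v. x (k v)" "h i"] x by simp
    then show "x i = 0" by (simp add: kh[OF i])
  qed
  ultimately have "self_dual_lattice n h L"
    using assms(2) LZ by unfold_locales (auto simp: unimodular_lattice_def)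
  then show ?thesis by blast
qed

lemma min_norm_le:
  assumes "x \<in> L" "x \<noteq> 0"
  shows "min_norm L \<le> x \<bullet> x"
  unfolding min_norm_def by (rule cInf_lower) (use assms in \<open>auto intro!: bdd_belowI[of _ 0]\<close>)

theorem proposition3:
  fixes L :: "'a::real_inner set" and x\<^sub>0 :: 'a
  assumes "extremal_type_II_lattice 72 L"
    and "x\<^sub>0 \<in> shell 8 L"
  shows "(\<forall>x\<^sub>1\<in>shell 8 L. \<forall>j\<in>{0..5}. shell10_mult L x\<^sub>1 j = shell10_mult L x\<^sub>0 j)
    \<and> shell10_mult L x\<^sub>0 0 = 5723204788224
    \<and> shell10_mult L x\<^sub>0 1 = 3708252979200
    \<and> shell10_mult L x\<^sub>0 2 = 975222374400
    \<and> shell10_mult L x\<^sub>0 3 = 93206937600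
    \<and> shell10_mult L x\<^sub>0 4 = 2595532800
    \<and> shell10_mult L x\<^sub>0 5 = 13959168
    \<and> (\<forall>j\<in>{0..5}. shell10_mult L x\<^sub>0 j > 0)
    \<and> shell10_mult L x\<^sub>0 0 + 2 * (\<Sum>j=1..5. shell10_mult L x\<^sub>0 j) = card (shell 10 L)"
proof -
  have L: "lattice_of_rank 72 L" "even_lattice L" "unimodular_lattice L" and m8: "min_norm L = 8"
    using assms(1) by (auto simp: extremal_type_II_lattice_def type_II_lattice_def)
  obtain b where "self_dual_lattice 72 b L" using self_dual_lattice_exists[OF L(1,3)] by blast
  then interpret self_dual_lattice 72 b L .
  have even: "\<And>x. x \<in> L \<Longrightarrow> \<exists>k::int. x \<bullet> x = 2 * of_int k" using L(2) by (auto simp: even_lattice_def)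
  have minimum: "\<And>x. x \<in> L \<Longrightarrow> x \<noteq> 0 \<Longrightarrow> x \<bullet> x \<ge> 8" using min_norm_le m8 by metis
  have sh: "half_norm_shell 5 = shell 10 L" by (auto simp: half_norm_shell_def shell_def)
  have mult: "shell10_mult L a (int j) = inner_count 5 a j" for a j
    by (simp add: shell10_mult_def inner_count_def sh)
  \<comment> \<open>Stated for every \<open>a\<close> of norm 8, so that independence of
    \<open>x\<^sub>0\<close> follows by comparing values.\<close>
  have vals: "shell10_mult L a 0 = 5723204788224" "shell10_mult L a 1 = 3708252979200"
    "shell10_mult L a 2 = 975222374400" "shell10_mult L a 3 = 93206937600"
    "shell10_mult L a 4 = 2595532800" "shell10_mult L a 5 = 13959168"
    "shell10_mult L a 0 + 2 * (\<Sum>j=1..5. shell10_mult L a j) = card (shell 10 L)"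
    if "a \<in> shell 8 L" for a
  proof -
    have a: "a \<in> L" "a \<bullet> a = 8" using that by (auto simp: shell_def)
    note c = inner_count_5[OF refl even minimum a]
    show v: "shell10_mult L a 0 = 5723204788224" "shell10_mult L a 1 = 3708252979200"
      "shell10_mult L a 2 = 975222374400" "shell10_mult L a 3 = 93206937600"
      "shell10_mult L a 4 = 2595532800" "shell10_mult L a 5 = 13959168"
      using c mult[of a 0] mult[of a 1] mult[of a 2] mult[of a 3] mult[of a 4] mult[of a 5] by simp_all
    have "{1..5::nat} = {1, 2, 3, 4, 5}" "{1..5::int} = {1, 2, 3, 4, 5}" by auto
    then show "shell10_mult L a 0 + 2 * (\<Sum>j=1..5. shell10_mult L a j) = card (shell 10 L)"
      using card_half_norm_shell_5[OF refl even minimum a] c v by (simp add: sh)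
  qed
  have "{0..5::int} = {0, 1, 2, 3, 4, 5}" by auto
  then show ?thesis using vals assms(2) by simp
qed

end
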